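(* Let $s\in(0,1)$ and $0<\alpha<2s<n$. Put $2^*_s=\frac{2n}{n-2s}$, $2^*_s(\alpha)=\frac{2(n-\alpha)}{n-2s}$, $r=\frac{\alpha}{2^*_s(\alpha)}$ and $\bar\theta=\max\Big\{\frac{2}{2^*_s(\alpha)},\frac{2^*_s-1}{2^*_s(\alpha)}\Big\}>0$. Then there exists a constant $C=C(n,s,\alpha)>0$ such that for any $\theta\in(\bar\theta,1)$ and any $p\in[1,2^*_s(\alpha))$, $$\Big(\int_{\mathbb{R}^n}\frac{|u(y)|^{2^*_s(\alpha)}}{|y|^\alpha}dy\Big)^{\frac{1}{2^*_s(\alpha)}}\le C\,\|u\|_{\dot H^s(\mathbb{R}^n)}^{\theta}\,\|u\|_{L^{p,\frac{n-2s}{2}p+pr}(\mathbb{R}^n,|y|^{-pr})}^{1-\theta}\qquad\text{for all }u\in\dot H^s(\mathbb{R}^n).$$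
   Context: $\dot H^s(\mathbb{R}^n)=\{u\in L^{2n/(n-2s)}(\mathbb{R}^n): |\xi|^s\hat u(\xi)\in L^2(\mathbb{R}^n)\}$ (the completion of $C_0^\infty(\mathbb{R}^n)$) with norm $\|u\|_{\dot H^s}^2=\int|\xi|^{2s}|\hat u(\xi)|^2d\xi=\int|(-\Delta)^{s/2}u|^2dx$. For $p\in[1,\infty)$, $\gamma,\lambda>0$ with $\gamma+\lambda\in(0,n)$, the weighted Morrey norm of a Lebesgue measurable $u:\mathbb{R}^n\to\mathbb{R}$ is $$\|u\|_{L^{p,\gamma+\lambda}(\mathbb{R}^n,|y|^{-\lambda})}=\sup_{R>0,\,x\in\mathbb{R}^n}\Big\{R^{\gamma+\lambda-n}\int_{B_R(x)}\frac{|u(y)|^p}{|y|^\lambda}dy\Big\}^{1/p};$$ here it is used with $\gamma=\frac{n-2s}{2}p$ and $\lambda=pr$. *)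

theory Defs
  imports "HOL-Analysis.Analysis"
begin

text \<open>Only used with a positive exponent, hence \<open>\<infinity>\<close> is mapped to \<open>\<infinity>\<close>.\<close>

definition epowr :: "ennreal \<Rightarrow> real \<Rightarrow> ennreal" where
  "epowr x a = (if x = \<infinity> then \<infinity> else ennreal (enn2real x powr a))"

definition Lp_space :: "real \<Rightarrow> ('a::euclidean_space \<Rightarrow> real) set" where
  "Lp_space p = {u. u \<in> borel_measurable lebesgue \<and> integrable lebesgue (\<lambda>x. \<bar>u x\<bar> powr p)}"

fun partial_derivs :: "'a::euclidean_space list \<Rightarrow> ('a \<Rightarrow> complex) \<Rightarrow> 'a \<Rightarrow> complex" where
  "partial_derivs [] f = f"
| "partial_derivs (b # bs) f = (\<lambda>x. frechet_derivative (partial_derivs bs f) (at x) b)"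

definition schwartz :: "('a::euclidean_space \<Rightarrow> complex) set" where
  "schwartz = {f. \<forall>bs \<in> lists Basis.
     (\<forall>x. partial_derivs bs f differentiable (at x)) \<and>
     (\<forall>k::nat. bounded (range (\<lambda>x. norm x ^ k *\<^sub>R partial_derivs bs f x)))}"

text \<open>The unitary normalisation, for which \<open>(-\<Delta>)\<^sup>s\<^sup>/\<^sup>2\<close> has symbol \<open>|\<xi>|\<^sup>s\<close> and Plancherel's
  identity holds without a constant.\<close>

definition fourier_integral :: "('a::euclidean_space \<Rightarrow> complex) \<Rightarrow> 'a \<Rightarrow> complex" where
  "fourier_integral f \<xi> =
     complex_of_real ((2 * pi) powr (- real DIM('a) / 2)) *
     (LINT x|lebesgue. cis (- (x \<bullet> \<xi>)) * f x)"

text \<open>A function in \<open>L\<^sup>q\<close> with \<open>q > 2\<close> has no Fourier integral in general; its Fourier transform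
  is that of the tempered distribution it induces. The predicate says that this transform is the
  distribution induced by the function \<open>g\<close>, which is then unique up to null sets.\<close>

definition has_fourier_transform ::
  "('a::euclidean_space \<Rightarrow> real) \<Rightarrow> ('a \<Rightarrow> complex) \<Rightarrow> bool" where
  "has_fourier_transform u g \<longleftrightarrow>
     u \<in> borel_measurable lebesgue \<and> g \<in> borel_measurable lebesgue \<and>
     (\<forall>\<phi>\<in>schwartz.
        integrable lebesgue (\<lambda>x. complex_of_real (u x) * \<phi> x) \<and>
        integrable lebesgue (\<lambda>\<xi>. g \<xi> * \<phi> \<xi>) \<and>
        (LINT x|lebesgue. complex_of_real (u x) * fourier_integral \<phi> x) =
        (LINT \<xi>|lebesgue. g \<xi> * \<phi> \<xi>))"

definition fourier_transform :: "('a::euclidean_space \<Rightarrow> real) \<Rightarrow> 'a \<Rightarrow> complex" where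
  "fourier_transform u = (SOME g. has_fourier_transform u g)"

definition Hdot :: "real \<Rightarrow> ('a::euclidean_space \<Rightarrow> real) set" where
  "Hdot s = {u \<in> Lp_space (2 * real DIM('a) / (real DIM('a) - 2 * s)).
     \<exists>g. has_fourier_transform u g \<and>
         integrable lebesgue (\<lambda>\<xi>. norm \<xi> powr (2 * s) * (norm (g \<xi>))\<^sup>2)}"

definition Hdot_norm :: "real \<Rightarrow> ('a::euclidean_space \<Rightarrow> real) \<Rightarrow> real" where
  "Hdot_norm s u =
     sqrt (LINT \<xi>|lebesgue. norm \<xi> powr (2 * s) * (norm (fourier_transform u \<xi>))\<^sup>2)"

text \<open>\<open>morrey_norm p \<mu> l u\<close> is the norm of \<open>u\<close> in \<open>L\<^sup>p\<^sup>,\<^sup>\<mu>(\<real>\<^sup>n, |y|\<^sup>-\<^sup>l)\<close>, where \<open>\<mu> = \<gamma> + l\<close>.\<close>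

definition morrey_norm ::
  "real \<Rightarrow> real \<Rightarrow> real \<Rightarrow> ('a::euclidean_space \<Rightarrow> real) \<Rightarrow> ennreal" where
  "morrey_norm p \<mu> l u =
     (SUP (R, x) \<in> {0<..} \<times> UNIV.
        epowr (ennreal (R powr (\<mu> - real DIM('a))) *
               (\<integral>\<^sup>+ y \<in> ball x R. ennreal (\<bar>u y\<bar> powr p / norm y powr l) \<partial>lebesgue))
              (1 / p))"

end

theory Submission
  imports Defs "HOL-Probability.Characteristic_Functions"
begin

text \<open>
  Put \<open>q = 2\<^sup>*\<^sub>s(\<alpha>)\<close> and \<open>v = |u| / |y|\<^sup>r\<close>, so that the left-hand side is the \<open>L\<^sup>q\<close> norm of \<open>v\<close>. A pointwise
  argument in the spirit of Hedberg bounds \<open>v\<^sup>q\<close> by \<open>M\<^sup>q\<^sup>-\<^sup>2\<close> times the sum of the Hardy integrand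
  \<open>u\<^sup>2 / |x|\<^sup>2\<^sup>s\<close> and the Gagliardo density \<open>\<integral>|u(x+h) - u(x)|\<^sup>2 / |h|\<^sup>n\<^sup>+\<^sup>2\<^sup>s dh\<close>, where \<open>M\<close> is the Morrey norm
  for \<open>p = 1\<close>. Both integrals are at most a constant times the square of the \<open>Hdot s\<close> norm: the Gagliardo
  energy by the Plancherel inequality for the differences \<open>u(\<cdot> + h) - u\<close>, which is obtained by Gaussian
  regularisation, and the Hardy integral by comparison with the Gagliardo energy. This gives the
  theorem for \<open>\<theta> = 2/q\<close>. The Morrey norm is increasing in \<open>p\<close> and at most a constant times the norm of
  \<open>v\<close>, hence also of \<open>u\<close>, up to constants independent of \<open>p\<close>; this yields the remaining \<open>p\<close> and \<open>\<theta>\<close>.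
\<close>

subsection \<open>Gaussian integrals\<close>

text \<open>Elements of \<open>Hdot s\<close> lie in \<open>L^p\<close> with \<open>p > 2\<close>,
  so in general their transform exists only through its pairing with Schwartz functions. Gaussians
  are Schwartz functions with explicit Fourier integrals; pairing with modulated ones writes the
  Gaussian means of \<open>u\<close> as Fourier integrals of integrable functions, on which
  classical arguments work. The way back from the means to \<open>u\<close> is by duality, since
  nothing beyond integrability against Gaussians is known at that stage. Only the upper half of
  Plancherel's identity is required, because the Gagliardo energy only has to be bounded from above.
  Two arguments absorb a term into the left-hand side (the Hardy inequality) or cancel a power of it
  (the interpolation). Both need that side to be finite beforehand, and this is where membership of
  \<open>u\<close> in \<open>L^p\<close> enters. At \<theta> = 2/q the Morrey norm carries the power
  1 - 2/q. For larger \<theta> the surplus \<theta> - 2/q is paid by the \<open>Hdot s\<close> norm;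
  as the surplus is at most 1, the constant can be chosen independent of \<theta>.\<close>

lemma borel_measurable_cis [measurable]: "cis \<in> borel_measurable borel"
  by (intro borel_measurable_continuous_onI continuous_intros)

section \<open>Affine substitutions\<close>

lemma nn_integral_lborel_affine:
  fixes f :: "'a::euclidean_space \<Rightarrow> ennreal"
  assumes [measurable]: "f \<in> borel_measurable borel" and "c \<noteq> 0"
  shows "(\<integral>\<^sup>+x. f x \<partial>lborel) = ennreal (\<bar>c\<bar> ^ DIM('a)) * (\<integral>\<^sup>+x. f (t + c *\<^sub>R x) \<partial>lborel)"
  by (subst lborel_affine[OF \<open>c \<noteq> 0\<close>, of t])
     (simp add: nn_integral_density nn_integral_distr nn_integral_cmult)

lemma integral_lborel_affine:
  fixes f :: "'a::euclidean_space \<Rightarrow> 'b::{banach, second_countable_topology}"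
  assumes [measurable]: "f \<in> borel_measurable borel" and "c \<noteq> 0"
  shows "(LINT x|lborel. f x) = (\<bar>c\<bar> ^ DIM('a)) *\<^sub>R (LINT x|lborel. f (t + c *\<^sub>R x))"
  by (subst lborel_affine[OF \<open>c \<noteq> 0\<close>, of t])
     (simp add: integral_density integral_distr)

lemma integrable_lborel_affine_iff:
  fixes f :: "'a::euclidean_space \<Rightarrow> 'b::{banach, second_countable_topology}"
  assumes [measurable]: "f \<in> borel_measurable borel" and "c \<noteq> 0"
  shows "integrable lborel (\<lambda>x. f (t + c *\<^sub>R x)) \<longleftrightarrow> integrable lborel f"
proof -
  have "integrable lborel f \<longleftrightarrow> integrable lborel (\<lambda>x. \<bar>c\<bar> ^ DIM('a) *\<^sub>R f (t + c *\<^sub>R x))"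
    by (subst lborel_affine[OF \<open>c \<noteq> 0\<close>, of t]) (simp add: integrable_density integrable_distr_eq)
  also have "\<dots> \<longleftrightarrow> integrable lborel (\<lambda>x. f (t + c *\<^sub>R x))"
    using assms(2) integrable_scaleR_right[of "1 / \<bar>c\<bar> ^ DIM('a)" lborel "\<lambda>x. \<bar>c\<bar> ^ DIM('a) *\<^sub>R f (t + c *\<^sub>R x)"]
    by auto
  finally show ?thesis ..
qed

lemma nn_integral_lborel_translation:
  fixes f :: "'a::euclidean_space \<Rightarrow> ennreal"
  assumes "f \<in> borel_measurable borel"
  shows "(\<integral>\<^sup>+x. f (t + x) \<partial>lborel) = (\<integral>\<^sup>+x. f x \<partial>lborel)"
  using nn_integral_lborel_affine[OF assms, of 1 t] by simp

lemma integral_lborel_translation: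
  fixes f :: "'a::euclidean_space \<Rightarrow> 'b::{banach, second_countable_topology}"
  assumes "f \<in> borel_measurable borel"
  shows "(LINT x|lborel. f (t + x)) = (LINT x|lborel. f x)"
  using integral_lborel_affine[OF assms, of 1 t] by simp

text \<open>Up to the factor \<open>sqrt (2 * pi)\<close> the integrand is the standard normal
  density times \<open>iexp\<close>, so the integral is the characteristic function of the normal
  law.\<close>

lemma gaussian_fourier_integral_real:
  fixes y :: real
  shows "integrable lborel (\<lambda>x::real. cis (y * x) * complex_of_real (exp (- x\<^sup>2 / 2)))"
    and "(LINT x|lborel. cis (y * x) * complex_of_real (exp (- x\<^sup>2 / 2))) =
      complex_of_real (sqrt (2 * pi) * exp (- y\<^sup>2 / 2))"
proof -
  have eq: "(\<lambda>x. cis (y * x) * complex_of_real (exp (- x\<^sup>2 / 2))) =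
     (\<lambda>x. sqrt (2 * pi) *\<^sub>R (std_normal_density x *\<^sub>R iexp (y * x)))"
    by (auto simp: fun_eq_iff std_normal_density_def cis_conv_exp scaleR_conv_of_real mult.commute)
  have "integrable std_normal_distribution (\<lambda>x. iexp (y * x))"
    by (rule finite_measure.integrable_const_bound[where B=1])
       (auto intro!: prob_space_normal_density prob_space.finite_measure)
  then have int: "integrable lborel (\<lambda>x. std_normal_density x *\<^sub>R iexp (y * x))"
    by (subst (asm) integrable_density) auto
  then show "integrable lborel (\<lambda>x::real. cis (y * x) * complex_of_real (exp (- x\<^sup>2 / 2)))"
    unfolding eq by (rule integrable_scaleR_right)
  have "(LINT x|lborel. std_normal_density x *\<^sub>R iexp (y * x)) = char std_normal_distribution y"
    unfolding char_def by (subst integral_density) auto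
  then have *: "(LINT x|lborel. std_normal_density x *\<^sub>R iexp (y * x)) = complex_of_real (exp (- y\<^sup>2 / 2))"
    by (simp add: char_std_normal_distribution)
  show "(LINT x|lborel. cis (y * x) * complex_of_real (exp (- x\<^sup>2 / 2))) =
      complex_of_real (sqrt (2 * pi) * exp (- y\<^sup>2 / 2))"
    unfolding eq integral_scaleR_right * by (simp add: scaleR_conv_of_real)
qed

lemma cis_sum: "finite A \<Longrightarrow> cis (\<Sum>x\<in>A. f x) = (\<Prod>x\<in>A. cis (f x))"
  by (induction A rule: finite_induct) (auto simp: cis_mult[symmetric])

text \<open>Lebesgue measure on \<open>'a\<close> is the image under \<open>?S\<close> of a product
  of one-dimensional Lebesgue measures, and both the character and the Gaussian factor over the
  orthonormal basis.\<close>

lemma gaussian_fourier_integral: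
  fixes y :: "'a::euclidean_space"
  shows "integrable lborel (\<lambda>x::'a. cis (y \<bullet> x) * complex_of_real (exp (- (norm x)\<^sup>2 / 2)))"
    and "(LINT x|lborel. cis (y \<bullet> x) * complex_of_real (exp (- (norm x)\<^sup>2 / 2))) =
      complex_of_real ((2 * pi) powr (DIM('a) / 2) * exp (- (norm y)\<^sup>2 / 2))"
proof -
  interpret product_sigma_finite "\<lambda>b::'a. (lborel :: real measure)"
    by (simp add: product_sigma_finite.intro sigma_finite_lborel)
  let ?P = "\<Pi>\<^sub>M b\<in>(Basis::'a set). (lborel :: real measure)"
  let ?g = "\<lambda>(b::'a) (x::real). cis ((y \<bullet> b) * x) * complex_of_real (exp (- x\<^sup>2 / 2))"
  let ?S = "\<lambda>f::'a \<Rightarrow> real. \<Sum>b\<in>Basis. f b *\<^sub>R b"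
  have S [measurable]: "?S \<in> measurable ?P borel"
    by measurable
  have nrm: "(norm x)\<^sup>2 = (\<Sum>b\<in>Basis. (x \<bullet> b)\<^sup>2)" for x :: 'a
    unfolding power2_norm_eq_inner by (subst euclidean_inner) (simp add: power2_eq_square)
  have eq: "cis (y \<bullet> ?S f) * complex_of_real (exp (- (norm (?S f))\<^sup>2 / 2)) = (\<Prod>b\<in>Basis. ?g b (f b))" for f
  proof -
    have "- (norm (?S f))\<^sup>2 / 2 = (\<Sum>b\<in>Basis. - (f b)\<^sup>2 / 2)"
      by (simp add: nrm sum_negf sum_divide_distrib)
    moreover have "y \<bullet> ?S f = (\<Sum>b\<in>Basis. (y \<bullet> b) * f b)"
      by (simp add: inner_sum_right mult.commute)
    ultimately show ?thesis
      by (simp add: cis_sum exp_sum prod.distrib)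
  qed
  have int: "integrable ?P (\<lambda>f. \<Prod>b\<in>Basis. ?g b (f b))"
    by (intro product_integrable_prod) (rule finite_Basis gaussian_fourier_integral_real(1))+
  show "integrable lborel (\<lambda>x::'a. cis (y \<bullet> x) * complex_of_real (exp (- (norm x)\<^sup>2 / 2)))"
    by (subst lborel_eq, subst integrable_distr_eq[OF S]) (measurable, simp only: eq int)
  have "(LINT x|lborel. cis (y \<bullet> x) * complex_of_real (exp (- (norm x)\<^sup>2 / 2))) = (LINT f|?P. (\<Prod>b\<in>Basis. ?g b (f b)))"
    by (subst lborel_eq, subst integral_distr[OF S]) (measurable, simp only: eq)
  also have "\<dots> = (\<Prod>b\<in>Basis. integral\<^sup>L lborel (?g b))"
    by (intro product_integral_prod) (rule finite_Basis gaussian_fourier_integral_real(1))+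
  also have "\<dots> = (\<Prod>b\<in>(Basis::'a set). complex_of_real (sqrt (2 * pi) * exp (- (y \<bullet> b)\<^sup>2 / 2)))"
    by (simp only: gaussian_fourier_integral_real(2))
  also have "\<dots> = complex_of_real (sqrt (2 * pi) ^ DIM('a) * exp (- (norm y)\<^sup>2 / 2))"
  proof -
    have "- (norm y)\<^sup>2 / 2 = (\<Sum>b\<in>Basis. - (y \<bullet> b)\<^sup>2 / 2)"
      by (simp add: nrm sum_negf sum_divide_distrib)
    then show ?thesis
      by (simp add: prod.distrib exp_sum flip: of_real_prod)
  qed
  also have "sqrt (2 * pi) ^ DIM('a) = (2 * pi) powr (DIM('a) / 2)"
    by (simp add: powr_half_sqrt[symmetric] powr_realpow[symmetric] powr_powr)
  finally show "(LINT x|lborel. cis (y \<bullet> x) * complex_of_real (exp (- (norm x)\<^sup>2 / 2))) =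
      complex_of_real ((2 * pi) powr (DIM('a) / 2) * exp (- (norm y)\<^sup>2 / 2))" .
qed

lemma gaussian_fourier_integral_scaled:
  fixes y :: "'a::euclidean_space"
  assumes "\<sigma> > 0"
  shows "integrable lborel (\<lambda>x::'a. cis (y \<bullet> x) * complex_of_real (exp (- (\<sigma> * norm x)\<^sup>2 / 2)))"
    and "(LINT x|lborel. cis (y \<bullet> x) * complex_of_real (exp (- (\<sigma> * norm x)\<^sup>2 / 2))) =
      complex_of_real ((2 * pi) powr (DIM('a) / 2) / \<sigma> ^ DIM('a) * exp (- (norm y / \<sigma>)\<^sup>2 / 2))"
proof -
  let ?f = "\<lambda>x::'a. cis ((y /\<^sub>R \<sigma>) \<bullet> x) * complex_of_real (exp (- (norm x)\<^sup>2 / 2))"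
  have m: "?f \<in> borel_measurable borel" by measurable
  have eq: "cis (y \<bullet> x) * complex_of_real (exp (- (\<sigma> * norm x)\<^sup>2 / 2)) = ?f (0 + \<sigma> *\<^sub>R x)" for x
    using assms by (simp add: power_mult_distrib inverse_eq_divide)
  show "integrable lborel (\<lambda>x::'a. cis (y \<bullet> x) * complex_of_real (exp (- (\<sigma> * norm x)\<^sup>2 / 2)))"
    unfolding eq 
    using assms gaussian_fourier_integral(1)[of "y /\<^sub>R \<sigma>"] by (subst integrable_lborel_affine_iff[OF m]) simp_all
  have "(LINT x|lborel. ?f x) = \<sigma> ^ DIM('a) *\<^sub>R (LINT x|lborel. ?f (0 + \<sigma> *\<^sub>R x))"
    using integral_lborel_affine[OF m, of \<sigma> 0] assms by simp
  then show "(LINT x|lborel. cis (y \<bullet> x) * complex_of_real (exp (- (\<sigma> * norm x)\<^sup>2 / 2))) =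
      complex_of_real ((2 * pi) powr (DIM('a) / 2) / \<sigma> ^ DIM('a) * exp (- (norm y / \<sigma>)\<^sup>2 / 2))"
    unfolding eq gaussian_fourier_integral(2) using assms
    by (simp add: scaleR_conv_of_real field_simps)
qed

lemma integrable_gaussian:
  fixes a :: real
  assumes "a > 0"
  shows "integrable lborel (\<lambda>x::'a::euclidean_space. exp (- a * (norm x)\<^sup>2))"
proof -
  have "integrable lborel (\<lambda>x::'a. cis (0 \<bullet> x) * complex_of_real (exp (- (sqrt (2 * a) * norm x)\<^sup>2 / 2)))"
    by (rule gaussian_fourier_integral_scaled) (use assms in auto)
  then have "integrable lborel (\<lambda>x::'a. complex_of_real (exp (- a * (norm x)\<^sup>2)))"
    using assms by (simp add: power_mult_distrib)
  then show ?thesis by (simp only: complex_of_real_integrable_eq)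
qed

lemma integral_gaussian:
  assumes "\<sigma> > 0"
  shows "(LINT x::'a::euclidean_space|lborel. exp (- (\<sigma> * norm x)\<^sup>2 / 2)) = (2 * pi) powr (DIM('a) / 2) / \<sigma> ^ DIM('a)"
proof -
  have "complex_of_real (LINT x::'a|lborel. exp (- (\<sigma> * norm x)\<^sup>2 / 2)) = 
     complex_of_real ((2 * pi) powr (DIM('a) / 2) / \<sigma> ^ DIM('a))"
    using gaussian_fourier_integral_scaled(2)[OF assms, of "0::'a"]
    by (simp add: integral_complex_of_real[symmetric] del: integral_complex_of_real)
  then show ?thesis by (simp only: of_real_eq_iff)
qed

subsection \<open>The Plancherel inequality\<close>

lemma borel_measurable_cnj [measurable]: "cnj \<in> borel_measurable borel"
  by (intro borel_measurable_continuous_onI continuous_intros)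

lemma integrable_pair_bound:
  fixes f :: "'a::euclidean_space \<times> 'b::euclidean_space \<Rightarrow> 'c::{banach, second_countable_topology}"
  assumes f[measurable]: "f \<in> borel_measurable (borel \<Otimes>\<^sub>M borel)"
    and g: "integrable lborel (g :: 'a \<Rightarrow> real)" and h: "integrable lborel (h :: 'b \<Rightarrow> real)"
    and le: "\<And>x y. norm (f (x, y)) \<le> g x * h y"
  shows "integrable (lborel \<Otimes>\<^sub>M lborel) f"
proof -
  have [measurable]: "g \<in> borel_measurable borel" "h \<in> borel_measurable borel"
    using g h by (auto dest: borel_measurable_integrable)
  have "integrable (lborel \<Otimes>\<^sub>M lborel) (\<lambda>z. g (fst z) * h (snd z))"
  proof (rule lborel_pair.Fubini_integrable)
    show "integrable lborel (\<lambda>x. LINT y|lborel. norm (g (fst (x, y)) * h (snd (x, y))))"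
      using g h by (simp add: abs_mult)
    show "AE x in lborel. integrable lborel (\<lambda>y. g (fst (x, y)) * h (snd (x, y)))"
      using h by simp
  qed measurable
  then show ?thesis
    by (rule Bochner_Integration.integrable_bound) (auto intro!: AE_I2 order_trans[OF le abs_ge_self])
qed

text \<open>Schur's test for a convolution kernel: after
  \<open>|F x * F y| \<le> (F x ^ 2 + F y ^ 2) / 2\<close>, one variable in each half occurs only in
  \<open>k\<close> and integrates to its mass.\<close>

lemma nn_integral_convolution_le:
  fixes F k :: "'a::euclidean_space \<Rightarrow> real"
  assumes [measurable]: "F \<in> borel_measurable borel" "k \<in> borel_measurable borel"
    and k: "\<And>x. k x \<ge> 0"
  shows "(\<integral>\<^sup>+x. \<integral>\<^sup>+y. ennreal (\<bar>F x * F y\<bar> * k (x - y)) \<partial>lborel \<partial>lborel)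
     \<le> (\<integral>\<^sup>+x. ennreal (k x) \<partial>lborel) * (\<integral>\<^sup>+x. ennreal ((F x)\<^sup>2) \<partial>lborel)"
proof -
  let ?K = "\<integral>\<^sup>+x. ennreal (k x) \<partial>lborel" and ?F = "\<integral>\<^sup>+x. ennreal ((F x)\<^sup>2) \<partial>lborel"
  have le: "ennreal (\<bar>F x * F y\<bar> * k (x - y)) \<le> ennreal (1/2) * ((F x)\<^sup>2 * k (x - y)) + ennreal (1/2) * ((F y)\<^sup>2 * k (x - y))" for x y
  proof -
    have "\<bar>F x * F y\<bar> \<le> (F x)\<^sup>2 / 2 + (F y)\<^sup>2 / 2"
      using sum_squares_bound[of "\<bar>F x\<bar>" "\<bar>F y\<bar>"] by (simp add: abs_mult)
    then have "\<bar>F x * F y\<bar> * k (x - y) \<le> 1/2 * ((F x)\<^sup>2 * k (x - y)) + 1/2 * ((F y)\<^sup>2 * k (x - y))"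
      using mult_right_mono[OF _ k[of "x - y"]] by (fastforce simp: algebra_simps)
    then show ?thesis
      using k by (subst (1 2) ennreal_mult[symmetric], simp, simp, simp, simp, subst ennreal_plus[symmetric])
        (auto intro!: ennreal_leI simp del: ennreal_plus)
  qed
  have 1: "(\<integral>\<^sup>+x. \<integral>\<^sup>+y. ennreal ((F x)\<^sup>2 * k (x - y)) \<partial>lborel \<partial>lborel) = ?K * ?F"
  proof -
    have "(\<integral>\<^sup>+y. ennreal (k (x - y)) \<partial>lborel) = ?K" for x
      using nn_integral_lborel_affine[of "\<lambda>x. ennreal (k x)" "-1" x] by simp
    then show ?thesis
      by (simp add: ennreal_mult k nn_integral_cmult nn_integral_multc mult.commute)
  qed
  have 2: "(\<integral>\<^sup>+x. \<integral>\<^sup>+y. ennreal ((F y)\<^sup>2 * k (x - y)) \<partial>lborel \<partial>lborel) = ?K * ?F"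
  proof -
    have "(\<integral>\<^sup>+x. ennreal (k (x - y)) \<partial>lborel) = ?K" for y
      using nn_integral_lborel_translation[of "\<lambda>x. ennreal (k x)" "- y"] by simp
    then show ?thesis
      by (subst lborel_pair.Fubini')
         (simp_all add: ennreal_mult k nn_integral_cmult nn_integral_multc mult.commute)
  qed
  have "(\<integral>\<^sup>+x. \<integral>\<^sup>+y. ennreal (\<bar>F x * F y\<bar> * k (x - y)) \<partial>lborel \<partial>lborel) \<le>
     (\<integral>\<^sup>+x. \<integral>\<^sup>+y. ennreal (1/2) * ((F x)\<^sup>2 * k (x - y)) + ennreal (1/2) * ((F y)\<^sup>2 * k (x - y)) \<partial>lborel \<partial>lborel)"
    by (intro nn_integral_mono le)
  also have "\<dots> = ennreal (1/2) * (?K * ?F) + ennreal (1/2) * (?K * ?F)"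
    by (simp add: nn_integral_add nn_integral_cmult 1 2)
  also have "\<dots> = (ennreal (1/2) + ennreal (1/2)) * (?K * ?F)"
    by (simp only: distrib_right)
  also have "\<dots> = ?K * ?F"
    by (subst ennreal_plus[symmetric]) auto
  finally show ?thesis .
qed

text \<open>Damping \<open>|V|^2\<close> by a Gaussian makes the exchange of integrals legitimate:
  integrating over \<open>x\<close> first turns the damped square norm into a quadratic form in
  \<open>F\<close> with a Gaussian kernel, to which Schur's test applies. Fatou's lemma removes the
  damping. As \<open>F\<close> need not be square integrable, the right-hand side may be
  infinite.\<close>

lemma plancherel_le:
  fixes F :: "'a::euclidean_space \<Rightarrow> complex"
  assumes F: "integrable lborel F"
  shows "(\<integral>\<^sup>+x. ennreal ((norm (LINT \<xi>|lborel. F \<xi> * cis (x \<bullet> \<xi>)))\<^sup>2) \<partial>lborel)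
     \<le> ennreal ((2 * pi) ^ DIM('a)) * (\<integral>\<^sup>+\<xi>. ennreal ((norm (F \<xi>))\<^sup>2) \<partial>lborel)"
proof -
  have [measurable]: "F \<in> borel_measurable borel"
    using F by (auto dest: borel_measurable_integrable)
  define V where "V x = (LINT \<xi>|lborel. F \<xi> * cis (x \<bullet> \<xi>))" for x
  define B where "B = (LINT \<xi>|lborel. norm (F \<xi>))"
  have intF: "integrable lborel (\<lambda>\<xi>. F \<xi> * cis (x \<bullet> \<xi>))" for x
    by (rule Bochner_Integration.integrable_bound[OF integrable_norm[OF F]]) (auto simp: norm_mult)
  have V_meas [measurable]: "V \<in> borel_measurable borel"
    unfolding V_def by measurable
  have V_bound: "norm (V x) \<le> B" for x
    unfolding V_def B_def by (rule order_trans[OF integral_norm_bound]) (simp add: norm_mult)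
  have main: "(\<integral>\<^sup>+x. ennreal ((norm (V x))\<^sup>2 * exp (- (\<sigma> * norm x)\<^sup>2 / 2)) \<partial>lborel)
     \<le> ennreal ((2 * pi) ^ DIM('a)) * (\<integral>\<^sup>+\<xi>. ennreal ((norm (F \<xi>))\<^sup>2) \<partial>lborel)" if \<sigma>: "\<sigma> > 0" for \<sigma>
  proof -
    define G where "G x = exp (- (\<sigma> * norm x)\<^sup>2 / 2)" for x :: 'a
    \<comment> \<open>The Fourier integral of \<open>G\<close>. Its mass, computed in
      \<open>kI\<close>, is (2 pi)^n for every \<sigma>; hence the bound does not deteriorate as
      \<sigma> tends to 0.\<close>
    define k where "k x = (2 * pi) powr (DIM('a) / 2) / \<sigma> ^ DIM('a) * exp (- (norm x / \<sigma>)\<^sup>2 / 2)" for x :: 'a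
    have [measurable]: "G \<in> borel_measurable borel" "k \<in> borel_measurable borel"
      unfolding G_def k_def by measurable
    have k0: "k x \<ge> 0" for x unfolding k_def using \<sigma> by simp
    have G: "integrable lborel G"
      using integrable_gaussian[of "\<sigma>\<^sup>2 / 2", where 'a='a] \<sigma> by (simp add: G_def[abs_def] power_mult_distrib)
    have kint: "integrable lborel k"
      using integrable_gaussian[of "1 / (2 * \<sigma>\<^sup>2)", where 'a='a] \<sigma> unfolding k_def[abs_def]
      by (intro integrable_mult_right) (simp add: power_divide mult.commute)
    have "(LINT x|lborel. k x) = (2 * pi) powr (DIM('a) / 2) / \<sigma> ^ DIM('a) * (LINT x::'a|lborel. exp (- ((1 / \<sigma>) * norm x)\<^sup>2 / 2))"
      by (simp add: k_def)
    also have "\<dots> = (2 * pi) powr (DIM('a) / 2) * (2 * pi) powr (DIM('a) / 2)"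
      using \<sigma> by (subst integral_gaussian) (auto simp: power_divide)
    also have "\<dots> = (2 * pi) ^ DIM('a)"
      by (simp flip: powr_add add: powr_realpow)
    finally have kI: "(\<integral>\<^sup>+x. ennreal (k x) \<partial>lborel) = ennreal ((2 * pi) ^ DIM('a))"
      using nn_integral_eq_integral[OF kint] k0 by simp
    define H where "H z = F (fst z) * cnj (F (snd z))" for z
    have H_meas [measurable]: "H \<in> borel_measurable borel"
      unfolding H_def borel_prod[symmetric] by measurable
    have H: "integrable lborel H"
      unfolding lborel_prod[symmetric]
    proof (rule integrable_pair_bound)
      show "norm (H (x, y)) \<le> norm (F x) * norm (F y)" for x y by (simp add: H_def norm_mult)
    qed (use F H_meas in \<open>simp_all add: borel_prod\<close>)
    have VV: "V x * cnj (V x) = (LINT z|lborel. H z * cis (x \<bullet> (fst z - snd z)))" for x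
    proof -
      have i: "integrable (lborel \<Otimes>\<^sub>M lborel) (\<lambda>(\<xi>, \<eta>). (F \<xi> * cis (x \<bullet> \<xi>)) * cnj (F \<eta> * cis (x \<bullet> \<eta>)))"
        by (rule integrable_pair_bound[OF _ integrable_norm[OF F] integrable_norm[OF F]])
           (auto simp: norm_mult)
      have "(LINT z|lborel. H z * cis (x \<bullet> (fst z - snd z))) =
         (LINT z|(lborel \<Otimes>\<^sub>M lborel). (case z of (\<xi>, \<eta>) \<Rightarrow> (F \<xi> * cis (x \<bullet> \<xi>)) * cnj (F \<eta> * cis (x \<bullet> \<eta>))))"
      proof -
        have "cis (x \<bullet> (\<xi> - \<eta>)) = cis (x \<bullet> \<xi>) * cis (- (x \<bullet> \<eta>))" for \<xi> \<eta>
          by (simp add: cis_mult inner_diff_right)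
        then show ?thesis
          unfolding lborel_prod by (intro Bochner_Integration.integral_cong) (auto simp: H_def cis_cnj)
      qed
      also have "\<dots> = (LINT \<xi>|lborel. LINT \<eta>|lborel. (F \<xi> * cis (x \<bullet> \<xi>)) * cnj (F \<eta> * cis (x \<bullet> \<eta>)))"
        using lborel_pair.integral_fst[OF i] by simp
      also have "\<dots> = (LINT \<xi>|lborel. (F \<xi> * cis (x \<bullet> \<xi>)) * cnj (V x))"
      proof -
        have "(LINT \<eta>|lborel. cnj (F \<eta> * cis (x \<bullet> \<eta>))) = cnj (V x)"
          unfolding V_def by (rule Bochner_Integration.integral_cnj)
        then show ?thesis by (simp only: integral_mult_right_zero)
      qed
      also have "\<dots> = V x * cnj (V x)"
        unfolding V_def by (subst integral_mult_left_zero) simp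
      finally show ?thesis ..
    qed
    have VG: "integrable lborel (\<lambda>x. (norm (V x))\<^sup>2 * G x)"
    proof (rule Bochner_Integration.integrable_bound)
      show "integrable lborel (\<lambda>x. B\<^sup>2 * G x)" using G by simp
      show "AE x in lborel. norm ((norm (V x))\<^sup>2 * G x) \<le> norm (B\<^sup>2 * G x)"
        using V_bound by (auto simp: abs_mult intro!: mult_right_mono power_mono)
    qed measurable
    have i2: "integrable (lborel \<Otimes>\<^sub>M lborel) (\<lambda>(x, z). complex_of_real (G x) * (H z * cis (x \<bullet> (fst z - snd z))))"
    proof (rule integrable_pair_bound[OF _ G integrable_norm[OF H]])
      show "(\<lambda>(x, z). complex_of_real (G x) * (H z * cis (x \<bullet> (fst z - snd z)))) \<in> borel_measurable (borel \<Otimes>\<^sub>M borel)"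
      proof -
        have "(\<lambda>p::'a \<times> 'a \<times> 'a. cis (fst p \<bullet> (fst (snd p) - snd (snd p)))) \<in> borel_measurable borel"
          by (intro borel_measurable_continuous_onI continuous_intros)
        then have [measurable]: "(\<lambda>p::'a \<times> 'a \<times> 'a. cis (fst p \<bullet> (fst (snd p) - snd (snd p)))) \<in> borel_measurable (borel \<Otimes>\<^sub>M borel)"
          by (simp add: borel_prod)
        show ?thesis
          unfolding case_prod_beta by measurable
      qed
    qed (auto simp: norm_mult G_def)
    have "complex_of_real (LINT x|lborel. (norm (V x))\<^sup>2 * G x) = (LINT x|lborel. complex_of_real (G x) * (V x * cnj (V x)))"
      unfolding integral_complex_of_real[symmetric]
      by (intro Bochner_Integration.integral_cong) (auto simp: complex_norm_square[symmetric])
    also have "\<dots> = (LINT x|lborel. LINT z|lborel. complex_of_real (G x) * (H z * cis (x \<bullet> (fst z - snd z))))"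
      unfolding VV by simp
    also have "\<dots> = (LINT z|lborel. LINT x|lborel. complex_of_real (G x) * (H z * cis (x \<bullet> (fst z - snd z))))"
      using lborel_pair.Fubini_integral[OF i2] by simp
    also have "\<dots> = (LINT z|lborel. H z * complex_of_real (k (fst z - snd z)))"
    proof (intro Bochner_Integration.integral_cong refl)
      fix z :: "'a \<times> 'a"
      have "(LINT x|lborel. complex_of_real (G x) * (H z * cis (x \<bullet> (fst z - snd z)))) =
        H z * (LINT x|lborel. cis ((fst z - snd z) \<bullet> x) * complex_of_real (G x))"
        by (subst integral_mult_right_zero[symmetric]) (simp add: inner_commute mult_ac)
      also have "\<dots> = H z * complex_of_real (k (fst z - snd z))"
        unfolding G_def k_def by (simp only: gaussian_fourier_integral_scaled(2)[OF \<sigma>])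
      finally show "(LINT x|lborel. complex_of_real (G x) * (H z * cis (x \<bullet> (fst z - snd z)))) =
        H z * complex_of_real (k (fst z - snd z))" .
    qed
    finally have eq: "complex_of_real (LINT x|lborel. (norm (V x))\<^sup>2 * G x) = (LINT z|lborel. H z * complex_of_real (k (fst z - snd z)))" .
    have "(\<integral>\<^sup>+x. ennreal ((norm (V x))\<^sup>2 * G x) \<partial>lborel) = ennreal (LINT x|lborel. (norm (V x))\<^sup>2 * G x)"
      by (rule nn_integral_eq_integral[OF VG]) (simp add: G_def)
    also have "\<dots> \<le> ennreal (norm (complex_of_real (LINT x|lborel. (norm (V x))\<^sup>2 * G x)))"
      by (intro ennreal_leI) simp
    \<comment> \<open>A non-integrable function has Bochner integral 0, so the bound is trivial in
      that case.\<close>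
    also have "\<dots> \<le> (\<integral>\<^sup>+z. norm (H z * complex_of_real (k (fst z - snd z))) \<partial>lborel)"
      unfolding eq
      by (cases "integrable lborel (\<lambda>z. H z * complex_of_real (k (fst z - snd z)))")
         (simp_all add: integral_norm_bound_ennreal not_integrable_integral_eq)
    also have "\<dots> = (\<integral>\<^sup>+x. \<integral>\<^sup>+y. ennreal (\<bar>norm (F x) * norm (F y)\<bar> * k (x - y)) \<partial>lborel \<partial>lborel)"
      unfolding lborel_prod[symmetric]
      by (subst lborel.nn_integral_fst[symmetric])
         (simp_all add: H_def norm_mult k0 abs_of_nonneg)
    also have "\<dots> \<le> (\<integral>\<^sup>+x. ennreal (k x) \<partial>lborel) * (\<integral>\<^sup>+x. ennreal ((norm (F x))\<^sup>2) \<partial>lborel)"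
      by (intro nn_integral_convolution_le k0) measurable
    finally show ?thesis unfolding kI G_def .
  qed
  \<comment> \<open>Fatou's lemma along \<sigma> = 1/(j+1).\<close>
  have "(\<integral>\<^sup>+x. ennreal ((norm (V x))\<^sup>2) \<partial>lborel) =
    (\<integral>\<^sup>+x. liminf (\<lambda>j. ennreal ((norm (V x))\<^sup>2 * exp (- (1 / real (Suc j) * norm x)\<^sup>2 / 2))) \<partial>lborel)"
  proof (intro nn_integral_cong)
    fix x :: 'a
    have "(\<lambda>j. (norm (V x))\<^sup>2 * exp (- (1 / real (Suc j) * norm x)\<^sup>2 / 2)) \<longlonglongrightarrow> (norm (V x))\<^sup>2 * exp (- (0 * norm x)\<^sup>2 / 2)"
      by (intro tendsto_intros LIMSEQ_Suc lim_1_over_n) auto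
    then have "(\<lambda>j. ennreal ((norm (V x))\<^sup>2 * exp (- (1 / real (Suc j) * norm x)\<^sup>2 / 2))) \<longlonglongrightarrow> ennreal ((norm (V x))\<^sup>2)"
      by (intro tendsto_ennrealI) simp
    then show "ennreal ((norm (V x))\<^sup>2) = liminf (\<lambda>j. ennreal ((norm (V x))\<^sup>2 * exp (- (1 / real (Suc j) * norm x)\<^sup>2 / 2)))"
      by (intro lim_imp_Liminf[symmetric]) auto
  qed
  also have "\<dots> \<le> liminf (\<lambda>j. \<integral>\<^sup>+x. ennreal ((norm (V x))\<^sup>2 * exp (- (1 / real (Suc j) * norm x)\<^sup>2 / 2)) \<partial>lborel)"
    by (intro nn_integral_liminf) measurable
  also have "\<dots> \<le> ennreal ((2 * pi) ^ DIM('a)) * (\<integral>\<^sup>+\<xi>. ennreal ((norm (F \<xi>))\<^sup>2) \<partial>lborel)"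
    by (rule order_trans[OF Liminf_le_Limsup Limsup_bounded]) (simp, intro always_eventually allI main, simp)
  finally show ?thesis unfolding V_def .
qed

subsection \<open>Gaussian means\<close>

text \<open>Lebesgue measurability yields continuous functions converging almost everywhere.
  Clamping them to \<open>[-N, N]\<close> and multiplying by the cutoff \<rho> leaves the limit
  unchanged, because \<open>f\<close> takes values in that interval and vanishes where \<rho>
  differs from 1. The unit of extra radius is the room in which \<rho> falls to 0.\<close>

lemma continuous_approximation_AE:
  fixes f :: "'a::euclidean_space \<Rightarrow> real"
  assumes f: "f \<in> borel_measurable borel" and N: "N \<ge> 0"
    and bound: "\<And>x. \<bar>f x\<bar> \<le> N" and supp: "\<And>x. norm x > N \<Longrightarrow> f x = 0"
  obtains \<psi> :: "nat \<Rightarrow> 'a \<Rightarrow> real" where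
    "\<And>k. continuous_on UNIV (\<psi> k)" "\<And>k x. \<bar>\<psi> k x\<bar> \<le> N" "\<And>k x. norm x > N + 1 \<Longrightarrow> \<psi> k x = 0"
    "AE x in lborel. (\<lambda>k. \<psi> k x) \<longlonglongrightarrow> f x"
proof -
  have "f \<in> borel_measurable lebesgue"
    using f by (simp add: measurable_completion)
  then have "f measurable_on UNIV"
    by (rule lebesgue_measurable_imp_measurable_on) simp
  then obtain Z g where Z: "negligible Z" and g: "\<And>k::nat. continuous_on UNIV (g k)"
    and lim: "\<And>x. x \<notin> Z \<Longrightarrow> (\<lambda>k. g k x) \<longlonglongrightarrow> f x"
    unfolding measurable_on_def by auto
  define \<rho> where "\<rho> x = max 0 (min 1 (N + 1 - norm x))" for x :: 'a
  define \<psi> where "\<psi> k x = max (- N) (min N (g k x)) * \<rho> x" for k x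
  have \<rho>: "0 \<le> \<rho> x" "\<rho> x \<le> 1" for x by (auto simp: \<rho>_def)
  show thesis
  proof (rule that)
    show "continuous_on UNIV (\<psi> k)" for k
      unfolding \<psi>_def \<rho>_def by (intro continuous_intros g)
    show "\<bar>\<psi> k x\<bar> \<le> N" for k x
    proof -
      have "\<bar>max (- N) (min N (g k x))\<bar> * \<bar>\<rho> x\<bar> \<le> N * 1"
        using N \<rho>[of x] by (intro mult_mono) auto
      then show ?thesis by (simp add: \<psi>_def abs_mult)
    qed
    show "\<psi> k x = 0" if "norm x > N + 1" for k x
      using that by (simp add: \<psi>_def \<rho>_def)
    have "AE x in lebesgue. x \<notin> Z"
      using Z by (intro AE_not_in) (simp add: negligible_iff_null_sets)
    then have "AE x in lborel. x \<notin> Z" by (simp add: AE_completion_iff)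
    then show "AE x in lborel. (\<lambda>k. \<psi> k x) \<longlonglongrightarrow> f x"
    proof eventually_elim
      case (elim x)
      have "(\<lambda>k. \<psi> k x) \<longlonglongrightarrow> max (- N) (min N (f x)) * \<rho> x"
        unfolding \<psi>_def by (intro tendsto_intros lim elim)
      also have "max (- N) (min N (f x)) * \<rho> x = f x"
        using bound[of x] supp[of x] N by (cases "norm x > N") (auto simp: \<rho>_def max_def min_def)
      finally show ?case .
    qed
  qed
qed

text \<open>The weight is left unnormalised, with mass \<open>(2 * pi) powr (n / 2)\<close>: then
  the Fourier representation in \<open>gauss_mean_eq\<close> carries no constant.\<close>

definition gauss_mean :: "real \<Rightarrow> ('a::euclidean_space \<Rightarrow> real) \<Rightarrow> 'a \<Rightarrow> real" where
  "gauss_mean \<sigma> w x = (LINT z|lborel. w (x + \<sigma> *\<^sub>R z) * exp (- (norm z)\<^sup>2 / 2))"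

text \<open>From \<open>|y|^2 \<le> 2 |y - \<sigma> z|^2 + 2 |z|^2\<close>. The point is to decouple
  \<open>y\<close> and \<open>z\<close> uniformly in \<sigma>, so that one product of Gaussians
  dominates all the integrands below.\<close>

lemma exp_shift_bound:
  fixes y z :: "'a::euclidean_space"
  assumes "0 \<le> \<sigma>" "\<sigma> \<le> 1"
  shows "exp (- (norm (y - \<sigma> *\<^sub>R z))\<^sup>2 / 4) * exp (- (norm z)\<^sup>2 / 2) \<le> exp (- (1/8) * (norm y)\<^sup>2) * exp (- (1/4) * (norm z)\<^sup>2)"
proof -
  have "norm y \<le> norm (y - \<sigma> *\<^sub>R z) + \<sigma> * norm z"
    using norm_triangle_sub[of y "\<sigma> *\<^sub>R z"] assms by simp
  also have "\<sigma> * norm z \<le> norm z" using assms by (simp add: mult_left_le_one_le)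
  finally have "(norm y)\<^sup>2 \<le> (norm (y - \<sigma> *\<^sub>R z) + norm z)\<^sup>2" by (intro power_mono) auto
  also have "\<dots> \<le> 2 * (norm (y - \<sigma> *\<^sub>R z))\<^sup>2 + 2 * (norm z)\<^sup>2"
    using sum_squares_bound[of "norm (y - \<sigma> *\<^sub>R z)" "norm z"] by (simp add: power2_sum)
  finally show ?thesis by (simp flip: exp_add)
qed

text \<open>The Gaussian averaging is moved from \<open>w\<close> to \<psi>. There it converges
  pointwise by continuity, with Gaussian domination, while for \<open>w\<close> only integrability
  against Gaussians is known.\<close>

lemma gauss_mean_duality:
  fixes w \<psi> :: "'a::euclidean_space \<Rightarrow> real"
  assumes w [measurable]: "w \<in> borel_measurable borel"
    and wint: "\<And>a. a > 0 \<Longrightarrow> integrable lborel (\<lambda>y. w y * exp (- a * (norm y)\<^sup>2))"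
    and \<psi>: "continuous_on UNIV \<psi>" and \<psi>_bound: "\<And>x. \<bar>\<psi> x\<bar> \<le> A * exp (- (norm x)\<^sup>2 / 4)"
  shows "\<And>\<sigma>. 0 < \<sigma> \<Longrightarrow> \<sigma> \<le> 1 \<Longrightarrow> integrable lborel (\<lambda>x. \<psi> x * gauss_mean \<sigma> w x)"
    and "(\<lambda>j. LINT x|lborel. \<psi> x * gauss_mean (1 / real (Suc j)) w x) \<longlonglongrightarrow>
       (2 * pi) powr (DIM('a) / 2) * (LINT x|lborel. w x * \<psi> x)"
proof -
  have [measurable]: "\<psi> \<in> borel_measurable borel"
    using \<psi> by (rule borel_measurable_continuous_onI)
  have A: "A \<ge> 0"
    using \<psi>_bound[of 0] by simp
  define \<gamma> where "\<gamma> z = exp (- (norm z)\<^sup>2 / 2)" for z :: 'a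
  have [measurable]: "\<gamma> \<in> borel_measurable borel" unfolding \<gamma>_def by measurable
  define g8 where "g8 y = exp (- (1/8) * (norm y)\<^sup>2)" for y :: 'a
  define g4 where "g4 y = exp (- (1/4) * (norm y)\<^sup>2)" for y :: 'a
  have [measurable]: "g8 \<in> borel_measurable borel" "g4 \<in> borel_measurable borel"
    unfolding g8_def g4_def by measurable
  have g0: "g8 y \<ge> 0" "g4 y \<ge> 0" for y by (auto simp: g8_def g4_def)
  have g4: "integrable lborel g4" unfolding g4_def by (intro integrable_gaussian) auto
  have w8: "integrable lborel (\<lambda>y. \<bar>w y\<bar> * (A * g8 y))"
    using integrable_mult_left[OF integrable_norm[OF wint[of "1/8"]], of A]
    by (simp add: g8_def abs_mult mult_ac)
  have pt: "\<bar>\<psi> (y - \<sigma> *\<^sub>R z)\<bar> * \<gamma> z \<le> A * g8 y * g4 z" if "0 \<le> \<sigma>" "\<sigma> \<le> 1" for \<sigma> y z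
  proof -
    have "\<bar>\<psi> (y - \<sigma> *\<^sub>R z)\<bar> * \<gamma> z \<le> (A * exp (- (norm (y - \<sigma> *\<^sub>R z))\<^sup>2 / 4)) * \<gamma> z"
      by (intro mult_right_mono \<psi>_bound) (simp add: \<gamma>_def)
    also have "\<dots> \<le> A * (g8 y * g4 z)"
      using mult_left_mono[OF exp_shift_bound[OF that, of y z] A] by (simp add: \<gamma>_def g8_def g4_def mult.assoc)
    finally show ?thesis by (simp add: mult.assoc)
  qed
  define \<Psi> where "\<Psi> \<sigma> y = (LINT z|lborel. \<psi> (y - \<sigma> *\<^sub>R z) * \<gamma> z)" for \<sigma> y
  have \<Psi>_meas [measurable]: "\<Psi> \<sigma> \<in> borel_measurable borel" for \<sigma>
    unfolding \<Psi>_def by measurable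
  have int1: "integrable (lborel \<Otimes>\<^sub>M lborel) (\<lambda>(y, z). w y * (\<psi> (y - \<sigma> *\<^sub>R z) * \<gamma> z))" if "0 \<le> \<sigma>" "\<sigma> \<le> 1" for \<sigma>
  proof (rule integrable_pair_bound[OF _ w8 g4])
    fix y z :: 'a
    have "\<bar>w y\<bar> * (\<bar>\<psi> (y - \<sigma> *\<^sub>R z)\<bar> * \<gamma> z) \<le> \<bar>w y\<bar> * (A * g8 y * g4 z)"
      by (intro mult_left_mono pt that) auto
    then show "norm (case (y, z) of (y, z) \<Rightarrow> w y * (\<psi> (y - \<sigma> *\<^sub>R z) * \<gamma> z)) \<le> \<bar>w y\<bar> * (A * g8 y) * g4 z"
      by (simp add: abs_mult mult.assoc \<gamma>_def)
  qed measurable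
  \<comment> \<open>Fubini's theorem is used in the variables \<open>(x, z)\<close> and then in
    \<open>(y, z)\<close>, where \<open>y = x + \<sigma> z\<close>. Domination is available only in
    the second form; \<open>i2\<close> carries integrability back by translating \<open>x\<close>
    for fixed \<open>z\<close>.\<close>
  have swap: "integrable lborel (\<lambda>x. \<psi> x * gauss_mean \<sigma> w x) \<and>
     (LINT x|lborel. \<psi> x * gauss_mean \<sigma> w x) = (LINT y|lborel. w y * \<Psi> \<sigma> y)" if \<sigma>: "0 < \<sigma>" "\<sigma> \<le> 1" for \<sigma>
  proof -
    note i1 = int1[OF less_imp_le[OF \<sigma>(1)] \<sigma>(2)]
    let ?f2 = "\<lambda>z x. w (x + \<sigma> *\<^sub>R z) * (\<psi> x * \<gamma> z)"
    have shift: "?f2 z x = (\<lambda>y. w y * (\<psi> (y - \<sigma> *\<^sub>R z) * \<gamma> z)) (\<sigma> *\<^sub>R z + 1 *\<^sub>R x)" for z x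
      by (simp add: add.commute)
    have i2: "integrable (lborel \<Otimes>\<^sub>M lborel) (\<lambda>(z, x). ?f2 z x)"
    proof (rule lborel_pair.Fubini_integrable)
      have "(LINT x|lborel. norm (?f2 z x)) = (LINT y|lborel. norm (w y * (\<psi> (y - \<sigma> *\<^sub>R z) * \<gamma> z)))" for z
        using integral_lborel_translation[of "\<lambda>y. norm (w y * (\<psi> (y - \<sigma> *\<^sub>R z) * \<gamma> z))" "\<sigma> *\<^sub>R z"]
        by (simp add: add.commute)
      then show "integrable lborel (\<lambda>z. LINT x|lborel. norm (case (z, x) of (z, x) \<Rightarrow> ?f2 z x))"
        using lborel_pair.integrable_snd[of "\<lambda>y z. norm (w y * (\<psi> (y - \<sigma> *\<^sub>R z) * \<gamma> z))"] integrable_norm[OF i1]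
        by (simp add: case_prod_beta')
      show "AE z in lborel. integrable lborel (\<lambda>x. case (z, x) of (z, x) \<Rightarrow> ?f2 z x)"
        using lborel_pair.AE_integrable_snd[OF i1]
      proof eventually_elim
        case (elim z)
        then show ?case unfolding prod.case shift
          by (subst integrable_lborel_affine_iff) auto
      qed
    qed measurable
    have gm: "\<psi> x * gauss_mean \<sigma> w x = (LINT z|lborel. ?f2 z x)" for x
      unfolding gauss_mean_def \<gamma>_def
      by (subst integral_mult_right_zero[symmetric]) (simp add: mult_ac)
    have "(LINT x|lborel. \<psi> x * gauss_mean \<sigma> w x) = (LINT x|lborel. LINT z|lborel. ?f2 z x)"
      by (simp only: gm)
    also have "\<dots> = (LINT z|lborel. LINT x|lborel. ?f2 z x)"
      by (rule lborel_pair.Fubini_integral[OF i2])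
    also have "\<dots> = (LINT z|lborel. LINT y|lborel. w y * (\<psi> (y - \<sigma> *\<^sub>R z) * \<gamma> z))"
      using integral_lborel_translation[of "\<lambda>y. w y * (\<psi> (y - \<sigma> *\<^sub>R z) * \<gamma> z)" "\<sigma> *\<^sub>R z" for z]
      by (simp add: add.commute)
    also have "\<dots> = (LINT y|lborel. LINT z|lborel. w y * (\<psi> (y - \<sigma> *\<^sub>R z) * \<gamma> z))"
      by (rule lborel_pair.Fubini_integral[OF i1])
    also have "\<dots> = (LINT y|lborel. w y * \<Psi> \<sigma> y)"
      unfolding \<Psi>_def by (simp only: integral_mult_right_zero)
    finally show ?thesis
      using lborel_pair.integrable_snd[OF i2] by (simp add: gm)
  qed
  then show "\<And>\<sigma>. 0 < \<sigma> \<Longrightarrow> \<sigma> \<le> 1 \<Longrightarrow> integrable lborel (\<lambda>x. \<psi> x * gauss_mean \<sigma> w x)" by blast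
  have c: "(LINT z|lborel. \<gamma> z) = (2 * pi) powr (DIM('a) / 2)"
    using integral_gaussian[of 1, where 'a='a] by (simp add: \<gamma>_def)
  have lim\<Psi>: "(\<lambda>j. \<Psi> (1 / real (Suc j)) y) \<longlonglongrightarrow> \<psi> y * (2 * pi) powr (DIM('a) / 2)" for y
  proof -
    have "(\<lambda>j. \<Psi> (1 / real (Suc j)) y) \<longlonglongrightarrow> (LINT z|lborel. \<psi> y * \<gamma> z)"
      unfolding \<Psi>_def
    proof (rule integral_dominated_convergence)
      show "integrable lborel (\<lambda>z. A * g8 y * g4 z)" using g4 by simp
      show "AE z in lborel. norm (\<psi> (y - (1 / real (Suc j)) *\<^sub>R z) * \<gamma> z) \<le> A * g8 y * g4 z" for j
        using pt[of "1 / real (Suc j)" y] by (simp add: abs_mult \<gamma>_def)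
      show "AE z in lborel. (\<lambda>j. \<psi> (y - (1 / real (Suc j)) *\<^sub>R z) * \<gamma> z) \<longlonglongrightarrow> \<psi> y * \<gamma> z"
      proof (intro AE_I2 tendsto_intros)
        fix z
        have "(\<lambda>j. y - (1 / real (Suc j)) *\<^sub>R z) \<longlonglongrightarrow> y - 0 *\<^sub>R z"
          by (intro tendsto_intros LIMSEQ_Suc lim_1_over_n)
        then show "(\<lambda>j. \<psi> (y - (1 / real (Suc j)) *\<^sub>R z)) \<longlonglongrightarrow> \<psi> y"
          using \<psi> by (intro continuous_on_tendsto_compose[OF \<psi>]) auto
      qed
    qed measurable
    then show ?thesis by (simp add: c)
  qed
  have "(\<lambda>j. LINT y|lborel. w y * \<Psi> (1 / real (Suc j)) y) \<longlonglongrightarrow> (LINT y|lborel. w y * (\<psi> y * (2 * pi) powr (DIM('a) / 2)))"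
  proof (rule integral_dominated_convergence)
    show "integrable lborel (\<lambda>y. \<bar>w y\<bar> * (A * g8 y) * (LINT z|lborel. g4 z))" using w8 by simp
    show "AE y in lborel. norm (w y * \<Psi> (1 / real (Suc j)) y) \<le> \<bar>w y\<bar> * (A * g8 y) * (LINT z|lborel. g4 z)" for j
    proof (intro AE_I2)
      fix y
      have "\<bar>\<Psi> (1 / real (Suc j)) y\<bar> \<le> (LINT z|lborel. A * g8 y * g4 z)"
        unfolding \<Psi>_def
        by (rule integral_abs_bound[THEN order_trans], rule integral_mono')
           (use g4 pt[of "1 / real (Suc j)" y] A g0 in \<open>auto simp: abs_mult \<gamma>_def\<close>)
      then have "\<bar>w y\<bar> * \<bar>\<Psi> (1 / real (Suc j)) y\<bar> \<le> \<bar>w y\<bar> * (A * g8 y * (LINT z|lborel. g4 z))"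
        by (intro mult_left_mono) auto
      then show "norm (w y * \<Psi> (1 / real (Suc j)) y) \<le> \<bar>w y\<bar> * (A * g8 y) * (LINT z|lborel. g4 z)"
        by (simp add: abs_mult mult.assoc)
    qed
    show "AE y in lborel. (\<lambda>j. w y * \<Psi> (1 / real (Suc j)) y) \<longlonglongrightarrow> w y * (\<psi> y * (2 * pi) powr (DIM('a) / 2))"
      by (intro AE_I2 tendsto_mult tendsto_const lim\<Psi>)
  qed measurable
  moreover have "(LINT y|lborel. w y * (\<psi> y * (2 * pi) powr (DIM('a) / 2))) = (2 * pi) powr (DIM('a) / 2) * (LINT x|lborel. w x * \<psi> x)"
    by (subst integral_mult_right_zero[symmetric]) (simp add: mult_ac)
  moreover have "(LINT x|lborel. \<psi> x * gauss_mean (1 / real (Suc j)) w x) = (LINT y|lborel. w y * \<Psi> (1 / real (Suc j)) y)" for j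
    using swap[of "1 / real (Suc j)"] by simp
  ultimately show "(\<lambda>j. LINT x|lborel. \<psi> x * gauss_mean (1 / real (Suc j)) w x) \<longlonglongrightarrow>
       (2 * pi) powr (DIM('a) / 2) * (LINT x|lborel. w x * \<psi> x)" by simp
qed

lemma borel_measurable_gauss_mean [measurable]:
  fixes w :: "'a::euclidean_space \<Rightarrow> real"
  assumes [measurable]: "w \<in> borel_measurable borel"
  shows "gauss_mean \<sigma> w \<in> borel_measurable borel"
  unfolding gauss_mean_def[abs_def] by measurable

text \<open>Weak lower semicontinuity of the square norm: \<open>gauss_mean_duality\<close> gives
  convergence of the means only against test functions, so the bound on \<open>w\<close> is
  recovered by testing with approximations of truncations of \<open>w\<close> itself.\<close>

lemma nn_integral_square_le_gauss_mean:
  fixes w :: "'a::euclidean_space \<Rightarrow> real"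
  assumes w [measurable]: "w \<in> borel_measurable borel"
    and wint: "\<And>a. a > 0 \<Longrightarrow> integrable lborel (\<lambda>y. w y * exp (- a * (norm y)\<^sup>2))"
    and bound: "\<And>\<sigma>. 0 < \<sigma> \<Longrightarrow> \<sigma> \<le> 1 \<Longrightarrow>
      (\<integral>\<^sup>+x. ennreal ((gauss_mean \<sigma> w x)\<^sup>2) \<partial>lborel) \<le> ennreal ((2 * pi) ^ DIM('a)) * B"
  shows "(\<integral>\<^sup>+x. ennreal ((w x)\<^sup>2) \<partial>lborel) \<le> B"
proof (cases B)
  case top
  then show ?thesis by simp
next
  case (real b)
  define c where "c = (2 * pi) powr (DIM('a) / 2)"
  have c: "c > 0" by (simp add: c_def)
  have c2: "c\<^sup>2 = (2 * pi) ^ DIM('a)"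
    unfolding c_def power2_eq_square by (simp flip: powr_add add: powr_realpow)
  \<comment> \<open>The integrated form of \<open>w \<psi> \<le> \<psi>^2 / 2 + w^2 / 2\<close>,
    with \<open>b\<close> in place of the integral of \<open>w^2\<close>.\<close>
  have test: "(LINT x|lborel. w x * \<psi> x) \<le> (LINT x|lborel. (\<psi> x)\<^sup>2) / 2 + b / 2"
    if \<psi>: "continuous_on UNIV \<psi>" and \<psi>_bound: "\<And>x. \<bar>\<psi> x\<bar> \<le> A * exp (- (norm x)\<^sup>2 / 4)" for \<psi> A
  proof -
    note dual = gauss_mean_duality[OF w wint \<psi> \<psi>_bound]
    have [measurable]: "\<psi> \<in> borel_measurable borel"
      using \<psi> by (rule borel_measurable_continuous_onI)
    have \<psi>2: "integrable lborel (\<lambda>x. (\<psi> x)\<^sup>2)"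
    proof (rule Bochner_Integration.integrable_bound)
      show "integrable lborel (\<lambda>x::'a. A\<^sup>2 * exp (- (1/2) * (norm x)\<^sup>2))"
        by (intro integrable_mult_right integrable_gaussian) auto
      have "(\<psi> x)\<^sup>2 \<le> A\<^sup>2 * exp (- (1/2) * (norm x)\<^sup>2)" for x
        using power_mono[OF \<psi>_bound[of x], of 2] by (simp add: power_mult_distrib flip: exp_double)
      then show "AE x in lborel. norm ((\<psi> x)\<^sup>2) \<le> norm (A\<^sup>2 * exp (- (1/2) * (norm x)\<^sup>2))" by simp
    qed measurable
    have *: "(LINT x|lborel. \<psi> x * gauss_mean \<sigma> w x) \<le> c * ((LINT x|lborel. (\<psi> x)\<^sup>2) / 2 + b / 2)"
      if \<sigma>: "0 < \<sigma>" "\<sigma> \<le> 1" for \<sigma>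
    proof -
      have le: "(\<integral>\<^sup>+x. ennreal ((gauss_mean \<sigma> w x)\<^sup>2) \<partial>lborel) \<le> ennreal (c\<^sup>2 * b)"
        using bound[OF \<sigma>] real by (simp add: c2 ennreal_mult)
      have W2: "integrable lborel (\<lambda>x. (gauss_mean \<sigma> w x)\<^sup>2)"
        by (rule integrableI_bounded) (use le in \<open>auto intro: le_less_trans\<close>)
      have "ennreal (LINT x|lborel. (gauss_mean \<sigma> w x)\<^sup>2) \<le> ennreal (c\<^sup>2 * b)"
        using le nn_integral_eq_integral[OF W2] by simp
      then have W2_le: "(LINT x|lborel. (gauss_mean \<sigma> w x)\<^sup>2) \<le> c\<^sup>2 * b"
        using real by (simp add: ennreal_le_iff)
      have "(LINT x|lborel. \<psi> x * gauss_mean \<sigma> w x) \<le> (LINT x|lborel. (c/2) * (\<psi> x)\<^sup>2 + (1 / (2 * c)) * (gauss_mean \<sigma> w x)\<^sup>2)"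
      proof (rule integral_mono)
        show "integrable lborel (\<lambda>x. \<psi> x * gauss_mean \<sigma> w x)" using dual(1) \<sigma> by blast
        show "integrable lborel (\<lambda>x. (c/2) * (\<psi> x)\<^sup>2 + (1 / (2 * c)) * (gauss_mean \<sigma> w x)\<^sup>2)"
          using \<psi>2 W2 by (intro Bochner_Integration.integrable_add integrable_mult_right)
        fix x
        \<comment> \<open>The mean has size \<open>c\<close> times \<open>w\<close>, so the product
          is split with the weight \<open>c\<close>; this makes both resulting terms proportional to
          \<open>c\<close>.\<close>
        have "0 \<le> (c * \<psi> x - gauss_mean \<sigma> w x)\<^sup>2" by simp
        then show "\<psi> x * gauss_mean \<sigma> w x \<le> (c/2) * (\<psi> x)\<^sup>2 + (1 / (2 * c)) * (gauss_mean \<sigma> w x)\<^sup>2"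
          using c by (simp add: field_simps power2_eq_square)
      qed
      also have "\<dots> = (c/2) * (LINT x|lborel. (\<psi> x)\<^sup>2) + (1 / (2 * c)) * (LINT x|lborel. (gauss_mean \<sigma> w x)\<^sup>2)"
        using \<psi>2 W2 by (subst Bochner_Integration.integral_add) auto
      also have "\<dots> \<le> (c/2) * (LINT x|lborel. (\<psi> x)\<^sup>2) + (1 / (2 * c)) * (c\<^sup>2 * b)"
        using c W2_le by (intro add_left_mono mult_left_mono) auto
      also have "\<dots> = c * ((LINT x|lborel. (\<psi> x)\<^sup>2) / 2 + b / 2)"
        using c by (simp add: field_simps power2_eq_square)
      finally show ?thesis .
    qed
    have "c * (LINT x|lborel. w x * \<psi> x) \<le> c * ((LINT x|lborel. (\<psi> x)\<^sup>2) / 2 + b / 2)"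
      using dual(2) unfolding c_def[symmetric] by (rule LIMSEQ_le_const2) (auto intro!: exI[of _ 0] *)
    then show ?thesis using c by simp
  qed
  \<comment> \<open>Truncating value and support together ensures \<open>w * f N = (f N)^2\<close>,
    so the pairing with \<open>w\<close> becomes a finite square norm.\<close>
  define f where "f N x = (if \<bar>w x\<bar> \<le> real N \<and> norm x \<le> real N then w x else 0)" for N x
  have [measurable]: "f N \<in> borel_measurable borel" for N
    unfolding f_def by measurable
  have fN: "(\<integral>\<^sup>+x. ennreal ((f N x)\<^sup>2) \<partial>lborel) \<le> ennreal b" for N
  proof -
    obtain \<psi> where \<psi>: "\<And>k. continuous_on UNIV (\<psi> k)" "\<And>k x. \<bar>\<psi> k x\<bar> \<le> real N"
      "\<And>k x. norm x > real N + 1 \<Longrightarrow> \<psi> k x = 0" "AE x in lborel. (\<lambda>k. \<psi> k x) \<longlonglongrightarrow> f N x"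
      by (rule continuous_approximation_AE[of "f N" "real N"]) (auto simp: f_def)
    have [measurable]: "\<psi> k \<in> borel_measurable borel" for k
      using \<psi>(1) by (rule borel_measurable_continuous_onI)
    \<comment> \<open>\<open>N\<close> bounds the values of the approximants and the exponential
      compensates a Gaussian of rate at most 1 on their support. Rate 1/4 is what
      \<open>test\<close> asks for; rate 1 serves dominated convergence.\<close>
    define D where "D = real N * exp ((real N + 1)\<^sup>2)"
    have D: "\<bar>\<psi> k x\<bar> \<le> D * exp (- a * (norm x)\<^sup>2)" if a: "0 \<le> a" "a \<le> 1" for k x a
    proof (cases "norm x > real N + 1")
      case False
      then have "a * (norm x)\<^sup>2 \<le> 1 * (real N + 1)\<^sup>2" using a by (intro mult_mono power_mono) auto
      then have "1 \<le> exp ((real N + 1)\<^sup>2) * exp (- a * (norm x)\<^sup>2)" by (simp flip: exp_add)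
      then have "real N * 1 \<le> real N * (exp ((real N + 1)\<^sup>2) * exp (- a * (norm x)\<^sup>2))" by (intro mult_left_mono) auto
      then show ?thesis using \<psi>(2)[of k x] by (simp add: D_def mult.assoc)
    qed (auto simp: \<psi>(3) D_def)
    have wf: "w x * f N x = (f N x)\<^sup>2" for x by (auto simp: f_def power2_eq_square)
    have lim1: "(\<lambda>k. LINT x|lborel. w x * \<psi> k x) \<longlonglongrightarrow> (LINT x|lborel. (f N x)\<^sup>2)"
      unfolding wf[symmetric]
    proof (rule integral_dominated_convergence)
      show "integrable lborel (\<lambda>x. D * norm (w x * exp (- 1 * (norm x)\<^sup>2)))"
        by (intro integrable_mult_right integrable_norm wint) auto
      show "AE x in lborel. norm (w x * \<psi> k x) \<le> D * norm (w x * exp (- 1 * (norm x)\<^sup>2))" for k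
        using mult_left_mono[OF D[of 1 k], of "\<bar>w x\<bar>" for x] by (auto simp: abs_mult mult_ac)
      show "AE x in lborel. (\<lambda>k. w x * \<psi> k x) \<longlonglongrightarrow> w x * f N x"
        using \<psi>(4) by eventually_elim (intro tendsto_intros)
    qed measurable
    have lim2': "integrable lborel (\<lambda>x. (f N x)\<^sup>2)" "(\<lambda>k. LINT x|lborel. (\<psi> k x)\<^sup>2) \<longlonglongrightarrow> (LINT x|lborel. (f N x)\<^sup>2)"
    proof -
      have i: "integrable lborel (\<lambda>x::'a. D\<^sup>2 * exp (- 2 * (norm x)\<^sup>2))"
        by (intro integrable_mult_right integrable_gaussian) auto
      have b: "AE x in lborel. norm ((\<psi> k x)\<^sup>2) \<le> D\<^sup>2 * exp (- 2 * (norm x)\<^sup>2)" for k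
      proof (intro AE_I2)
        fix x
        show "norm ((\<psi> k x)\<^sup>2) \<le> D\<^sup>2 * exp (- 2 * (norm x)\<^sup>2)"
          using power_mono[OF D[of 1 k x], of 2] by (simp add: power_mult_distrib flip: exp_double)
      qed
      have l: "AE x in lborel. (\<lambda>k. (\<psi> k x)\<^sup>2) \<longlonglongrightarrow> (f N x)\<^sup>2"
        using \<psi>(4) by eventually_elim (intro tendsto_intros)
      show "integrable lborel (\<lambda>x. (f N x)\<^sup>2)"
        by (rule integrable_dominated_convergence[OF _ _ i l b]) measurable
      show "(\<lambda>k. LINT x|lborel. (\<psi> k x)\<^sup>2) \<longlonglongrightarrow> (LINT x|lborel. (f N x)\<^sup>2)"
        by (rule integral_dominated_convergence[OF _ _ i l b]) measurable
    qed
    \<comment> \<open>The limit of \<open>test\<close> along the approximants; half of the square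
      integral is then absorbed, which is legitimate because it is a finite real number.\<close>
    have "(LINT x|lborel. (f N x)\<^sup>2) \<le> (LINT x|lborel. (f N x)\<^sup>2) / 2 + b / 2"
    proof (rule LIMSEQ_le[OF lim1])
      show "(\<lambda>k. (LINT x|lborel. (\<psi> k x)\<^sup>2) / 2 + b / 2) \<longlonglongrightarrow> (LINT x|lborel. (f N x)\<^sup>2) / 2 + b / 2"
        by (intro tendsto_intros lim2') auto
      show "\<exists>M. \<forall>k\<ge>M. (LINT x|lborel. w x * \<psi> k x) \<le> (LINT x|lborel. (\<psi> k x)\<^sup>2) / 2 + b / 2"
        using test[OF \<psi>(1), of _ D] D[of "1/4"] by simp
    qed
    then have "(LINT x|lborel. (f N x)\<^sup>2) \<le> b" by simp
    then show ?thesis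
      by (subst nn_integral_eq_integral[OF lim2'(1)]) (auto intro: ennreal_leI)
  qed
  have "(\<integral>\<^sup>+x. ennreal ((w x)\<^sup>2) \<partial>lborel) = (\<integral>\<^sup>+x. liminf (\<lambda>N. ennreal ((f N x)\<^sup>2)) \<partial>lborel)"
  proof (intro nn_integral_cong)
    fix x
    have "eventually (\<lambda>N. real N \<ge> max \<bar>w x\<bar> (norm x)) sequentially"
      using filterlim_real_sequentially by (simp only: filterlim_at_top)
    then have "eventually (\<lambda>N. ennreal ((f N x)\<^sup>2) = ennreal ((w x)\<^sup>2)) sequentially"
      by eventually_elim (auto simp: f_def)
    then have "(\<lambda>N. ennreal ((f N x)\<^sup>2)) \<longlonglongrightarrow> ennreal ((w x)\<^sup>2)"
      by (rule tendsto_eventually)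
    then show "ennreal ((w x)\<^sup>2) = liminf (\<lambda>N. ennreal ((f N x)\<^sup>2))"
      by (intro lim_imp_Liminf[symmetric]) auto
  qed
  also have "\<dots> \<le> liminf (\<lambda>N. \<integral>\<^sup>+x. ennreal ((f N x)\<^sup>2) \<partial>lborel)"
    by (intro nn_integral_liminf) measurable
  also have "\<dots> \<le> ennreal b"
    by (rule order_trans[OF Liminf_le_Limsup Limsup_bounded]) (simp, intro always_eventually allI fN)
  finally show ?thesis using real by simp
qed

subsection \<open>Gaussians are Schwartz functions\<close>

text \<open>The polynomial functions with complex coefficients, generated by exactly the operations
  that differentiating a Gaussian produces, so that derivatives and growth bounds follow by rule
  induction.\<close>

inductive_set cpoly :: "('a::euclidean_space \<Rightarrow> complex) set" where
  const: "(\<lambda>x. c) \<in> cpoly"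
| inner: "(\<lambda>x. complex_of_real (x \<bullet> a)) \<in> cpoly"
| add: "p \<in> cpoly \<Longrightarrow> q \<in> cpoly \<Longrightarrow> (\<lambda>x. p x + q x) \<in> cpoly"
| mult: "p \<in> cpoly \<Longrightarrow> q \<in> cpoly \<Longrightarrow> (\<lambda>x. p x * q x) \<in> cpoly"

lemma cpoly_has_derivative:
  assumes "p \<in> cpoly"
  shows "\<exists>p'. (\<forall>b. p' b \<in> cpoly) \<and> (\<forall>x. (p has_derivative (\<lambda>b. p' b x)) (at x))"
  using assms
proof induction
  case (const c)
  show ?case
    by (rule exI[of _ "\<lambda>b x. 0"]) (auto intro: cpoly.const)
next
  case (inner a)
  show ?case
    by (rule exI[of _ "\<lambda>b x. complex_of_real (b \<bullet> a)"])
       (auto intro!: cpoly.const derivative_eq_intros)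
next
  case (add p q)
  then obtain p' q' where "\<forall>b. p' b \<in> cpoly" "\<forall>x. (p has_derivative (\<lambda>b. p' b x)) (at x)"
    "\<forall>b. q' b \<in> cpoly" "\<forall>x. (q has_derivative (\<lambda>b. q' b x)) (at x)" by blast
  then show ?case
    by (intro exI[of _ "\<lambda>b x. p' b x + q' b x"]) (auto intro!: cpoly.add has_derivative_add)
next
  case (mult p q)
  then obtain p' q' where "\<forall>b. p' b \<in> cpoly" "\<forall>x. (p has_derivative (\<lambda>b. p' b x)) (at x)"
    "\<forall>b. q' b \<in> cpoly" "\<forall>x. (q has_derivative (\<lambda>b. q' b x)) (at x)" by blast
  then show ?case using mult.hyps
    by (intro exI[of _ "\<lambda>b x. p x * q' b x + p' b x * q x"])
       (auto intro!: cpoly.add cpoly.mult has_derivative_mult)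
qed

lemma cpoly_bound:
  assumes "p \<in> cpoly"
  shows "\<exists>C k. C \<ge> 0 \<and> (\<forall>x. norm (p x) \<le> C * (1 + norm x) ^ k)"
  using assms
proof induction
  case (const c)
  show ?case by (intro exI[of _ "norm c"] exI[of _ 0]) auto
next
  case (inner a)
  have "\<bar>x \<bullet> a\<bar> \<le> norm a * (1 + norm x)" for x
    using Cauchy_Schwarz_ineq2[of x a] by (simp add: algebra_simps add_increasing)
  then show ?case by (intro exI[of _ "norm a"] exI[of _ 1]) auto
next
  case (add p q)
  then obtain C k D l where *: "C \<ge> 0" "\<And>x. norm (p x) \<le> C * (1 + norm x) ^ k"
    "D \<ge> 0" "\<And>x. norm (q x) \<le> D * (1 + norm x) ^ l" by blast
  have "norm (p x + q x) \<le> (C + D) * (1 + norm x) ^ (k + l)" for x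
  proof -
    have "norm (p x) \<le> C * (1 + norm x) ^ (k + l)" "norm (q x) \<le> D * (1 + norm x) ^ (k + l)"
      using * by (auto intro!: order_trans[OF *(2)] order_trans[OF *(4)] mult_left_mono power_increasing)
    then show ?thesis
      using norm_triangle_ineq[of "p x" "q x"] by (simp add: algebra_simps)
  qed
  then show ?case using * by (intro exI[of _ "C + D"] exI[of _ "k + l"]) auto
next
  case (mult p q)
  then obtain C k D l where *: "C \<ge> 0" "\<And>x. norm (p x) \<le> C * (1 + norm x) ^ k"
    "D \<ge> 0" "\<And>x. norm (q x) \<le> D * (1 + norm x) ^ l" by blast
  have "norm (p x * q x) \<le> (C * D) * (1 + norm x) ^ (k + l)" for x
  proof -
    have "norm (p x * q x) \<le> (C * (1 + norm x) ^ k) * (D * (1 + norm x) ^ l)"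
      unfolding norm_mult using * by (intro mult_mono) auto
    then show ?thesis by (simp add: power_add algebra_simps)
  qed
  then show ?case using * by (intro exI[of _ "C * D"] exI[of _ "k + l"]) auto
qed

text \<open>Every partial derivative is a polynomial times the function itself, and the quadratic
  decay beats any power. The vector \<open>a\<close> allows for translated Gaussians and
  \<open>b\<close> for modulated ones; both kinds are used as test functions.\<close>

lemma gaussian_schwartz:
  fixes a b :: "'a::euclidean_space"
  assumes t: "t > 0"
  shows "(\<lambda>x. complex_of_real (exp (- t * (norm x)\<^sup>2 + a \<bullet> x + c)) * cis (b \<bullet> x)) \<in> schwartz"
proof -
  define f where "f = (\<lambda>x. exp (complex_of_real (- t * (x \<bullet> x) + x \<bullet> a + c) + \<i> * complex_of_real (x \<bullet> b)))"
  define f' where "f' = (\<lambda>h x. complex_of_real (x \<bullet> ((- 2 * t) *\<^sub>R h)) + (complex_of_real (h \<bullet> a) + \<i> * complex_of_real (h \<bullet> b)))"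
  have feq: "f = (\<lambda>x. complex_of_real (exp (- t * (norm x)\<^sup>2 + a \<bullet> x + c)) * cis (b \<bullet> x))"
    by (auto simp: f_def fun_eq_iff exp_add cis_conv_exp power2_norm_eq_inner inner_commute of_real_exp)
  have f'_poly: "f' h \<in> cpoly" for h
    unfolding f'_def by (intro cpoly.intros)
  have f_deriv: "(f has_derivative (\<lambda>h. f' h x * f x)) (at x)" for x
  proof -
    let ?e = "\<lambda>x. complex_of_real (- t * (x \<bullet> x) + x \<bullet> a + c) + \<i> * complex_of_real (x \<bullet> b)"
    have "(?e has_derivative (\<lambda>h. f' h x)) (at x)"
      unfolding f'_def
      by (auto intro!: derivative_eq_intros simp: fun_eq_iff algebra_simps inner_commute)
    from has_derivative_compose[OF this DERIV_exp[THEN has_field_derivative_imp_has_derivative]]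
    show ?thesis unfolding f_def by (simp add: mult.commute)
  qed
  have pd: "\<exists>p\<in>cpoly. partial_derivs bs f = (\<lambda>x. p x * f x)" for bs
  proof (induction bs)
    case Nil
    show ?case by (rule bexI[of _ "\<lambda>x. 1"]) (auto intro: cpoly.const)
  next
    case (Cons h bs)
    then obtain p where p: "p \<in> cpoly" "partial_derivs bs f = (\<lambda>x. p x * f x)" by blast
    obtain p' where p': "\<And>b. p' b \<in> cpoly" "\<And>x. (p has_derivative (\<lambda>b. p' b x)) (at x)"
      using cpoly_has_derivative[OF p(1)] by blast
    have "((\<lambda>x. p x * f x) has_derivative (\<lambda>h. p x * (f' h x * f x) + p' h x * f x)) (at x)" for x
      by (intro has_derivative_mult f_deriv p')
    then have "frechet_derivative (\<lambda>x. p x * f x) (at x) = (\<lambda>h. p x * (f' h x * f x) + p' h x * f x)" for x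
      by (rule frechet_derivative_at[symmetric])
    then have "partial_derivs (h # bs) f = (\<lambda>x. (p x * f' h x + p' h x) * f x)"
      by (simp add: p fun_eq_iff distrib_right mult.assoc)
    then show ?case
      using p(1) p'(1) f'_poly by (intro bexI[of _ "\<lambda>x. p x * f' h x + p' h x"] cpoly.add cpoly.mult)
  qed
  have "partial_derivs bs f differentiable (at x)" for bs x
  proof -
    obtain p where p: "p \<in> cpoly" "partial_derivs bs f = (\<lambda>x. p x * f x)" using pd by blast
    obtain p' where p': "\<And>x. (p has_derivative (\<lambda>b. p' b x)) (at x)"
      using cpoly_has_derivative[OF p(1)] by blast
    show ?thesis unfolding p(2)
      using has_derivative_mult[OF p' f_deriv] by (rule differentiableI)
  qed
  moreover have "bounded (range (\<lambda>x. norm x ^ k *\<^sub>R partial_derivs bs f x))" for bs k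
  proof -
    obtain p where p: "p \<in> cpoly" "partial_derivs bs f = (\<lambda>x. p x * f x)" using pd by blast
    obtain C l where C: "C \<ge> 0" "\<And>x. norm (p x) \<le> C * (1 + norm x) ^ l"
      using cpoly_bound[OF p(1)] by blast
    \<comment> \<open>The total linear rate in the exponent: 1 from bounding powers by
      \<open>exp (1 + norm x)\<close>, and \<open>norm a\<close> from the term
      \<open>a \<bullet> x\<close>. Completing the square leaves
      \<open>d^2 / (4 * t)\<close>.\<close>
    define d where "d = 1 + norm a"
    have "norm (norm x ^ k *\<^sub>R (p x * f x)) \<le> C * fact (k + l) * exp (1 + c + d\<^sup>2 / (4 * t))" for x
    proof -
      have 1: "norm (f x) \<le> exp (- t * (norm x)\<^sup>2 + norm a * norm x + c)"
        using norm_cauchy_schwarz[of a x] by (simp add: feq norm_mult)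
      have "norm x ^ k * (C * (1 + norm x) ^ l) \<le> (1 + norm x) ^ k * (C * (1 + norm x) ^ l)"
        using C by (intro mult_right_mono power_mono) auto
      also have "\<dots> = C * (1 + norm x) ^ (k + l)" by (simp add: power_add)
      \<comment> \<open>A single term of the exponential series is at most the whole series.\<close>
      also have "(1 + norm x) ^ (k + l) \<le> fact (k + l) * exp (1 + norm x)"
        using sum_le_suminf[OF summable_exp_generic[of "1 + norm x"], of "{k + l}"]
        by (simp add: exp_def field_simps)
      finally have 2: "norm x ^ k * (C * (1 + norm x) ^ l) \<le> C * (fact (k + l) * exp (1 + norm x))"
        using C by (auto intro: mult_left_mono)
      have "norm (norm x ^ k *\<^sub>R (p x * f x)) = norm x ^ k * norm (p x) * norm (f x)"
        by (simp add: norm_mult)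
      also have "\<dots> \<le> (norm x ^ k * (C * (1 + norm x) ^ l)) * norm (f x)"
        using C by (intro mult_right_mono mult_left_mono) auto
      also have "\<dots> \<le> (C * (fact (k + l) * exp (1 + norm x))) * exp (- t * (norm x)\<^sup>2 + norm a * norm x + c)"
        using C by (intro mult_mono 1 2) auto
      also have "\<dots> = C * fact (k + l) * exp (1 + c + (d * norm x - t * (norm x)\<^sup>2))"
        by (simp add: d_def exp_add[symmetric] algebra_simps mult_exp_exp)
      also have "\<dots> \<le> C * fact (k + l) * exp (1 + c + d\<^sup>2 / (4 * t))"
      proof -
        have "0 \<le> (2 * t * norm x - d)\<^sup>2" by simp
        then have "4 * t * (d * norm x - t * (norm x)\<^sup>2) \<le> d\<^sup>2"
          by (simp add: power2_eq_square algebra_simps)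
        then have "d * norm x - t * (norm x)\<^sup>2 \<le> d\<^sup>2 / (4 * t)" using t by (simp add: field_simps)
        then show ?thesis using C by (intro mult_left_mono) auto
      qed
      finally show ?thesis .
    qed
    then show ?thesis unfolding p(2) by (intro boundedI) auto
  qed
  ultimately show ?thesis unfolding schwartz_def feq by auto
qed

subsection \<open>Distributional Fourier transforms\<close>

lemma lebesgue_complex_borel_version:
  fixes g :: "'a::euclidean_space \<Rightarrow> complex"
  assumes "g \<in> borel_measurable lebesgue"
  obtains g' where "g' \<in> borel_measurable borel" "AE x in lebesgue. g x = g' x"
proof -
  have "(\<lambda>x. Re (g x)) \<in> borel_measurable lebesgue" "(\<lambda>x. Im (g x)) \<in> borel_measurable lebesgue"
    by (intro measurable_compose[OF assms] borel_measurable_continuous_onI continuous_intros)+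
  then obtain a b where a: "a \<in> borel_measurable lborel" "AE x in lborel. Re (g x) = a x"
    and b: "b \<in> borel_measurable lborel" "AE x in lborel. Im (g x) = b x"
    by (auto dest!: completion_ex_borel_measurable_real)
  have [measurable]: "a \<in> borel_measurable borel" "b \<in> borel_measurable borel"
    using a b by auto
  show thesis
  proof (rule that)
    show "(\<lambda>x. complex_of_real (a x) + \<i> * complex_of_real (b x)) \<in> borel_measurable borel" by measurable
    have "AE x in lborel. g x = complex_of_real (a x) + \<i> * complex_of_real (b x)"
      using a(2) b(2) by eventually_elim (auto simp: complex_eq_iff)
    then show "AE x in lebesgue. g x = complex_of_real (a x) + \<i> * complex_of_real (b x)"
      by (rule AE_completion)
  qed
qed

lemma has_fourier_transform_cong_AE:
  assumes ft: "has_fourier_transform u g"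
    and u: "AE x in lebesgue. u x = u' x" "u' \<in> borel_measurable lebesgue"
    and g: "AE x in lebesgue. g x = g' x" "g' \<in> borel_measurable lebesgue"
  shows "has_fourier_transform u' g'"
  unfolding has_fourier_transform_def
proof (intro conjI ballI u(2) g(2))
  fix \<phi> :: "'a \<Rightarrow> complex" assume \<phi>: "\<phi> \<in> schwartz"
  have meas: "u \<in> borel_measurable lebesgue" "g \<in> borel_measurable lebesgue"
    using ft unfolding has_fourier_transform_def by auto
  have 1: "integrable lebesgue (\<lambda>x. complex_of_real (u x) * \<phi> x)" "integrable lebesgue (\<lambda>\<xi>. g \<xi> * \<phi> \<xi>)"
    "(LINT x|lebesgue. complex_of_real (u x) * fourier_integral \<phi> x) = (LINT \<xi>|lebesgue. g \<xi> * \<phi> \<xi>)"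
    using ft \<phi> unfolding has_fourier_transform_def by auto
  have cont: "continuous_on UNIV \<phi>"
  proof -
    have "\<phi> differentiable (at x)" for x
      using \<phi> lists.Nil[of Basis] unfolding schwartz_def by (auto dest!: bspec[of _ _ "[]"])
    then show ?thesis
      by (auto intro!: continuous_at_imp_continuous_on differentiable_imp_continuous_within)
  qed
  then have \<phi>_borel [measurable]: "\<phi> \<in> borel_measurable borel"
    by (rule borel_measurable_continuous_onI)
  then have \<phi>m: "\<phi> \<in> borel_measurable lebesgue"
    by (intro measurable_completion) simp
  have m: "(\<lambda>x. complex_of_real (u x) * \<phi> x) \<in> borel_measurable lebesgue"
    "(\<lambda>x. complex_of_real (u' x) * \<phi> x) \<in> borel_measurable lebesgue"
    "(\<lambda>x. g x * \<phi> x) \<in> borel_measurable lebesgue" "(\<lambda>x. g' x * \<phi> x) \<in> borel_measurable lebesgue"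
    using \<phi>m meas u(2) g(2) by (auto intro!: borel_measurable_times borel_measurable_of_real)
  have ae: "AE x in lebesgue. complex_of_real (u x) * f x = complex_of_real (u' x) * f x"
    "AE x in lebesgue. g x * f x = g' x * f x" for f
    using u(1) g(1) by (eventually_elim, simp)+
  show "integrable lebesgue (\<lambda>x. complex_of_real (u' x) * \<phi> x)"
    by (rule integrable_cong_AE_imp[OF 1(1) m(2)]) (use ae(1)[of \<phi>] in \<open>auto elim!: eventually_mono\<close>)
  show "integrable lebesgue (\<lambda>x. g' x * \<phi> x)"
    by (rule integrable_cong_AE_imp[OF 1(2) m(4)]) (use ae(2)[of \<phi>] in \<open>auto elim!: eventually_mono\<close>)
  have e: "(LINT x|lebesgue. g x * \<phi> x) = (LINT x|lebesgue. g' x * \<phi> x)"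
    by (rule integral_cong_AE[OF m(3,4) ae(2)])
  show "(LINT x|lebesgue. complex_of_real (u' x) * fourier_integral \<phi> x) = (LINT \<xi>|lebesgue. g' \<xi> * \<phi> \<xi>)"
  proof -
    \<comment> \<open>Replacing \<open>u\<close> in the pairing needs
      \<open>fourier_integral \<phi>\<close> to be measurable; the version of its integral over
      \<open>lborel\<close> shows this.\<close>
    have "(\<lambda>\<xi>. LINT x|lborel. cis (- (x \<bullet> \<xi>)) * \<phi> x) \<in> borel_measurable borel"
      by measurable
    moreover have "(LINT x|lebesgue. cis (- (x \<bullet> \<xi>)) * \<phi> x) = (LINT x|lborel. cis (- (x \<bullet> \<xi>)) * \<phi> x)" for \<xi>
      by (intro integral_completion) measurable
    ultimately have "fourier_integral \<phi> \<in> borel_measurable borel"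
      unfolding fourier_integral_def[abs_def] by simp
    then have "fourier_integral \<phi> \<in> borel_measurable lebesgue"
      by (intro measurable_completion) simp
    then have "(LINT x|lebesgue. complex_of_real (u x) * fourier_integral \<phi> x) = (LINT x|lebesgue. complex_of_real (u' x) * fourier_integral \<phi> x)"
      using meas u(2) by (intro integral_cong_AE ae(1)) (auto intro!: borel_measurable_times borel_measurable_of_real)
    then show ?thesis using 1(3) e by simp
  qed
qed

lemma has_fourier_transformD:
  assumes "has_fourier_transform u g" "\<phi> \<in> schwartz"
  shows "integrable lebesgue (\<lambda>x. complex_of_real (u x) * \<phi> x)"
    and "integrable lebesgue (\<lambda>\<xi>. g \<xi> * \<phi> \<xi>)"
    and "(LINT x|lebesgue. complex_of_real (u x) * fourier_integral \<phi> x) = (LINT \<xi>|lebesgue. g \<xi> * \<phi> \<xi>)"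
  using assms unfolding has_fourier_transform_def by simp_all

section \<open>Testing with Gaussians\<close>

lemma centered_gaussian_schwartz:
  fixes x :: "'a::euclidean_space"
  assumes "t > 0"
  shows "(\<lambda>y. complex_of_real (exp (- t * (norm (y - x))\<^sup>2))) \<in> schwartz"
proof -
  have "- t * (norm (y - x))\<^sup>2 = - t * (norm y)\<^sup>2 + ((2 * t) *\<^sub>R x) \<bullet> y + - t * (norm x)\<^sup>2" for y
    unfolding power2_norm_eq_inner by (simp add: inner_commute algebra_simps)
  then have "(\<lambda>y. complex_of_real (exp (- t * (norm (y - x))\<^sup>2))) =
      (\<lambda>y. complex_of_real (exp (- t * (norm y)\<^sup>2 + ((2 * t) *\<^sub>R x) \<bullet> y + - t * (norm x)\<^sup>2)) * cis (0 \<bullet> y))"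
    by (simp only: inner_zero_left cis_zero mult_1_right)
  then show ?thesis
    by (simp only: gaussian_schwartz[OF assms])
qed

text \<open>Borel representatives make the product-measure arguments available.\<close>

locale fourier_pair =
  fixes u :: "'a::euclidean_space \<Rightarrow> real" and g :: "'a \<Rightarrow> complex"
  assumes u_meas [measurable]: "u \<in> borel_measurable borel"
    and g_meas [measurable]: "g \<in> borel_measurable borel"
    and ft: "has_fourier_transform u g"
begin

lemma gaussian_integrable:
  assumes "t > 0"
  shows "integrable lborel (\<lambda>y. u y * exp (- t * (norm (y - x))\<^sup>2))"
    and "integrable lborel (\<lambda>y. g y * complex_of_real (exp (- t * (norm (y - x))\<^sup>2)))"
proof -
  let ?\<phi> = "\<lambda>y. complex_of_real (exp (- t * (norm (y - x))\<^sup>2))"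
  have "integrable lebesgue (\<lambda>y. complex_of_real (u y) * ?\<phi> y)" "integrable lebesgue (\<lambda>y. g y * ?\<phi> y)"
    by (fact has_fourier_transformD(1,2)[OF ft centered_gaussian_schwartz[OF assms]])+
  then have "integrable lborel (\<lambda>y. complex_of_real (u y) * ?\<phi> y)" and 2: "integrable lborel (\<lambda>y. g y * ?\<phi> y)"
    by (auto simp: integrable_completion)
  then show "integrable lborel (\<lambda>y. u y * exp (- t * (norm (y - x))\<^sup>2))"
    by (simp only: of_real_mult[symmetric] complex_of_real_integrable_eq)
  show "integrable lborel (\<lambda>y. g y * complex_of_real (exp (- t * (norm (y - x))\<^sup>2)))" by (fact 2)
qed

text \<open>The transform is tested with a Gaussian modulated by
  \<open>cis (x \<bullet> \<xi>)\<close>. Its Fourier integral is a Gaussian of width \<sigma>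
  centred at \<open>x\<close>, so the side of \<open>u\<close> becomes the Gaussian mean after the
  substitution \<open>y = x + \<sigma> z\<close>. The unitary factor of
  \<open>fourier_integral\<close> cancels the constant of the Gaussian integral.\<close>

lemma gauss_mean_eq:
  assumes \<sigma>: "\<sigma> > 0"
  shows "integrable lborel (\<lambda>\<xi>. g \<xi> * complex_of_real (exp (- (\<sigma> * norm \<xi>)\<^sup>2 / 2)) * cis (x \<bullet> \<xi>))"
    and "complex_of_real (gauss_mean \<sigma> u x) =
      (LINT \<xi>|lborel. g \<xi> * complex_of_real (exp (- (\<sigma> * norm \<xi>)\<^sup>2 / 2)) * cis (x \<bullet> \<xi>))"
proof -
  let ?\<phi> = "\<lambda>\<xi>. complex_of_real (exp (- (\<sigma> * norm \<xi>)\<^sup>2 / 2)) * cis (x \<bullet> \<xi>)"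
  have "?\<phi> = (\<lambda>\<xi>. complex_of_real (exp (- (\<sigma>\<^sup>2 / 2) * (norm \<xi>)\<^sup>2 + 0 \<bullet> \<xi> + 0)) * cis (x \<bullet> \<xi>))"
    by (auto simp: fun_eq_iff power_mult_distrib)
  moreover have "\<sigma>\<^sup>2 / 2 > 0" using \<sigma> by simp
  ultimately have sch: "?\<phi> \<in> schwartz" by (simp only: gaussian_schwartz)
  have F: "fourier_integral ?\<phi> y = complex_of_real (exp (- (norm (x - y) / \<sigma>)\<^sup>2 / 2) / \<sigma> ^ DIM('a))" for y
  proof -
    have "(LINT z|lebesgue. cis (- (z \<bullet> y)) * ?\<phi> z) = (LINT z|lborel. cis (- (z \<bullet> y)) * ?\<phi> z)"
      by (intro integral_completion) measurable
    also have "\<dots> = (LINT z|lborel. cis ((x - y) \<bullet> z) * complex_of_real (exp (- (\<sigma> * norm z)\<^sup>2 / 2)))"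
    proof (intro Bochner_Integration.integral_cong refl)
      fix z :: 'a
      have "cis ((x - y) \<bullet> z) = cis (- (z \<bullet> y)) * cis (x \<bullet> z)"
        by (simp add: cis_mult inner_diff_left inner_commute[of z])
      then show "cis (- (z \<bullet> y)) * ?\<phi> z = cis ((x - y) \<bullet> z) * complex_of_real (exp (- (\<sigma> * norm z)\<^sup>2 / 2))" by simp
    qed
    also note gaussian_fourier_integral_scaled(2)[OF \<sigma>]
    finally show ?thesis
      unfolding fourier_integral_def using \<sigma>
      by (simp add: powr_minus field_simps)
  qed
  have int: "integrable lebesgue (\<lambda>\<xi>. g \<xi> * ?\<phi> \<xi>)"
    and eq: "(LINT y|lebesgue. complex_of_real (u y) * fourier_integral ?\<phi> y) = (LINT \<xi>|lebesgue. g \<xi> * ?\<phi> \<xi>)"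
    by (fact has_fourier_transformD(2,3)[OF ft sch])+
  have "integrable lborel (\<lambda>\<xi>. g \<xi> * ?\<phi> \<xi>)"
    using int by (simp add: integrable_completion)
  then show "integrable lborel (\<lambda>\<xi>. g \<xi> * complex_of_real (exp (- (\<sigma> * norm \<xi>)\<^sup>2 / 2)) * cis (x \<bullet> \<xi>))"
    by (simp only: mult.assoc)
  let ?f = "\<lambda>y. u y * (exp (- (norm (x - y) / \<sigma>)\<^sup>2 / 2) / \<sigma> ^ DIM('a))"
  have "(LINT y|lebesgue. complex_of_real (u y) * fourier_integral ?\<phi> y) = (LINT y|lebesgue. complex_of_real (?f y))"
    by (simp only: F of_real_mult)
  also have "\<dots> = complex_of_real (LINT y|lebesgue. ?f y)" by (rule Bochner_Integration.integral_complex_of_real)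
  also have "(LINT y|lebesgue. ?f y) = (LINT y|lborel. ?f y)"
    by (intro integral_completion) measurable
  also have "\<dots> = (\<bar>\<sigma>\<bar> ^ DIM('a)) *\<^sub>R (LINT z|lborel. ?f (x + \<sigma> *\<^sub>R z))"
    by (rule integral_lborel_affine) (use \<sigma> in auto)
  also have "\<dots> = gauss_mean \<sigma> u x"
  proof -
    have "(\<bar>\<sigma>\<bar> ^ DIM('a)) *\<^sub>R (LINT z|lborel. ?f (x + \<sigma> *\<^sub>R z)) = (LINT z|lborel. \<bar>\<sigma>\<bar> ^ DIM('a) * ?f (x + \<sigma> *\<^sub>R z))"
      by (simp only: integral_mult_right_zero real_scaleR_def)
    also have "(\<lambda>z. \<bar>\<sigma>\<bar> ^ DIM('a) * ?f (x + \<sigma> *\<^sub>R z)) = (\<lambda>z. u (x + \<sigma> *\<^sub>R z) * exp (- (norm z)\<^sup>2 / 2))"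
      using \<sigma> by (auto simp: fun_eq_iff)
    finally show ?thesis unfolding gauss_mean_def .
  qed
  finally have "complex_of_real (gauss_mean \<sigma> u x) = (LINT \<xi>|lebesgue. g \<xi> * ?\<phi> \<xi>)"
    using eq by simp
  also have "\<dots> = (LINT \<xi>|lborel. g \<xi> * ?\<phi> \<xi>)"
    by (intro integral_completion) measurable
  finally show "complex_of_real (gauss_mean \<sigma> u x) =
      (LINT \<xi>|lborel. g \<xi> * complex_of_real (exp (- (\<sigma> * norm \<xi>)\<^sup>2 / 2)) * cis (x \<bullet> \<xi>))"
    by (simp only: mult.assoc)
qed

lemma gauss_mean_integrable:
  assumes \<sigma>: "\<sigma> > 0"
  shows "integrable lborel (\<lambda>z. u (x + \<sigma> *\<^sub>R z) * exp (- (norm z)\<^sup>2 / 2))"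
proof -
  let ?f = "\<lambda>y. u y * exp (- (1 / (2 * \<sigma>\<^sup>2)) * (norm (y - x))\<^sup>2)"
  have "integrable lborel (\<lambda>z. ?f (x + \<sigma> *\<^sub>R z))"
    using \<sigma> gaussian_integrable(1)[of "1 / (2 * \<sigma>\<^sup>2)" x] by (subst integrable_lborel_affine_iff) auto
  then show ?thesis using \<sigma> by (simp add: power_mult_distrib)
qed

text \<open>Translation by \<open>h\<close> multiplies the transform by
  \<open>cis (h \<bullet> \<xi>)\<close>. The estimate is made for the Gaussian means of the
  difference, whose transform is integrable, and then transferred to the difference itself.\<close>

lemma translation_difference_le:
  "(\<integral>\<^sup>+x. ennreal ((u (x + h) - u x)\<^sup>2) \<partial>lborel)
     \<le> (\<integral>\<^sup>+\<xi>. ennreal ((norm (cis (h \<bullet> \<xi>) - 1))\<^sup>2 * (norm (g \<xi>))\<^sup>2) \<partial>lborel)"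
proof (rule nn_integral_square_le_gauss_mean)
  fix a :: real assume a: "a > 0"
  have "integrable lborel (\<lambda>y. u (h + 1 *\<^sub>R y) * exp (- a * (norm (h + 1 *\<^sub>R y - h))\<^sup>2))"
    using gaussian_integrable(1)[OF a, of h] by (subst integrable_lborel_affine_iff) auto
  then have "integrable lborel (\<lambda>y. u (y + h) * exp (- a * (norm y)\<^sup>2))" by (simp add: add.commute)
  moreover have "integrable lborel (\<lambda>y. u y * exp (- a * (norm y)\<^sup>2))"
    using gaussian_integrable(1)[OF a, of 0] by simp
  ultimately show "integrable lborel (\<lambda>y. (u (y + h) - u y) * exp (- a * (norm y)\<^sup>2))"
    by (simp add: left_diff_distrib)
next
  fix \<sigma> :: real assume \<sigma>: "0 < \<sigma>"
  \<comment> \<open>The transform of the regularised difference. The Gaussian makes it integrable,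
    as \<open>plancherel_le\<close> requires.\<close>
  let ?F = "\<lambda>\<xi>. g \<xi> * complex_of_real (exp (- (\<sigma> * norm \<xi>)\<^sup>2 / 2)) * (cis (h \<bullet> \<xi>) - 1)"
  have eq: "?F \<xi> * cis (x \<bullet> \<xi>) = g \<xi> * complex_of_real (exp (- (\<sigma> * norm \<xi>)\<^sup>2 / 2)) * cis ((x + h) \<bullet> \<xi>)
       - g \<xi> * complex_of_real (exp (- (\<sigma> * norm \<xi>)\<^sup>2 / 2)) * cis (x \<bullet> \<xi>)" for x \<xi>
  proof -
    have "cis ((x + h) \<bullet> \<xi>) = cis (h \<bullet> \<xi>) * cis (x \<bullet> \<xi>)" by (simp add: cis_mult inner_add_left add.commute)
    then show ?thesis by (simp add: algebra_simps)
  qed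
  have intF: "integrable lborel ?F"
  proof -
    have "integrable lborel (\<lambda>\<xi>. ?F \<xi> * cis (0 \<bullet> \<xi>))"
      unfolding eq by (intro Bochner_Integration.integrable_diff gauss_mean_eq(1) \<sigma>)
    then show ?thesis by simp
  qed
  have gm: "complex_of_real (gauss_mean \<sigma> (\<lambda>x. u (x + h) - u x) x) = (LINT \<xi>|lborel. ?F \<xi> * cis (x \<bullet> \<xi>))" for x
  proof -
    have "gauss_mean \<sigma> (\<lambda>x. u (x + h) - u x) x = gauss_mean \<sigma> u (x + h) - gauss_mean \<sigma> u x"
      using Bochner_Integration.integral_diff[OF gauss_mean_integrable[OF \<sigma>, of "x + h"] gauss_mean_integrable[OF \<sigma>, of x]]
      unfolding gauss_mean_def by (simp add: algebra_simps)
    then show ?thesis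
      unfolding eq
      by (simp only: Bochner_Integration.integral_diff[OF gauss_mean_eq(1)[OF \<sigma>] gauss_mean_eq(1)[OF \<sigma>]]
          gauss_mean_eq(2)[OF \<sigma>] of_real_diff)
  qed
  have "(gauss_mean \<sigma> (\<lambda>x. u (x + h) - u x) x)\<^sup>2 = (norm (LINT \<xi>|lborel. ?F \<xi> * cis (x \<bullet> \<xi>)))\<^sup>2" for x
    unfolding gm[symmetric] by simp
  then have "(\<integral>\<^sup>+x. ennreal ((gauss_mean \<sigma> (\<lambda>x. u (x + h) - u x) x)\<^sup>2) \<partial>lborel)
    \<le> ennreal ((2 * pi) ^ DIM('a)) * (\<integral>\<^sup>+\<xi>. ennreal ((norm (?F \<xi>))\<^sup>2) \<partial>lborel)"
    using plancherel_le[OF intF] by simp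
  also have "\<dots> \<le> ennreal ((2 * pi) ^ DIM('a)) *
    (\<integral>\<^sup>+\<xi>. ennreal ((norm (cis (h \<bullet> \<xi>) - 1))\<^sup>2 * (norm (g \<xi>))\<^sup>2) \<partial>lborel)"
  \<comment> \<open>The damping factor is at most 1, so the bound becomes independent of
    \<sigma>.\<close>
  proof (intro mult_left_mono nn_integral_mono ennreal_leI)
    fix \<xi>
    have "norm (?F \<xi>) = norm (g \<xi>) * exp (- (\<sigma> * norm \<xi>)\<^sup>2 / 2) * norm (cis (h \<bullet> \<xi>) - 1)"
      by (simp add: norm_mult)
    also have "\<dots> \<le> norm (g \<xi>) * 1 * norm (cis (h \<bullet> \<xi>) - 1)"
      by (intro mult_right_mono mult_left_mono) auto
    finally have "(norm (?F \<xi>))\<^sup>2 \<le> (norm (g \<xi>) * norm (cis (h \<bullet> \<xi>) - 1))\<^sup>2"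
      by (intro power_mono) auto
    then show "(norm (?F \<xi>))\<^sup>2 \<le> (norm (cis (h \<bullet> \<xi>) - 1))\<^sup>2 * (norm (g \<xi>))\<^sup>2"
      by (simp add: power_mult_distrib mult.commute)
  qed auto
  finally show "(\<integral>\<^sup>+x. ennreal ((gauss_mean \<sigma> (\<lambda>x. u (x + h) - u x) x)\<^sup>2) \<partial>lborel)
    \<le> ennreal ((2 * pi) ^ DIM('a)) * (\<integral>\<^sup>+\<xi>. ennreal ((norm (cis (h \<bullet> \<xi>) - 1))\<^sup>2 * (norm (g \<xi>))\<^sup>2) \<partial>lborel)" .
qed measurable

end

text \<open>The difference \<open>d\<close> of two transforms integrates to 0 against all translated
  Gaussians, so its Gaussian means vanish and the square norm bound with \<open>B = 0\<close> forces
  \<open>d = 0\<close> almost everywhere.\<close>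

lemma has_fourier_transform_unique_borel:
  assumes "fourier_pair u g" "fourier_pair u g'"
  shows "AE x in lborel. g x = g' x"
proof -
  interpret G: fourier_pair u g by fact
  interpret G': fourier_pair u g' by fact
  define d where "d x = g x - g' x" for x
  have [measurable]: "d \<in> borel_measurable borel" unfolding d_def by measurable
  have dint: "integrable lborel (\<lambda>y. d y * complex_of_real (exp (- t * (norm (y - x))\<^sup>2)))" if "t > 0" for t x
    unfolding d_def left_diff_distrib
    by (intro Bochner_Integration.integrable_diff G.gaussian_integrable(2) G'.gaussian_integrable(2) that)
  have d0: "(LINT y|lborel. d y * complex_of_real (exp (- t * (norm (y - x))\<^sup>2))) = 0" if t: "t > 0" for t x
  proof -
    let ?\<phi> = "\<lambda>y. complex_of_real (exp (- t * (norm (y - x))\<^sup>2))"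
    have "(LINT y|lebesgue. g y * ?\<phi> y) = (LINT y|lebesgue. g' y * ?\<phi> y)"
      using has_fourier_transformD(3)[OF G.ft centered_gaussian_schwartz[OF t]]
        has_fourier_transformD(3)[OF G'.ft centered_gaussian_schwartz[OF t]] by simp
    moreover have "(LINT y|lebesgue. g y * ?\<phi> y) = (LINT y|lborel. g y * ?\<phi> y)"
      "(LINT y|lebesgue. g' y * ?\<phi> y) = (LINT y|lborel. g' y * ?\<phi> y)"
      by (intro integral_completion; measurable)+
    ultimately show ?thesis
      unfolding d_def left_diff_distrib
      by (subst Bochner_Integration.integral_diff[OF G.gaussian_integrable(2)[OF t] G'.gaussian_integrable(2)[OF t]]) simp
  qed
  \<comment> \<open>The bound is for real functions; \<open>P\<close> stands for the real and for
    the imaginary part.\<close>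
  have zero: "AE x in lborel. P (d x) = 0" if P: "bounded_linear P" "\<And>r z. P (z * complex_of_real r) = P z * r"
    for P :: "complex \<Rightarrow> real"
  proof -
    have [measurable]: "P \<in> borel_measurable borel"
      using P(1) by (intro borel_measurable_continuous_onI linear_continuous_on)
    have "(\<integral>\<^sup>+x. ennreal ((P (d x))\<^sup>2) \<partial>lborel) \<le> 0"
    proof (rule nn_integral_square_le_gauss_mean)
      show "integrable lborel (\<lambda>y. P (d y) * exp (- a * (norm y)\<^sup>2))" if "a > 0" for a
        using integrable_bounded_linear[OF P(1) dint[OF that, of 0]] by (simp add: P(2))
      fix \<sigma> :: real assume \<sigma>: "0 < \<sigma>"
      have "gauss_mean \<sigma> (\<lambda>x. P (d x)) x = 0" for x
      proof -
        let ?f = "\<lambda>y. P (d y) * exp (- (1 / (2 * \<sigma>\<^sup>2)) * (norm (y - x))\<^sup>2)"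
        have "P (LINT y|lborel. d y * complex_of_real (exp (- (1 / (2 * \<sigma>\<^sup>2)) * (norm (y - x))\<^sup>2))) = (LINT y|lborel. ?f y)"
          using integral_bounded_linear[OF P(1) dint[of "1 / (2 * \<sigma>\<^sup>2)" x]] \<sigma> by (simp add: P(2))
        then have "(LINT y|lborel. ?f y) = 0"
          using d0[of "1 / (2 * \<sigma>\<^sup>2)" x] \<sigma> linear_0[OF bounded_linear.linear[OF P(1)]] by simp
        moreover have "(LINT y|lborel. ?f y) = (\<bar>\<sigma>\<bar> ^ DIM('a)) *\<^sub>R (LINT z|lborel. ?f (x + \<sigma> *\<^sub>R z))"
          by (rule integral_lborel_affine) (use \<sigma> in auto)
        ultimately show ?thesis
          using \<sigma> by (simp add: gauss_mean_def power_mult_distrib)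
      qed
      then show "(\<integral>\<^sup>+x. ennreal ((gauss_mean \<sigma> (\<lambda>x. P (d x)) x)\<^sup>2) \<partial>lborel) \<le> ennreal ((2 * pi) ^ DIM('a)) * 0"
        by simp
    qed measurable
    then have "AE x in lborel. ennreal ((P (d x))\<^sup>2) = 0"
      by (subst (asm) le_zero_eq, subst (asm) nn_integral_0_iff_AE) auto
    then show ?thesis by eventually_elim (simp add: ennreal_eq_0_iff)
  qed
  show ?thesis
    using zero[OF bounded_linear_Re] zero[OF bounded_linear_Im]
    by (simp, elim AE_mp) (auto intro!: AE_I2 simp: d_def complex_eq_iff)
qed

text \<open>Membership in \<open>Hdot s\<close> makes the energy of some transform finite, whereas
  \<open>Hdot_norm\<close> is computed from the one chosen by \<open>fourier_transform\<close>.
  Uniqueness identifies the two, so the norm is a genuine integral and not the default 0 of a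
  divergent one.\<close>

lemma Hdot_borel_representative:
  fixes u :: "'a::euclidean_space \<Rightarrow> real"
  assumes u: "u \<in> Hdot s"
  obtains u0 g where "fourier_pair u0 g" "AE x in lebesgue. u x = u0 x"
    "(\<integral>\<^sup>+\<xi>. ennreal (norm \<xi> powr (2 * s) * (norm (g \<xi>))\<^sup>2) \<partial>lborel) = ennreal ((Hdot_norm s u)\<^sup>2)"
    "(\<integral>\<^sup>+x. ennreal (\<bar>u0 x\<bar> powr (2 * real DIM('a) / (real DIM('a) - 2 * s))) \<partial>lborel) < \<infinity>"
proof -
  let ?p = "2 * real DIM('a) / (real DIM('a) - 2 * s)"
  from u obtain g1 where um: "u \<in> borel_measurable lebesgue" and up: "integrable lebesgue (\<lambda>x. \<bar>u x\<bar> powr ?p)"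
    and ft1: "has_fourier_transform u g1" and int1: "integrable lebesgue (\<lambda>\<xi>. norm \<xi> powr (2 * s) * (norm (g1 \<xi>))\<^sup>2)"
    unfolding Hdot_def Lp_space_def by auto
  have ft2: "has_fourier_transform u (fourier_transform u)"
    using someI[of "has_fourier_transform u", OF ft1] unfolding fourier_transform_def .
  have ft1m: "g1 \<in> borel_measurable lebesgue" and ft2m: "fourier_transform u \<in> borel_measurable lebesgue"
    using ft1 ft2 unfolding has_fourier_transform_def by simp_all
  obtain u0 where u0: "u0 \<in> borel_measurable lborel" "AE x in lborel. u x = u0 x"
    using completion_ex_borel_measurable_real[OF um] by auto
  have u0m [measurable]: "u0 \<in> borel_measurable borel" using u0 by simp
  have u0ae: "AE x in lebesgue. u x = u0 x" using u0(2) by (rule AE_completion)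
  have u0l: "u0 \<in> borel_measurable lebesgue" by (rule measurable_completion[OF u0(1)])
  obtain g where gm [measurable]: "g \<in> borel_measurable borel" and g: "AE x in lebesgue. g1 x = g x"
    by (rule lebesgue_complex_borel_version[OF ft1m]) (rule that)
  have gl: "g \<in> borel_measurable lebesgue" using gm by (simp add: measurable_completion)
  obtain g' where g'm [measurable]: "g' \<in> borel_measurable borel" and g': "AE x in lebesgue. fourier_transform u x = g' x"
    by (rule lebesgue_complex_borel_version[OF ft2m]) (rule that)
  have g'l: "g' \<in> borel_measurable lebesgue" using g'm by (simp add: measurable_completion)
  have fp: "fourier_pair u0 g" "fourier_pair u0 g'"
    using has_fourier_transform_cong_AE[OF ft1 u0ae u0l g gl] has_fourier_transform_cong_AE[OF ft2 u0ae u0l g' g'l]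
    by (auto intro!: fourier_pair.intro)
  have gg': "AE x in lebesgue. g x = g' x"
    using has_fourier_transform_unique_borel[OF fp] by (rule AE_completion)
  define k where "k \<xi> = norm \<xi> powr (2 * s) * (norm (g \<xi>))\<^sup>2" for \<xi>
  have k0: "k \<xi> \<ge> 0" for \<xi> by (simp add: k_def)
  have km [measurable]: "k \<in> borel_measurable borel" unfolding k_def by measurable
  have kl: "k \<in> borel_measurable lebesgue" using km by (simp add: measurable_completion)
  have "integrable lebesgue k"
    by (rule integrable_cong_AE_imp[OF int1 kl]) (use g in \<open>eventually_elim, simp add: k_def\<close>)
  then have kint: "integrable lborel k" by (simp add: integrable_completion)
  have "(LINT \<xi>|lebesgue. norm \<xi> powr (2 * s) * (norm (fourier_transform u \<xi>))\<^sup>2) = (LINT \<xi>|lebesgue. k \<xi>)"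
  proof (rule integral_cong_AE)
    show "AE \<xi> in lebesgue. norm \<xi> powr (2 * s) * (norm (fourier_transform u \<xi>))\<^sup>2 = k \<xi>"
      using g' gg' by eventually_elim (simp add: k_def)
    have 1: "(\<lambda>\<xi>::'a. norm \<xi> powr (2 * s)) \<in> borel_measurable lebesgue"
      by (intro measurable_completion) simp
    show "(\<lambda>\<xi>. norm \<xi> powr (2 * s) * (norm (fourier_transform u \<xi>))\<^sup>2) \<in> borel_measurable lebesgue"
      by (intro borel_measurable_times borel_measurable_power measurable_compose[OF ft2m borel_measurable_norm] 1)
  qed (rule kl)
  then have "Hdot_norm s u = sqrt (LINT \<xi>|lborel. k \<xi>)"
    unfolding Hdot_norm_def by (simp add: integral_completion)
  moreover have "0 \<le> (LINT \<xi>|lborel. k \<xi>)" by (simp add: k0)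
  ultimately have "(\<integral>\<^sup>+\<xi>. ennreal (k \<xi>) \<partial>lborel) = ennreal ((Hdot_norm s u)\<^sup>2)"
    using nn_integral_eq_integral[OF kint] k0 by simp
  moreover have "(\<integral>\<^sup>+x. ennreal (\<bar>u0 x\<bar> powr ?p) \<partial>lborel) < \<infinity>"
  proof -
    have "integrable lebesgue (\<lambda>x. \<bar>u0 x\<bar> powr ?p)"
    proof (rule integrable_cong_AE_imp[OF up])
      show "(\<lambda>x. \<bar>u0 x\<bar> powr ?p) \<in> borel_measurable lebesgue"
        by (intro measurable_completion) simp
      show "AE x in lebesgue. \<bar>u x\<bar> powr ?p = \<bar>u0 x\<bar> powr ?p"
        using u0ae by eventually_elim simp
    qed
    then have "integrable lborel (\<lambda>x. \<bar>u0 x\<bar> powr ?p)" by (simp add: integrable_completion)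
    then show ?thesis by (simp add: nn_integral_eq_integral)
  qed
  ultimately show thesis using fp(1) u0ae unfolding k_def by (intro that)
qed

subsection \<open>The Gagliardo energy\<close>

lemma norm_cis_minus_1_le: "(norm (cis t - 1))\<^sup>2 \<le> min 4 (t\<^sup>2)"
proof -
  have eq: "norm (cis t - 1) = 2 * \<bar>sin (t / 2)\<bar>"
    using dist_exp_i_1[of t] by (simp add: cis_conv_exp)
  have "2 * \<bar>sin (t / 2)\<bar> \<le> \<bar>t\<bar>" using abs_sin_x_le_abs_x[of "t / 2"] by simp
  then have "(norm (cis t - 1))\<^sup>2 \<le> \<bar>t\<bar>\<^sup>2" unfolding eq by (intro power_mono) auto
  moreover have "(norm (cis t - 1))\<^sup>2 \<le> 2\<^sup>2" unfolding eq by (intro power_mono) auto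
  ultimately show ?thesis by simp
qed

text \<open>Instead of polar coordinates, \<open>norm h powr (- a)\<close> is written as the
  integral of \<open>a * R powr (- a - 1)\<close> over \<open>R \<ge> norm h\<close>. As
  \<open>min 4 (R^2)\<close> increases with \<open>R\<close>, it may be evaluated at
  \<open>R\<close>; after the exchange of integrals only ball volumes remain.\<close>

lemma nn_integral_levy_kernel_finite:
  assumes s: "0 < s" "s < 1"
  shows "(\<integral>\<^sup>+(h::'a::euclidean_space). ennreal (min 4 ((norm h)\<^sup>2) / norm h powr (real DIM('a) + 2 * s)) \<partial>lborel) < \<infinity>"
proof -
  define a where "a = real DIM('a) + 2 * s"
  have a: "a > 0" using s by (simp add: a_def)
  define \<omega> where "\<omega> = unit_ball_vol (real DIM('a))"
  have \<omega>: "\<omega> \<ge> 0" by (simp add: \<omega>_def)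
  let ?k = "\<lambda>R. a * R powr (- a - 1)"
  have tail: "(\<integral>\<^sup>+R. ennreal (?k R) * indicator {r..} R \<partial>lborel) = ennreal (r powr (- a))" if "r > 0" for r
  proof -
    have "((\<lambda>R. ?k R) has_integral a * (- (r powr (- a - 1 + 1)) / (- a - 1 + 1))) {r..}"
      using a that by (intro has_integral_mult_right has_integral_powr_to_inf) auto
    then have "((\<lambda>R. ?k R) has_integral r powr (- a)) {r..}" using a by simp
    then show ?thesis using a by (intro nn_integral_has_integral_lebesgue') auto
  qed
  have "(\<integral>\<^sup>+(h::'a). ennreal (min 4 ((norm h)\<^sup>2) / norm h powr a) \<partial>lborel) \<le>
     (\<integral>\<^sup>+(h::'a). \<integral>\<^sup>+R. ennreal (min 4 (R\<^sup>2) * ?k R) * indicator {0..} R * indicator (cball 0 R) h \<partial>lborel \<partial>lborel)"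
  proof (intro nn_integral_mono)
    fix h :: 'a
    show "ennreal (min 4 ((norm h)\<^sup>2) / norm h powr a) \<le>
      (\<integral>\<^sup>+R. ennreal (min 4 (R\<^sup>2) * ?k R) * indicator {0..} R * indicator (cball 0 R) h \<partial>lborel)"
    proof (cases "h = 0")
      case False
      have "ennreal (min 4 ((norm h)\<^sup>2) / norm h powr a) = ennreal (min 4 ((norm h)\<^sup>2)) * ennreal (norm h powr (- a))"
        by (subst ennreal_mult[symmetric]) (auto simp: powr_minus divide_inverse)
      also have "\<dots> = (\<integral>\<^sup>+R. ennreal (min 4 ((norm h)\<^sup>2)) * (ennreal (?k R) * indicator {norm h..} R) \<partial>lborel)"
        using False by (subst nn_integral_cmult) (auto simp: tail)
      also have "\<dots> \<le> (\<integral>\<^sup>+R. ennreal (min 4 (R\<^sup>2) * ?k R) * indicator {0..} R * indicator (cball 0 R) h \<partial>lborel)"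
      proof (intro nn_integral_mono)
        fix R :: real
        have "min 4 ((norm h)\<^sup>2) \<le> min 4 (R\<^sup>2)" if "norm h \<le> R"
          using that by (intro min.mono power_mono) auto
        then show "ennreal (min 4 ((norm h)\<^sup>2)) * (ennreal (?k R) * indicator {norm h..} R) \<le>
          ennreal (min 4 (R\<^sup>2) * ?k R) * indicator {0..} R * indicator (cball 0 R) h"
          using a order_trans[OF norm_ge_zero[of h], of R]
          by (auto simp: indicator_def ennreal_mult intro!: mult_right_mono ennreal_leI)
      qed
      finally show ?thesis .
    qed simp
  qed
  also have "\<dots> = (\<integral>\<^sup>+R. \<integral>\<^sup>+(h::'a). ennreal (min 4 (R\<^sup>2) * ?k R) * indicator {0..} R * indicator (cball 0 R) h \<partial>lborel \<partial>lborel)"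
    by (rule lborel_pair.Fubini') (unfold cball_def, measurable)
  also have "\<dots> = (\<integral>\<^sup>+R. ennreal (min 4 (R\<^sup>2) * ?k R * (\<omega> * R ^ DIM('a))) * indicator {0..} R \<partial>lborel)"
  proof (intro nn_integral_cong)
    fix R :: real
    have "(\<integral>\<^sup>+(h::'a). ennreal (min 4 (R\<^sup>2) * ?k R) * indicator {0..} R * indicator (cball 0 R) h \<partial>lborel) =
       ennreal (min 4 (R\<^sup>2) * ?k R) * indicator {0..} R * emeasure lborel (cball (0::'a) R)"
      by (subst nn_integral_cmult_indicator) auto
    also have "\<dots> = ennreal (min 4 (R\<^sup>2) * ?k R * (\<omega> * R ^ DIM('a))) * indicator {0..} R"
      using a \<omega> by (auto simp: indicator_def emeasure_cball \<omega>_def ennreal_mult)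
    finally show "(\<integral>\<^sup>+(h::'a). ennreal (min 4 (R\<^sup>2) * ?k R) * indicator {0..} R * indicator (cball 0 R) h \<partial>lborel) =
      ennreal (min 4 (R\<^sup>2) * ?k R * (\<omega> * R ^ DIM('a))) * indicator {0..} R" .
  qed
  \<comment> \<open>The exponent \<open>1 - 2 * s\<close> is integrable at 0 because
    \<open>s < 1\<close>, and \<open>- 2 * s - 1\<close> at infinity because
    \<open>s > 0\<close>.\<close>
  also have "\<dots> \<le> (\<integral>\<^sup>+R. ennreal (a * \<omega>) * (ennreal (R powr (1 - 2 * s)) * indicator {0..1} R) +
      ennreal (4 * a * \<omega>) * (ennreal (R powr (- 2 * s - 1)) * indicator {1..} R) \<partial>lborel)"
  proof (intro nn_integral_mono)
    fix R :: real
    consider "R \<le> 0" | "0 < R" "R \<le> 1" | "1 < R" by linarith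
    then show "ennreal (min 4 (R\<^sup>2) * ?k R * (\<omega> * R ^ DIM('a))) * indicator {0..} R \<le>
       ennreal (a * \<omega>) * (ennreal (R powr (1 - 2 * s)) * indicator {0..1} R) +
      ennreal (4 * a * \<omega>) * (ennreal (R powr (- 2 * s - 1)) * indicator {1..} R)"
    proof cases
      case 2
      have "min 4 (R\<^sup>2) * ?k R * (\<omega> * R ^ DIM('a)) \<le> R\<^sup>2 * ?k R * (\<omega> * R ^ DIM('a))"
        using a \<omega> 2 by (intro mult_right_mono) auto
      also have "\<dots> = a * \<omega> * (R powr 2 * R powr (- a - 1) * R powr (real DIM('a)))"
        using 2 by (simp add: powr_realpow algebra_simps)
      also have "\<dots> = a * \<omega> * R powr (1 - 2 * s)"
        by (simp flip: powr_add add: a_def algebra_simps)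
      finally show ?thesis
        using 2 a \<omega> by (auto simp flip: ennreal_mult intro!: add_increasing2 ennreal_leI)
    next
      case 3
      have "min 4 (R\<^sup>2) * ?k R * (\<omega> * R ^ DIM('a)) \<le> 4 * ?k R * (\<omega> * R ^ DIM('a))"
        using a \<omega> 3 by (intro mult_right_mono) auto
      also have "\<dots> = 4 * a * \<omega> * (R powr (- a - 1) * R powr (real DIM('a)))"
        using 3 by (simp add: powr_realpow algebra_simps)
      also have "\<dots> = 4 * a * \<omega> * R powr (- 2 * s - 1)"
        by (simp only: powr_add[symmetric]) (simp add: a_def)
      finally show ?thesis
        using 3 a \<omega> by (auto simp flip: ennreal_mult intro!: add_increasing ennreal_leI)
    qed (auto simp: indicator_def)
  qed
  also have "\<dots> = ennreal (a * \<omega>) * (\<integral>\<^sup>+R. ennreal (R powr (1 - 2 * s)) * indicator {0..1} R \<partial>lborel) +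
      ennreal (4 * a * \<omega>) * (\<integral>\<^sup>+R. ennreal (R powr (- 2 * s - 1)) * indicator {1..} R \<partial>lborel)"
    by (subst nn_integral_add) (auto simp: nn_integral_cmult)
  also have "\<dots> < \<infinity>"
  proof -
    have "(\<integral>\<^sup>+R. ennreal (R powr (1 - 2 * s)) * indicator {0..1::real} R \<partial>lborel) = ennreal (1 powr (1 - 2 * s + 1) / (1 - 2 * s + 1))"
      using s by (intro nn_integral_has_integral_lebesgue' has_integral_powr_from_0) auto
    moreover have "(\<integral>\<^sup>+R. ennreal (R powr (- 2 * s - 1)) * indicator {1::real..} R \<partial>lborel) =
       ennreal (- (1 powr (- 2 * s - 1 + 1)) / (- 2 * s - 1 + 1))"
      using s by (intro nn_integral_has_integral_lebesgue' has_integral_powr_to_inf) auto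
    ultimately show ?thesis by (simp add: ennreal_mult_less_top)
  qed
  finally show ?thesis unfolding a_def .
qed

definition gagliardo_density :: "real \<Rightarrow> ('a::euclidean_space \<Rightarrow> real) \<Rightarrow> 'a \<Rightarrow> ennreal" where
  "gagliardo_density s u x = (\<integral>\<^sup>+h. ennreal ((u (x + h) - u x)\<^sup>2 / norm h powr (real DIM('a) + 2 * s)) \<partial>lborel)"

lemma borel_measurable_gagliardo_density [measurable]:
  fixes u :: "'a::euclidean_space \<Rightarrow> real"
  assumes [measurable]: "u \<in> borel_measurable borel"
  shows "gagliardo_density s u \<in> borel_measurable borel"
  unfolding gagliardo_density_def[abs_def] by measurable

text \<open>For fixed \<open>h\<close> the difference is estimated on the Fourier side. Exchanging
  integrals leaves an \<open>h\<close>-integral with parameter \<xi>, and the substitution of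
  \<open>h\<close> by \<open>h / |\<xi>|\<close> extracts \<open>|\<xi>|^(2s)\<close> from
  it.\<close>

lemma gagliardo_energy_le_fourier:
  assumes s: "0 < s" "s < 1"
  obtains C :: real where "C \<ge> 0"
    "\<And>u g. fourier_pair (u :: 'a::euclidean_space \<Rightarrow> real) g \<Longrightarrow>
       (\<integral>\<^sup>+x. gagliardo_density s u x \<partial>lborel) \<le> ennreal C * (\<integral>\<^sup>+\<xi>. ennreal (norm \<xi> powr (2 * s) * (norm (g \<xi>))\<^sup>2) \<partial>lborel)"
proof -
  define a where "a = real DIM('a) + 2 * s"
  define k where "k h = min 4 ((norm h)\<^sup>2) / norm h powr a" for h :: 'a
  have [measurable]: "k \<in> borel_measurable borel" unfolding k_def by measurable
  have k0: "k h \<ge> 0" for h by (simp add: k_def)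
  obtain C where C: "C \<ge> 0" "(\<integral>\<^sup>+h. ennreal (k h) \<partial>lborel) = ennreal C"
    using nn_integral_levy_kernel_finite[OF s, where 'a='a] unfolding k_def a_def
    by (auto simp: less_top elim: ennreal_cases)
  have scale: "(\<integral>\<^sup>+(h::'a). ennreal ((norm (cis (h \<bullet> \<xi>) - 1))\<^sup>2 / norm h powr a) \<partial>lborel) \<le> ennreal C * ennreal (norm \<xi> powr (2 * s))" for \<xi> :: 'a
  proof (cases "\<xi> = 0")
    case False
    define \<rho> where "\<rho> = norm \<xi>"
    have \<rho>: "\<rho> > 0" using False by (simp add: \<rho>_def)
    have le: "(norm (cis (h \<bullet> \<xi>) - 1))\<^sup>2 / norm h powr a \<le> \<rho> powr a * k (0 + \<rho> *\<^sub>R h)" for h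
    proof (cases "h = 0")
      case hn: False
      \<comment> \<open>Cauchy-Schwarz leaves a radial kernel, so a dilation alone finishes the
        estimate and no rotation is involved.\<close>
      have "\<bar>h \<bullet> \<xi>\<bar>\<^sup>2 \<le> (\<rho> * norm h)\<^sup>2"
        using Cauchy_Schwarz_ineq2[of h \<xi>] by (intro power_mono) (auto simp: \<rho>_def mult.commute)
      then have "min 4 ((h \<bullet> \<xi>)\<^sup>2) \<le> min 4 ((\<rho> * norm h)\<^sup>2)"
        by (intro min.mono) auto
      then have "(norm (cis (h \<bullet> \<xi>) - 1))\<^sup>2 / norm h powr a \<le> min 4 ((\<rho> * norm h)\<^sup>2) / norm h powr a"
        using norm_cis_minus_1_le[of "h \<bullet> \<xi>"] by (intro divide_right_mono) auto
      also have "\<dots> = \<rho> powr a * k (0 + \<rho> *\<^sub>R h)"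
        using \<rho> hn by (simp add: k_def powr_mult)
      finally show ?thesis .
    qed (simp add: k0)
    have "(\<integral>\<^sup>+(h::'a). ennreal ((norm (cis (h \<bullet> \<xi>) - 1))\<^sup>2 / norm h powr a) \<partial>lborel) \<le>
       (\<integral>\<^sup>+h. ennreal (\<rho> powr a) * ennreal (k (0 + \<rho> *\<^sub>R h)) \<partial>lborel)"
      using le by (intro nn_integral_mono) (auto simp flip: ennreal_mult simp: k0 intro!: ennreal_leI)
    also have "\<dots> = ennreal (\<rho> powr a) * (\<integral>\<^sup>+h. ennreal (k (0 + \<rho> *\<^sub>R h)) \<partial>lborel)"
      by (rule nn_integral_cmult) measurable
    \<comment> \<open>The factor \<open>\<rho> ^ n\<close> is the Jacobian of the dilation;
      \<open>\<rho> powr (2 * s)\<close> is what remains.\<close>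
    also have "ennreal (\<rho> powr a) = ennreal (\<rho> powr (2 * s)) * ennreal (\<bar>\<rho>\<bar> ^ DIM('a))"
      using \<rho> by (simp flip: ennreal_mult powr_realpow powr_add add: a_def add.commute)
    also have "ennreal (\<rho> powr (2 * s)) * ennreal (\<bar>\<rho>\<bar> ^ DIM('a)) * (\<integral>\<^sup>+h. ennreal (k (0 + \<rho> *\<^sub>R h)) \<partial>lborel) =
      ennreal (\<rho> powr (2 * s)) * (\<integral>\<^sup>+h. ennreal (k h) \<partial>lborel)"
      using nn_integral_lborel_affine[of "\<lambda>h. ennreal (k h)" \<rho> 0] \<rho> by (simp only: mult.assoc) simp
    also have "\<dots> = ennreal C * ennreal (norm \<xi> powr (2 * s))"
      by (simp add: C \<rho>_def mult.commute)
    finally show ?thesis .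
  qed simp
  show thesis
  proof (rule that[OF C(1)])
    fix u :: "'a \<Rightarrow> real" and g assume "fourier_pair u g"
    then interpret fourier_pair u g .
    have "(\<integral>\<^sup>+x. gagliardo_density s u x \<partial>lborel) =
      (\<integral>\<^sup>+x. \<integral>\<^sup>+h. ennreal (1 / norm h powr a) * ennreal ((u (x + h) - u x)\<^sup>2) \<partial>lborel \<partial>lborel)"
      unfolding gagliardo_density_def a_def by (simp flip: ennreal_mult)
    also have "\<dots> = (\<integral>\<^sup>+h. \<integral>\<^sup>+x. ennreal (1 / norm h powr a) * ennreal ((u (x + h) - u x)\<^sup>2) \<partial>lborel \<partial>lborel)"
      by (rule lborel_pair.Fubini') measurable
    also have "\<dots> = (\<integral>\<^sup>+h. ennreal (1 / norm h powr a) * (\<integral>\<^sup>+x. ennreal ((u (x + h) - u x)\<^sup>2) \<partial>lborel) \<partial>lborel)"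
      by (subst nn_integral_cmult) auto
    also have "\<dots> \<le> (\<integral>\<^sup>+h. ennreal (1 / norm h powr a) *
       (\<integral>\<^sup>+\<xi>. ennreal ((norm (cis (h \<bullet> \<xi>) - 1))\<^sup>2 * (norm (g \<xi>))\<^sup>2) \<partial>lborel) \<partial>lborel)"
      by (intro nn_integral_mono mult_left_mono translation_difference_le) auto
    also have "\<dots> = (\<integral>\<^sup>+h. \<integral>\<^sup>+\<xi>. ennreal (1 / norm h powr a) *
       ennreal ((norm (cis (h \<bullet> \<xi>) - 1))\<^sup>2 * (norm (g \<xi>))\<^sup>2) \<partial>lborel \<partial>lborel)"
      by (subst nn_integral_cmult) auto
    also have "\<dots> = (\<integral>\<^sup>+\<xi>. \<integral>\<^sup>+h. ennreal (1 / norm h powr a) *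
       ennreal ((norm (cis (h \<bullet> \<xi>) - 1))\<^sup>2 * (norm (g \<xi>))\<^sup>2) \<partial>lborel \<partial>lborel)"
      by (rule lborel_pair.Fubini') measurable
    also have "\<dots> = (\<integral>\<^sup>+\<xi>. ennreal ((norm (g \<xi>))\<^sup>2) *
       (\<integral>\<^sup>+h. ennreal ((norm (cis (h \<bullet> \<xi>) - 1))\<^sup>2 / norm h powr a) \<partial>lborel) \<partial>lborel)"
      by (subst nn_integral_cmult[symmetric]) (auto simp flip: ennreal_mult simp: mult_ac)
    also have "\<dots> \<le> (\<integral>\<^sup>+\<xi>. ennreal ((norm (g \<xi>))\<^sup>2) * (ennreal C * ennreal (norm \<xi> powr (2 * s))) \<partial>lborel)"
      by (intro nn_integral_mono mult_left_mono scale) auto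
    also have "\<dots> = (\<integral>\<^sup>+\<xi>. ennreal C * ennreal (norm \<xi> powr (2 * s) * (norm (g \<xi>))\<^sup>2) \<partial>lborel)"
      using C by (simp flip: ennreal_mult add: mult_ac)
    also have "\<dots> = ennreal C * (\<integral>\<^sup>+\<xi>. ennreal (norm \<xi> powr (2 * s) * (norm (g \<xi>))\<^sup>2) \<partial>lborel)"
      by (rule nn_integral_cmult) measurable
    finally show "(\<integral>\<^sup>+x. gagliardo_density s u x \<partial>lborel) \<le>
      ennreal C * (\<integral>\<^sup>+\<xi>. ennreal (norm \<xi> powr (2 * s) * (norm (g \<xi>))\<^sup>2) \<partial>lborel)" .
  qed
qed

subsection \<open>The Hardy inequality\<close>

text \<open>Finiteness of \<open>X\<close> is essential: an infinite \<open>X\<close> satisfies the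
  first inequality for every \<open>A\<close>.\<close>

lemma ennreal_absorb_half:
  fixes X A :: ennreal
  assumes "X \<le> A + ennreal (1/2) * X" "X < \<infinity>"
  shows "X \<le> 2 * A"
proof (cases A)
  case (real r)
  obtain x where x: "x \<ge> 0" "X = ennreal x" using assms(2) by (cases X) auto
  have "ennreal (r + 1/2 * x) = A + ennreal (1/2) * X"
    using x real by (simp only: ennreal_mult[symmetric] ennreal_plus[symmetric] mult_nonneg_nonneg zero_le_divide_1_iff zero_le_numeral)
  then have "ennreal x \<le> ennreal (r + 1/2 * x)"
    using assms(1) x by simp
  then have "x \<le> r + 1/2 * x" using x real by (subst (asm) ennreal_le_iff) auto
  then have "ennreal x \<le> ennreal (2 * r)" by (intro ennreal_leI) simp
  then show ?thesis using x real by (simp add: ennreal_mult)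
qed (simp add: ennreal_mult_top)

text \<open>For given \<open>y\<close> the set is a shell of radius about \<open>|y| / K\<close>.
  The largest value of the integrand times the volume of the enclosing ball gives
  \<open>K powr (n + 2 * s)\<close> times \<open>K powr (- n)\<close>.\<close>

lemma annulus_integral_le:
  fixes y :: "'a::euclidean_space"
  assumes s: "0 < s" and K: "K \<ge> 1"
  shows "(\<integral>\<^sup>+(x::'a). ennreal (1 / norm x powr (real DIM('a) + 2 * s)) * indicator {x. K * norm x \<le> norm y \<and> norm y < 2 * K * norm x} x \<partial>lborel)
    \<le> ennreal (unit_ball_vol DIM('a) * 2 powr (real DIM('a) + 2 * s) * K powr (2 * s) / norm y powr (2 * s))"
proof (cases "y = 0")
  case True
  have "\<not> (K * norm x \<le> norm y \<and> norm y < 2 * K * norm x)" for x :: 'a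
    using True mult_nonneg_nonneg[of K "norm x"] K by auto
  then have empty: "{x::'a. K * norm x \<le> norm y \<and> norm y < 2 * K * norm x} = {}" by blast
  show ?thesis unfolding empty by simp
next
  case False
  define n where "n = real DIM('a)"
  define \<rho> where "\<rho> = norm y"
  have \<rho>: "\<rho> > 0" using False by (simp add: \<rho>_def)
  have "(\<integral>\<^sup>+(x::'a). ennreal (1 / norm x powr (n + 2 * s)) * indicator {x. K * norm x \<le> norm y \<and> norm y < 2 * K * norm x} x \<partial>lborel)
     \<le> (\<integral>\<^sup>+x. ennreal ((2 * K / \<rho>) powr (n + 2 * s)) * indicator (cball (0::'a) (\<rho> / K)) x \<partial>lborel)"
  proof (intro nn_integral_mono)
    fix x :: 'a
    show "ennreal (1 / norm x powr (n + 2 * s)) * indicator {x. K * norm x \<le> norm y \<and> norm y < 2 * K * norm x} x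
      \<le> ennreal ((2 * K / \<rho>) powr (n + 2 * s)) * indicator (cball (0::'a) (\<rho> / K)) x"
    proof (cases "K * norm x \<le> norm y \<and> norm y < 2 * K * norm x")
      case True
      then have x: "norm x > 0" by (cases "x = 0") auto
      have "1 / norm x \<le> 2 * K / \<rho>" using True x \<rho> by (simp add: \<rho>_def field_simps)
      then have "(1 / norm x) powr (n + 2 * s) \<le> (2 * K / \<rho>) powr (n + 2 * s)"
        using s by (intro powr_mono2) (auto simp: n_def)
      then have "1 / norm x powr (n + 2 * s) \<le> (2 * K / \<rho>) powr (n + 2 * s)"
        using x by (simp add: powr_divide)
      moreover have "norm x \<le> \<rho> / K" using True K by (simp add: \<rho>_def field_simps)
      ultimately show ?thesis using True by (auto intro!: ennreal_leI)
    qed simp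
  qed
  also have "\<dots> = ennreal ((2 * K / \<rho>) powr (n + 2 * s)) * ennreal (unit_ball_vol n * (\<rho> / K) ^ DIM('a))"
    using \<rho> K by (subst nn_integral_cmult_indicator) (auto simp: emeasure_cball n_def)
  also have "\<dots> = ennreal ((2 * K / \<rho>) powr (n + 2 * s) * (unit_ball_vol n * (\<rho> / K) ^ DIM('a)))"
    using \<rho> K by (subst ennreal_mult) (auto simp: n_def)
  also have "(2 * K / \<rho>) powr (n + 2 * s) * (unit_ball_vol n * (\<rho> / K) ^ DIM('a)) =
     unit_ball_vol n * 2 powr (n + 2 * s) * K powr (2 * s) / \<rho> powr (2 * s)"
  proof -
    have "(\<rho> / K) ^ DIM('a) = \<rho> powr n / K powr n"
      using \<rho> K by (simp add: n_def powr_realpow power_divide)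
    moreover have "(2 * K / \<rho>) powr (n + 2 * s) = 2 powr (n + 2 * s) * (K powr n * K powr (2 * s)) / (\<rho> powr n * \<rho> powr (2 * s))"
      using \<rho> K by (simp add: powr_divide powr_mult powr_add)
    ultimately show ?thesis using \<rho> K by simp
  qed
  finally show ?thesis unfolding n_def \<rho>_def .
qed

lemma emeasure_annulus:
  fixes \<rho> :: real
  assumes "\<rho> > 0"
  shows "emeasure lborel {y::'a::euclidean_space. \<rho> \<le> norm y \<and> norm y < 2 * \<rho>} =
    ennreal (unit_ball_vol DIM('a) * (2 ^ DIM('a) - 1) * \<rho> ^ DIM('a))"
proof -
  have "{y::'a. \<rho> \<le> norm y \<and> norm y < 2 * \<rho>} = ball 0 (2 * \<rho>) - ball 0 \<rho>" by auto
  also have "emeasure lborel \<dots> = emeasure lborel (ball (0::'a) (2 * \<rho>)) - emeasure lborel (ball (0::'a) \<rho>)"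
    using assms by (intro emeasure_Diff) (auto simp: emeasure_ball)
  also have "\<dots> = ennreal (unit_ball_vol DIM('a) * (2 * \<rho>) ^ DIM('a) - unit_ball_vol DIM('a) * \<rho> ^ DIM('a))"
    using assms by (simp add: emeasure_ball ennreal_minus)
  finally show ?thesis by (simp add: power_mult_distrib algebra_simps)
qed

text \<open>Comparing \<open>u x\<close> with the values of \<open>u\<close> on the much larger annulus \<open>K |x| \<le> |y| < 2 K |x|\<close>
  gains the factor \<open>K powr (2 * s - n)\<close>, which makes the last term absorbable.\<close>

lemma hardy_step:
  assumes s: "0 < s" "2 * s < real DIM('a::euclidean_space)"
  obtains K c :: real where "K \<ge> 2" "c \<ge> 0"
    "\<And>(u :: 'a \<Rightarrow> real) \<Omega>1 \<Omega>2. u \<in> borel_measurable borel \<Longrightarrow> \<Omega>1 \<in> sets borel \<Longrightarrow> \<Omega>2 \<in> sets borel \<Longrightarrow>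
      (\<And>x y. x \<in> \<Omega>1 \<Longrightarrow> K * norm x \<le> norm y \<Longrightarrow> norm y < 2 * K * norm x \<Longrightarrow> y \<in> \<Omega>2) \<Longrightarrow>
      (\<integral>\<^sup>+x. ennreal ((u x)\<^sup>2 / norm x powr (2 * s)) * indicator \<Omega>1 x \<partial>lborel) \<le>
        ennreal c * (\<integral>\<^sup>+x. gagliardo_density s u x \<partial>lborel) +
        ennreal (1/2) * (\<integral>\<^sup>+x. ennreal ((u x)\<^sup>2 / norm x powr (2 * s)) * indicator \<Omega>2 x \<partial>lborel)"
proof -
  define n where "n = real DIM('a)"
  define \<omega> where "\<omega> = unit_ball_vol n"
  have \<omega>: "\<omega> > 0" by (simp add: \<omega>_def n_def)
  define \<beta> where "\<beta> = \<omega> * (2 ^ DIM('a) - 1)"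
  have "(2::real) ^ DIM('a) > 1" by (intro one_less_power) auto
  then have \<beta>: "\<beta> > 0" using \<omega> by (simp add: \<beta>_def)
  define Q where "Q = 2 / \<beta> * (\<omega> * 2 powr (n + 2 * s))"
  have Q: "Q > 0" using \<beta> \<omega> by (simp add: Q_def)
  \<comment> \<open>\<open>Q\<close> collects the constants of the last term, whose factor is then
    \<open>Q * K powr (2 * s - n)\<close>. This is at most 1/2 for large \<open>K\<close>, because
    \<open>2 * s < n\<close>.\<close>
  define K where "K = max 2 ((2 * Q) powr (1 / (n - 2 * s)))"
  have K2: "K \<ge> 2" by (simp add: K_def)
  then have K: "K > 0" by simp
  have n2s: "n - 2 * s > 0" using s by (simp add: n_def)
  have QK: "Q * K powr (2 * s) / K powr n \<le> 1 / 2"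
  proof -
    have "2 * Q = ((2 * Q) powr (1 / (n - 2 * s))) powr (n - 2 * s)"
      using Q n2s by (simp add: powr_powr)
    also have "\<dots> \<le> K powr (n - 2 * s)" using n2s by (intro powr_mono2) (auto simp: K_def)
    finally have "2 * Q \<le> K powr n / K powr (2 * s)" using K by (simp add: powr_diff)
    then show ?thesis using K by (simp add: field_simps)
  qed
  define c where "c = 2 * (3 * K) powr (n + 2 * s) / (\<beta> * K powr n)"
  have c: "c \<ge> 0" using \<beta> by (simp add: c_def)
  show thesis
  proof (rule that[OF K2 c])
    fix u :: "'a \<Rightarrow> real" and \<Omega>1 \<Omega>2 :: "'a set"
    assume [measurable]: "u \<in> borel_measurable borel" "\<Omega>1 \<in> sets borel" "\<Omega>2 \<in> sets borel"
      and \<Omega>: "\<And>x y. x \<in> \<Omega>1 \<Longrightarrow> K * norm x \<le> norm y \<Longrightarrow> norm y < 2 * K * norm x \<Longrightarrow> y \<in> \<Omega>2"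
    define A where "A x y \<longleftrightarrow> K * norm x \<le> norm y \<and> norm y < 2 * K * norm x" for x y :: 'a
    have [measurable]: "Measurable.pred (borel \<Otimes>\<^sub>M borel) (\<lambda>(x, y). A x y)"
      unfolding A_def by measurable
    let ?I = "\<lambda>x. \<integral>\<^sup>+y. ennreal ((u y)\<^sup>2) * indicator {y. A x y} y \<partial>lborel"
    have pt: "ennreal ((u x)\<^sup>2 / norm x powr (2 * s)) \<le> ennreal c * gagliardo_density s u x +
        ennreal (2 / (\<beta> * K powr n)) * (ennreal (1 / norm x powr (n + 2 * s)) * ?I x)" for x
    proof (cases "x = 0")
      case False
      define \<rho> where "\<rho> = norm x"
      have \<rho>: "\<rho> > 0" using False by (simp add: \<rho>_def)
      \<comment> \<open>On the annulus \<open>|y - x| \<le> 3 K |x|\<close>, so \<open>M\<close>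
        divided by the power of \<open>|y - x|\<close> is at least 1 and the Gagliardo kernel can be
        inserted.\<close>
      define M where "M = (3 * K * \<rho>) powr (n + 2 * s)"
      have ptw: "ennreal ((u x)\<^sup>2) * indicator {y. A x y} y \<le>
        ennreal (2 * M) * ennreal ((u (x + (y - x)) - u x)\<^sup>2 / norm (y - x) powr (n + 2 * s)) + 2 * (ennreal ((u y)\<^sup>2) * indicator {y. A x y} y)" for y
      proof (cases "A x y")
        case True
        have d: "norm (y - x) \<le> 3 * K * \<rho>"
        proof -
          have "norm (y - x) \<le> norm y + norm x" by (rule norm_triangle_ineq4)
          also have "\<dots> \<le> 2 * K * \<rho> + K * \<rho>" using True K2 \<rho> by (intro add_mono) (auto simp: A_def \<rho>_def)
          finally show ?thesis by simp
        qed
        have "x \<noteq> y"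
        proof
          assume "x = y"
          then have "K * \<rho> \<le> \<rho>" using True by (simp add: A_def \<rho>_def)
          then show False using \<rho> K2 by simp
        qed
        then have d0: "norm (y - x) > 0" by simp
        have "norm (y - x) powr (n + 2 * s) \<le> M"
          unfolding M_def using s d by (intro powr_mono2) (auto simp: n_def)
        then have "1 \<le> M / norm (y - x) powr (n + 2 * s)" using d0 by (simp add: field_simps)
        then have "2 * (u y - u x)\<^sup>2 * 1 \<le> 2 * (u y - u x)\<^sup>2 * (M / norm (y - x) powr (n + 2 * s))"
          by (intro mult_left_mono) auto
        moreover have "(u x)\<^sup>2 \<le> 2 * (u y - u x)\<^sup>2 + 2 * (u y)\<^sup>2"
        proof -
          have "0 \<le> (u x - 2 * u y)\<^sup>2" by simp
          then show ?thesis by (simp add: power2_eq_square algebra_simps)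
        qed
        ultimately have "(u x)\<^sup>2 \<le> 2 * M * ((u y - u x)\<^sup>2 / norm (y - x) powr (n + 2 * s)) + 2 * (u y)\<^sup>2"
          by (simp add: mult_ac)
        then have "ennreal ((u x)\<^sup>2) \<le> ennreal (2 * M * ((u y - u x)\<^sup>2 / norm (y - x) powr (n + 2 * s)) + 2 * (u y)\<^sup>2)"
          by (rule ennreal_leI)
        also have "\<dots> = ennreal (2 * M) * ennreal ((u y - u x)\<^sup>2 / norm (y - x) powr (n + 2 * s)) + 2 * ennreal ((u y)\<^sup>2)"
        proof -
          have "M \<ge> 0" by (simp add: M_def)
          then show ?thesis
            by (simp only: ennreal_mult[of "2 * M"] ennreal_mult[of 2] ennreal_plus ennreal_numeral
                divide_nonneg_nonneg mult_nonneg_nonneg zero_le_power2 powr_ge_zero zero_le_numeral)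
        qed
        finally show ?thesis using True by simp
      qed simp
      \<comment> \<open>The pointwise estimate is integrated over the annulus, whose measure is
        \<open>\<beta> * (K * \<rho>) ^ n\<close>.\<close>
      have "ennreal ((u x)\<^sup>2) * ennreal (\<beta> * (K * \<rho>) ^ DIM('a)) = (\<integral>\<^sup>+y. ennreal ((u x)\<^sup>2) * indicator {y. A x y} y \<partial>lborel)"
      proof -
        have "{y. A x y} = {y. K * \<rho> \<le> norm y \<and> norm y < 2 * (K * \<rho>)}"
          by (auto simp: A_def \<rho>_def)
        then have "emeasure lborel {y. A x y} = ennreal (\<beta> * (K * \<rho>) ^ DIM('a))"
          using emeasure_annulus[of "K * \<rho>", where 'a='a] K \<rho> by (simp add: \<beta>_def \<omega>_def n_def)
        then show ?thesis by (subst nn_integral_cmult_indicator) auto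
      qed
      also have "\<dots> \<le> (\<integral>\<^sup>+y. ennreal (2 * M) * ennreal ((u (x + (y - x)) - u x)\<^sup>2 / norm (y - x) powr (n + 2 * s)) + 2 * (ennreal ((u y)\<^sup>2) * indicator {y. A x y} y) \<partial>lborel)"
        by (intro nn_integral_mono ptw)
      also have "\<dots> = ennreal (2 * M) * (\<integral>\<^sup>+y. ennreal ((u (x + (y - x)) - u x)\<^sup>2 / norm (y - x) powr (n + 2 * s)) \<partial>lborel) + 2 * ?I x"
        by (subst nn_integral_add) (auto simp: nn_integral_cmult)
      also have "(\<integral>\<^sup>+y. ennreal ((u (x + (y - x)) - u x)\<^sup>2 / norm (y - x) powr (n + 2 * s)) \<partial>lborel) = gagliardo_density s u x"
        unfolding gagliardo_density_def n_def
        using nn_integral_lborel_translation[of "\<lambda>h. ennreal ((u (x + h) - u x)\<^sup>2 / norm h powr (real DIM('a) + 2 * s))" "- x"]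
        by simp
      finally have main: "ennreal ((u x)\<^sup>2) * ennreal (\<beta> * (K * \<rho>) ^ DIM('a)) \<le> ennreal (2 * M) * gagliardo_density s u x + 2 * ?I x" .
      \<comment> \<open>Division by the measure of the annulus and by
        \<open>\<rho> powr (2 * s)\<close>. The powers of \<rho> in \<open>D * M\<close> cancel, so
        the coefficient \<open>c\<close> is the same for all \<open>x\<close>.\<close>
      define D where "D = 1 / (\<beta> * (K * \<rho>) ^ DIM('a) * \<rho> powr (2 * s))"
      have D: "D > 0" using \<beta> K \<rho> by (simp add: D_def)
      have Kn: "(K * \<rho>) ^ DIM('a) = K powr n * \<rho> powr n"
        using K \<rho> by (simp add: n_def powr_realpow power_mult_distrib)
      have "(u x)\<^sup>2 / norm x powr (2 * s) = D * ((u x)\<^sup>2 * (\<beta> * (K * \<rho>) ^ DIM('a)))"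
        using \<beta> K \<rho> by (simp add: D_def \<rho>_def)
      then have "ennreal ((u x)\<^sup>2 / norm x powr (2 * s)) = ennreal D * (ennreal ((u x)\<^sup>2) * ennreal (\<beta> * (K * \<rho>) ^ DIM('a)))"
        using D \<beta> K \<rho> by (simp add: ennreal_mult)
      also have "\<dots> \<le> ennreal D * (ennreal (2 * M) * gagliardo_density s u x + 2 * ?I x)"
        by (intro mult_left_mono main) simp
      also have "\<dots> = ennreal (D * (2 * M)) * gagliardo_density s u x + ennreal (2 * D) * ?I x"
        using D by (simp add: distrib_left ennreal_mult M_def mult_ac)
      also have "D * (2 * M) = c"
        unfolding D_def M_def c_def Kn using \<rho> K \<beta> by (simp add: powr_mult powr_add field_simps)
      also have "2 * D = 2 / (\<beta> * K powr n) * (1 / norm x powr (n + 2 * s))"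
        unfolding D_def Kn by (simp add: powr_add \<rho>_def)
      also have "ennreal (2 / (\<beta> * K powr n) * (1 / norm x powr (n + 2 * s))) =
          ennreal (2 / (\<beta> * K powr n)) * ennreal (1 / norm x powr (n + 2 * s))"
        using \<beta> by (intro ennreal_mult) auto
      finally show ?thesis by (simp only: mult.assoc)
    qed simp
    let ?I1 = "\<integral>\<^sup>+x. ennreal ((u x)\<^sup>2 / norm x powr (2 * s)) * indicator \<Omega>1 x \<partial>lborel"
    let ?I2 = "\<integral>\<^sup>+x. ennreal ((u x)\<^sup>2 / norm x powr (2 * s)) * indicator \<Omega>2 x \<partial>lborel"
    let ?Z = "\<integral>\<^sup>+x. \<integral>\<^sup>+y. ennreal (1 / norm x powr (n + 2 * s)) * (ennreal ((u y)\<^sup>2) * indicator {y. A x y} y) * indicator \<Omega>1 x \<partial>lborel \<partial>lborel"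
    have "?I1 \<le>
      (\<integral>\<^sup>+x. ennreal c * gagliardo_density s u x +
        ennreal (2 / (\<beta> * K powr n)) * (\<integral>\<^sup>+y. ennreal (1 / norm x powr (n + 2 * s)) * (ennreal ((u y)\<^sup>2) * indicator {y. A x y} y) * indicator \<Omega>1 x \<partial>lborel) \<partial>lborel)"
    proof (intro nn_integral_mono)
      fix x
      have "(\<integral>\<^sup>+y. ennreal (1 / norm x powr (n + 2 * s)) * (ennreal ((u y)\<^sup>2) * indicator {y. A x y} y) \<partial>lborel) =
        ennreal (1 / norm x powr (n + 2 * s)) * ?I x"
        by (rule nn_integral_cmult) measurable
      then show "ennreal ((u x)\<^sup>2 / norm x powr (2 * s)) * indicator \<Omega>1 x \<le> ennreal c * gagliardo_density s u x +
        ennreal (2 / (\<beta> * K powr n)) * (\<integral>\<^sup>+y. ennreal (1 / norm x powr (n + 2 * s)) * (ennreal ((u y)\<^sup>2) * indicator {y. A x y} y) * indicator \<Omega>1 x \<partial>lborel)"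
        using pt[of x] by (cases "x \<in> \<Omega>1") auto
    qed
    also have "\<dots> = ennreal c * (\<integral>\<^sup>+x. gagliardo_density s u x \<partial>lborel) + ennreal (2 / (\<beta> * K powr n)) *
      (\<integral>\<^sup>+x. \<integral>\<^sup>+y. ennreal (1 / norm x powr (n + 2 * s)) * (ennreal ((u y)\<^sup>2) * indicator {y. A x y} y) * indicator \<Omega>1 x \<partial>lborel \<partial>lborel)"
      by (subst nn_integral_add) (measurable, simp add: nn_integral_cmult)
    finally have 1: "?I1 \<le> ennreal c * (\<integral>\<^sup>+x. gagliardo_density s u x \<partial>lborel) + ennreal (2 / (\<beta> * K powr n)) * ?Z" .
    \<comment> \<open>With \<open>y\<close> fixed, \<open>annulus_integral_le\<close> yields only
      \<open>K powr (2 * s)\<close>, against the \<open>K powr (- n)\<close> from averaging over the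
      annulus. Moreover \<open>x \<in> \<Omega>1\<close> places \<open>y\<close> in
      \<Omega>2.\<close>
    have "?Z =
      (\<integral>\<^sup>+y. \<integral>\<^sup>+x. ennreal (1 / norm x powr (n + 2 * s)) * (ennreal ((u y)\<^sup>2) * indicator {y. A x y} y) * indicator \<Omega>1 x \<partial>lborel \<partial>lborel)"
      by (rule lborel_pair.Fubini') measurable
    also have "\<dots> \<le> (\<integral>\<^sup>+y. ennreal (\<omega> * 2 powr (n + 2 * s) * K powr (2 * s)) * (ennreal ((u y)\<^sup>2 / norm y powr (2 * s)) * indicator \<Omega>2 y) \<partial>lborel)"
    proof (intro nn_integral_mono)
      fix y
      have "(\<integral>\<^sup>+x. ennreal (1 / norm x powr (n + 2 * s)) * (ennreal ((u y)\<^sup>2) * indicator {y. A x y} y) * indicator \<Omega>1 x \<partial>lborel) \<le>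
        (\<integral>\<^sup>+x. ennreal ((u y)\<^sup>2) * indicator \<Omega>2 y * (ennreal (1 / norm x powr (n + 2 * s)) * indicator {x. A x y} x) \<partial>lborel)"
        using \<Omega> by (intro nn_integral_mono) (auto simp: indicator_def A_def mult_ac)
      also have "\<dots> = ennreal ((u y)\<^sup>2) * indicator \<Omega>2 y * (\<integral>\<^sup>+x. ennreal (1 / norm x powr (n + 2 * s)) * indicator {x. A x y} x \<partial>lborel)"
        by (rule nn_integral_cmult) measurable
      also have "\<dots> \<le> ennreal ((u y)\<^sup>2) * indicator \<Omega>2 y * ennreal (\<omega> * 2 powr (n + 2 * s) * K powr (2 * s) / norm y powr (2 * s))"
        using annulus_integral_le[OF s(1), of K y] K2 unfolding A_def n_def \<omega>_def by (intro mult_left_mono) auto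
      also have "\<dots> = ennreal (\<omega> * 2 powr (n + 2 * s) * K powr (2 * s)) * (ennreal ((u y)\<^sup>2 / norm y powr (2 * s)) * indicator \<Omega>2 y)"
        using \<omega> by (cases "y \<in> \<Omega>2") (auto simp flip: ennreal_mult simp: mult_ac)
      finally show "(\<integral>\<^sup>+x. ennreal (1 / norm x powr (n + 2 * s)) * (ennreal ((u y)\<^sup>2) * indicator {y. A x y} y) * indicator \<Omega>1 x \<partial>lborel) \<le>
        ennreal (\<omega> * 2 powr (n + 2 * s) * K powr (2 * s)) * (ennreal ((u y)\<^sup>2 / norm y powr (2 * s)) * indicator \<Omega>2 y)" .
    qed
    also have "\<dots> = ennreal (\<omega> * 2 powr (n + 2 * s) * K powr (2 * s)) * (\<integral>\<^sup>+y. ennreal ((u y)\<^sup>2 / norm y powr (2 * s)) * indicator \<Omega>2 y \<partial>lborel)"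
      by (rule nn_integral_cmult) measurable
    finally have Z: "?Z \<le> ennreal (\<omega> * 2 powr (n + 2 * s) * K powr (2 * s)) * ?I2" .
    have "ennreal (2 / (\<beta> * K powr n)) * ?Z \<le> ennreal (2 / (\<beta> * K powr n)) * (ennreal (\<omega> * 2 powr (n + 2 * s) * K powr (2 * s)) * ?I2)"
      by (intro mult_left_mono Z) simp
    also have "\<dots> = ennreal (2 / (\<beta> * K powr n) * (\<omega> * 2 powr (n + 2 * s) * K powr (2 * s))) * ?I2"
      using \<beta> \<omega> by (subst ennreal_mult) (auto simp: mult.assoc)
    also have "2 / (\<beta> * K powr n) * (\<omega> * 2 powr (n + 2 * s) * K powr (2 * s)) = Q * K powr (2 * s) / K powr n"
      by (simp add: Q_def)
    also have "ennreal (Q * K powr (2 * s) / K powr n) * ?I2 \<le> ennreal (1/2) * ?I2"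
      by (intro mult_right_mono ennreal_leI QK) simp
    finally have 2: "ennreal (2 / (\<beta> * K powr n)) * ?Z \<le> ennreal (1/2) * ?I2" .
    show "?I1 \<le> ennreal c * (\<integral>\<^sup>+x. gagliardo_density s u x \<partial>lborel) + ennreal (1/2) * ?I2"
      by (rule order_trans[OF 1 add_left_mono[OF 2]])
  qed
qed

text \<open>The integral over all of space is not known to be finite, so absorption is first carried
  out on the shells \<open>1/N \<le> |x| < N\<close>. The step enlarges such a shell only outwards,
  and by scale invariance the added part is bounded uniformly in \<open>N\<close> by means of the
  \<open>L^p\<close> norm. The limit proves finiteness with an inhomogeneous bound; applying the
  step once more on the whole space gives the homogeneous one.\<close>

lemma hardy_inequality:
  assumes s: "0 < s" "2 * s < real DIM('a::euclidean_space)"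
    and p: "p = 2 * real DIM('a) / (real DIM('a) - 2 * s)"
  obtains C :: real where "C \<ge> 0"
    "\<And>u :: 'a \<Rightarrow> real. u \<in> borel_measurable borel \<Longrightarrow> (\<integral>\<^sup>+x. ennreal (\<bar>u x\<bar> powr p) \<partial>lborel) < \<infinity> \<Longrightarrow>
      (\<integral>\<^sup>+x. ennreal ((u x)\<^sup>2 / norm x powr (2 * s)) \<partial>lborel) \<le> ennreal C * (\<integral>\<^sup>+x. gagliardo_density s u x \<partial>lborel)"
proof -
  define n where "n = real DIM('a)"
  obtain K c where K: "K \<ge> 2" and c: "c \<ge> 0" and step:
    "\<And>(u :: 'a \<Rightarrow> real) \<Omega>1 \<Omega>2. u \<in> borel_measurable borel \<Longrightarrow> \<Omega>1 \<in> sets borel \<Longrightarrow> \<Omega>2 \<in> sets borel \<Longrightarrow>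
      (\<And>x y. x \<in> \<Omega>1 \<Longrightarrow> K * norm x \<le> norm y \<Longrightarrow> norm y < 2 * K * norm x \<Longrightarrow> y \<in> \<Omega>2) \<Longrightarrow>
      (\<integral>\<^sup>+x. ennreal ((u x)\<^sup>2 / norm x powr (2 * s)) * indicator \<Omega>1 x \<partial>lborel) \<le>
        ennreal c * (\<integral>\<^sup>+x. gagliardo_density s u x \<partial>lborel) +
        ennreal (1/2) * (\<integral>\<^sup>+x. ennreal ((u x)\<^sup>2 / norm x powr (2 * s)) * indicator \<Omega>2 x \<partial>lborel)"
    using hardy_step[OF s] by blast
  have n2s: "n - 2 * s > 0" using s by (simp add: n_def)
  have p2: "p > 2" using s n2s by (simp add: p n_def field_simps)
  define \<omega> where "\<omega> = unit_ball_vol n"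
  have \<omega>: "\<omega> > 0" by (simp add: \<omega>_def n_def)
  show thesis
  \<comment> \<open>The added 1 keeps the constant positive, so that the right-hand side is infinite
    when the energy is; in \<open>ennreal\<close>, 0 times infinity is 0.\<close>
  proof (rule that[of "2 * c + 1"])
    show "2 * c + 1 \<ge> 0" using c by simp
    fix u :: "'a \<Rightarrow> real"
    assume [measurable]: "u \<in> borel_measurable borel" and fin: "(\<integral>\<^sup>+x. ennreal (\<bar>u x\<bar> powr p) \<partial>lborel) < \<infinity>"
    define P where "P = (\<integral>\<^sup>+x. ennreal (\<bar>u x\<bar> powr p) \<partial>lborel)"
    define J where "J = (\<integral>\<^sup>+x. gagliardo_density s u x \<partial>lborel)"
    define I where "I \<Omega> = (\<integral>\<^sup>+x. ennreal ((u x)\<^sup>2 / norm x powr (2 * s)) * indicator \<Omega> x \<partial>lborel)" for \<Omega>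
    have young: "(u x)\<^sup>2 / norm x powr (2 * s) \<le> \<bar>u x\<bar> powr p + 1 / norm x powr n" for x
    proof (cases "x = 0 \<or> u x = 0")
      case False
      define r where "r = norm x"
      have r: "r > 0" using False by (simp add: r_def)
      \<comment> \<open>The critical decay rate. Below this level \<open>u^2 / |x|^(2s)\<close> is
        at most \<open>|x|^(-n)\<close>, above it at most \<open>|u|^p\<close>.\<close>
      define l where "l = r powr (- (n - 2 * s) / 2)"
      have l: "l > 0" using r by (simp add: l_def)
      have l2: "l\<^sup>2 / r powr (2 * s) = 1 / r powr n"
      proof -
        have "l\<^sup>2 = r powr (- (n - 2 * s) / 2 + - (n - 2 * s) / 2)"
          unfolding l_def power2_eq_square by (simp only: powr_add)
        also have "- (n - 2 * s) / 2 + - (n - 2 * s) / 2 = 2 * s - n" by simp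
        finally show ?thesis using r by (simp add: powr_diff)
      qed
      have lp: "l powr (2 - p) = r powr (2 * s)"
      proof -
        have "(2 - p) * (n - 2 * s) = - 4 * s" using n2s by (simp add: p n_def field_simps)
        then have "- (n - 2 * s) / 2 * (2 - p) = 2 * s" by (simp add: algebra_simps)
        then show ?thesis by (simp add: l_def powr_powr)
      qed
      show ?thesis
      proof (cases "\<bar>u x\<bar> \<le> l")
        case True
        then have "\<bar>u x\<bar>\<^sup>2 \<le> l\<^sup>2" by (intro power_mono) auto
        then have "(u x)\<^sup>2 / r powr (2 * s) \<le> l\<^sup>2 / r powr (2 * s)"
          by (intro divide_right_mono) auto
        then show ?thesis unfolding l2 by (simp add: r_def add_increasing)
      next
        case False
        have "(u x)\<^sup>2 = \<bar>u x\<bar> powr p * \<bar>u x\<bar> powr (2 - p)"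
          using \<open>\<not> (x = 0 \<or> u x = 0)\<close> by (simp flip: powr_add add: powr_numeral)
        also have "\<dots> \<le> \<bar>u x\<bar> powr p * l powr (2 - p)"
          using False l p2 by (intro mult_left_mono powr_mono2') auto
        finally have "(u x)\<^sup>2 / r powr (2 * s) \<le> \<bar>u x\<bar> powr p"
          unfolding lp using r by (simp add: field_simps)
        then show ?thesis by (simp add: r_def add_increasing2)
      qed
    qed auto
    \<comment> \<open>Only the ratio of the radii enters, hence the uniform bound for the outer
      shells from \<open>N\<close> to \<open>2 * K * N\<close>.\<close>
    have shell: "I {x. a \<le> norm x \<and> norm x < b} \<le> P + ennreal (\<omega> * (b / a) ^ DIM('a))" if "0 < a" "0 \<le> b" for a b :: real
    proof -
      have "I {x. a \<le> norm x \<and> norm x < b} \<le> (\<integral>\<^sup>+x. ennreal (\<bar>u x\<bar> powr p) + ennreal (1 / a ^ DIM('a)) * indicator (ball 0 b) x \<partial>lborel)"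
        unfolding I_def
      proof (intro nn_integral_mono)
        fix x :: 'a
        show "ennreal ((u x)\<^sup>2 / norm x powr (2 * s)) * indicator {x. a \<le> norm x \<and> norm x < b} x
          \<le> ennreal (\<bar>u x\<bar> powr p) + ennreal (1 / a ^ DIM('a)) * indicator (ball 0 b) x"
        proof (cases "a \<le> norm x \<and> norm x < b")
          case True
          then have "norm x > 0" using \<open>0 < a\<close> by linarith
          then have "1 / norm x powr n \<le> 1 / a ^ DIM('a)"
            using \<open>0 < a\<close> True powr_realpow[of "norm x" "DIM('a)"] by (simp add: n_def frac_le power_mono)
          then have "(u x)\<^sup>2 / norm x powr (2 * s) \<le> \<bar>u x\<bar> powr p + 1 / a ^ DIM('a)"
            using young[of x] by simp
          then have "ennreal ((u x)\<^sup>2 / norm x powr (2 * s)) \<le> ennreal (\<bar>u x\<bar> powr p + 1 / a ^ DIM('a))"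
            by (rule ennreal_leI)
          then show ?thesis using True \<open>0 < a\<close> by (simp add: ennreal_plus)
        qed simp
      qed
      also have "\<dots> = P + ennreal (1 / a ^ DIM('a)) * emeasure lborel (ball (0::'a) b)"
      proof -
        have m: "(\<lambda>x. ennreal (1 / a ^ DIM('a)) * indicator (ball (0::'a) b) x) \<in> borel_measurable lborel"
          by (intro borel_measurable_times_ennreal borel_measurable_const borel_measurable_indicator) simp
        have "(\<integral>\<^sup>+x. ennreal (1 / a ^ DIM('a)) * indicator (ball (0::'a) b) x \<partial>lborel) = ennreal (1 / a ^ DIM('a)) * emeasure lborel (ball (0::'a) b)"
          by (rule nn_integral_cmult_indicator) simp
        then show ?thesis
          unfolding P_def by (subst nn_integral_add[OF _ m]) simp_all
      qed
      also have "\<dots> = P + ennreal (\<omega> * (b / a) ^ DIM('a))"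
        using that by (simp add: emeasure_ball \<omega>_def n_def power_divide flip: ennreal_mult)
      finally show ?thesis .
    qed
    define B where "B = P + ennreal (\<omega> * (2 * K) ^ DIM('a))"
    have B: "B < \<infinity>" using fin by (simp add: B_def P_def)
    define \<Omega> where "\<Omega> j = {x::'a. 1 / real (Suc j) \<le> norm x \<and> norm x < real (Suc j)}" for j
    have bound: "I (\<Omega> j) \<le> 2 * (ennreal c * J + B)" for j
    proof (rule ennreal_absorb_half)
      define N where "N = real (Suc j)"
      have N: "N \<ge> 1" by (simp add: N_def)
      let ?O2 = "{x::'a. 1 / N \<le> norm x \<and> norm x < 2 * K * N}" and ?O3 = "{x::'a. N \<le> norm x \<and> norm x < 2 * K * N}"
      have O: "\<Omega> j = {x. 1 / N \<le> norm x \<and> norm x < N}" by (simp add: \<Omega>_def N_def)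
      have 1: "I (\<Omega> j) \<le> ennreal c * J + ennreal (1/2) * I ?O2"
        unfolding I_def J_def
      proof (rule step)
        fix x y :: 'a assume x: "x \<in> \<Omega> j" and y: "K * norm x \<le> norm y" "norm y < 2 * K * norm x"
        have "1 / N \<le> norm x" "norm x < N" using x by (auto simp: O)
        moreover have "norm x \<le> K * norm x" using K mult_right_mono[of 1 K "norm x"] by simp
        moreover have "2 * K * norm x \<le> 2 * K * N" using K calculation(2) by (intro mult_left_mono) auto
        ultimately show "y \<in> ?O2" using y by auto
      qed (auto simp: \<Omega>_def)
      have 2: "I ?O2 \<le> I (\<Omega> j) + I ?O3"
      proof -
        have "I ?O2 \<le> (\<integral>\<^sup>+x. ennreal ((u x)\<^sup>2 / norm x powr (2 * s)) * indicator (\<Omega> j) x + ennreal ((u x)\<^sup>2 / norm x powr (2 * s)) * indicator ?O3 x \<partial>lborel)"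
          unfolding I_def by (intro nn_integral_mono) (auto simp: O indicator_def)
        also have "\<dots> = I (\<Omega> j) + I ?O3"
          unfolding I_def \<Omega>_def by (rule nn_integral_add) measurable
        finally show ?thesis .
      qed
      have 3: "I ?O3 \<le> B"
        using shell[of N "2 * K * N"] N K by (simp add: B_def)
      have "I (\<Omega> j) \<le> ennreal c * J + ennreal (1/2) * (I (\<Omega> j) + B)"
        by (rule order_trans[OF 1 add_left_mono[OF mult_left_mono[OF order_trans[OF 2 add_left_mono[OF 3]]]]]) simp
      also have "\<dots> \<le> ennreal c * J + B + ennreal (1/2) * I (\<Omega> j)"
      proof -
        have "ennreal (1/2) * B \<le> 1 * B" by (intro mult_right_mono) (auto simp del: ennreal_half simp: ennreal_le_1)
        then have "ennreal c * J + (ennreal (1/2) * I (\<Omega> j) + ennreal (1/2) * B) \<le> ennreal c * J + (ennreal (1/2) * I (\<Omega> j) + B)"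
          by (intro add_left_mono) simp
        then show ?thesis unfolding distrib_left by (simp only: ac_simps)
      qed
      finally show "I (\<Omega> j) \<le> ennreal c * J + B + ennreal (1/2) * I (\<Omega> j)" .
      have "I (\<Omega> j) \<le> P + ennreal (\<omega> * (N / (1 / N)) ^ DIM('a))"
        unfolding O using N by (intro shell) auto
      also have "\<dots> < \<infinity>" using fin by (simp add: P_def)
      finally show "I (\<Omega> j) < \<infinity>" .
    qed
    have lim: "I UNIV \<le> 2 * (ennreal c * J + B)"
    proof -
      have "I UNIV = (\<integral>\<^sup>+x. liminf (\<lambda>j. ennreal ((u x)\<^sup>2 / norm x powr (2 * s)) * indicator (\<Omega> j) x) \<partial>lborel)"
        unfolding I_def
      proof (intro nn_integral_cong)
        fix x :: 'a
        have "(\<lambda>j. ennreal ((u x)\<^sup>2 / norm x powr (2 * s)) * indicator (\<Omega> j) x) \<longlonglongrightarrow> ennreal ((u x)\<^sup>2 / norm x powr (2 * s))"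
        \<comment> \<open>No shell contains the origin, but the integrand there is 0 because
          division by 0 gives 0.\<close>
        proof (cases "x = 0")
          case False
          have "eventually (\<lambda>j. real j \<ge> max (norm x) (1 / norm x)) sequentially"
            using filterlim_real_sequentially by (simp only: filterlim_at_top)
          then have "eventually (\<lambda>j. x \<in> \<Omega> j) sequentially"
            by eventually_elim (use False in \<open>auto simp: \<Omega>_def field_simps add_increasing\<close>)
          then have "eventually (\<lambda>j. ennreal ((u x)\<^sup>2 / norm x powr (2 * s)) * indicator (\<Omega> j) x = ennreal ((u x)\<^sup>2 / norm x powr (2 * s))) sequentially"
            by eventually_elim simp
          then show ?thesis by (rule tendsto_eventually)
        qed simp
        from lim_imp_Liminf[OF _ this]
        show "ennreal ((u x)\<^sup>2 / norm x powr (2 * s)) * indicator UNIV x =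
          liminf (\<lambda>j. ennreal ((u x)\<^sup>2 / norm x powr (2 * s)) * indicator (\<Omega> j) x)"
          by simp
      qed
      also have "\<dots> \<le> liminf (\<lambda>j. I (\<Omega> j))"
        unfolding I_def \<Omega>_def by (intro nn_integral_liminf) measurable
      also have "\<dots> \<le> 2 * (ennreal c * J + B)"
        by (rule order_trans[OF Liminf_le_Limsup Limsup_bounded]) (simp, intro always_eventually allI bound)
      finally show ?thesis .
    qed
    have "I UNIV \<le> ennreal (2 * c + 1) * J"
    proof (cases "J = \<infinity>")
      case True
      then show ?thesis using c by (simp add: ennreal_mult_top)
    next
      case False
      \<comment> \<open>Finiteness being known, absorbing on the whole space removes the term
        \<open>B\<close>, which is not homogeneous in \<open>u\<close>.\<close>
      have "I UNIV \<le> 2 * (ennreal c * J)"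
      proof (rule ennreal_absorb_half)
        show "I UNIV \<le> ennreal c * J + ennreal (1/2) * I UNIV"
          unfolding I_def J_def by (rule step) auto
        show "I UNIV < \<infinity>"
          using lim False B by (auto simp: ennreal_mult_less_top less_top intro: le_less_trans)
      qed
      also have "\<dots> = ennreal (2 * c) * J" using c by (simp add: ennreal_mult mult.assoc)
      also have "\<dots> \<le> ennreal (2 * c + 1) * J" by (intro mult_right_mono ennreal_leI) auto
      finally show ?thesis .
    qed
    then show "(\<integral>\<^sup>+x. ennreal ((u x)\<^sup>2 / norm x powr (2 * s)) \<partial>lborel) \<le> ennreal (2 * c + 1) * (\<integral>\<^sup>+x. gagliardo_density s u x \<partial>lborel)"
      unfolding I_def J_def by simp
  qed
qed

subsection \<open>Morrey norms\<close>

lemma morrey_norm_cong_AE: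
  assumes ae: "AE x in lebesgue. u x = u' x"
  shows "morrey_norm p \<mu> l u = morrey_norm p \<mu> l u'"
proof -
  have "(\<integral>\<^sup>+ y \<in> ball x R. ennreal (\<bar>u y\<bar> powr p / norm y powr l) \<partial>lebesgue) =
    (\<integral>\<^sup>+ y \<in> ball x R. ennreal (\<bar>u' y\<bar> powr p / norm y powr l) \<partial>lebesgue)" for x R
    by (intro nn_integral_cong_AE, use ae in eventually_elim) simp
  then show ?thesis unfolding morrey_norm_def by simp
qed

lemma morrey_integral_lborel:
  fixes u :: "'a::euclidean_space \<Rightarrow> real"
  shows "(\<integral>\<^sup>+ y \<in> ball x R. ennreal (\<bar>u y\<bar> powr p / norm y powr l) \<partial>lebesgue) =
    (\<integral>\<^sup>+ y. ennreal (\<bar>u y\<bar> powr p / norm y powr l) * indicator (ball x R) y \<partial>lborel)"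
  by (rule nn_integral_completion)

lemma epowr_ennreal: "x \<ge> 0 \<Longrightarrow> epowr (ennreal x) a = ennreal (x powr a)"
  by (simp add: epowr_def)

lemma epowr_mono:
  assumes "x \<le> y" "a \<ge> 0"
  shows "epowr x a \<le> epowr y a"
proof (cases "y = \<infinity>")
  case False
  then have "x < \<infinity>" "y < \<infinity>" using assms by (auto simp: less_top le_less_trans)
  then show ?thesis using assms by (auto simp: epowr_def intro!: ennreal_leI powr_mono2 enn2real_mono)
qed (simp add: epowr_def)

text \<open>Below the level \<open>l\<close> the second term suffices; above it
  \<open>v powr (a - b)\<close> is at most \<open>l powr (a - b)\<close>.\<close>

lemma morrey_scaling_young:
  fixes v :: real
  assumes "v \<ge> 0" "l > 0" "0 \<le> a" "a \<le> b"
  shows "v powr a \<le> l powr (a - b) * v powr b + l powr a"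
proof (cases "v \<le> l")
  case True
  then have "v powr a \<le> l powr a" using assms by (intro powr_mono2) auto
  then show ?thesis by (simp add: add_increasing)
next
  case False
  then have "v powr a = v powr b * v powr (a - b)" using assms by (simp flip: powr_add)
  also have "\<dots> \<le> v powr b * l powr (a - b)"
    using False assms by (intro mult_left_mono powr_mono2') auto
  finally show ?thesis by (simp add: mult.commute add_increasing2)
qed

text \<open>A substitute for Hoelder's inequality that only loses the factor \<open>1 + |B\<^sub>1|\<close>.\<close>

lemma morrey_exponent_change:
  fixes v :: "'a::euclidean_space \<Rightarrow> real"
  assumes [measurable]: "v \<in> borel_measurable borel" and v: "\<And>x. v x \<ge> 0"
    and ab: "0 \<le> a" "a \<le> b" and R: "R > 0" and M: "M > 0"
    and bound: "(\<integral>\<^sup>+y. ennreal (v y powr b) * indicator (ball x R) y \<partial>lborel) \<le> ennreal (M powr b * R powr (real DIM('a) - m * b))"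
  shows "(\<integral>\<^sup>+y. ennreal (v y powr a) * indicator (ball x R) y \<partial>lborel)
    \<le> ennreal ((1 + unit_ball_vol DIM('a)) * M powr a * R powr (real DIM('a) - m * a))"
proof -
  define n where "n = real DIM('a)"
  \<comment> \<open>With this level both terms of \<open>morrey_scaling_young\<close>, integrated
    over the ball, have the order \<open>M powr a * R powr (n - m * a)\<close>.\<close>
  define l where "l = M * R powr (- m)"
  have l: "l > 0" using M R by (simp add: l_def)
  have lpow: "l powr e = M powr e * R powr (- m * e)" for e
    using M R by (simp add: l_def powr_mult powr_powr)
  have bm: "ball x R \<in> sets lborel" by simp
  have m1: "(\<lambda>y. ennreal (v y powr b) * indicator (ball x R) y) \<in> borel_measurable lborel"
    by (intro borel_measurable_times_ennreal borel_measurable_indicator bm) simp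
  have "(\<integral>\<^sup>+y. ennreal (v y powr a) * indicator (ball x R) y \<partial>lborel) \<le>
    (\<integral>\<^sup>+y. ennreal (l powr (a - b)) * (ennreal (v y powr b) * indicator (ball x R) y) + ennreal (l powr a) * indicator (ball x R) y \<partial>lborel)"
  proof (intro nn_integral_mono)
    fix y
    have "ennreal (v y powr a) \<le> ennreal (l powr (a - b) * v y powr b + l powr a)"
      by (intro ennreal_leI morrey_scaling_young v l ab)
    also have "\<dots> = ennreal (l powr (a - b)) * ennreal (v y powr b) + ennreal (l powr a)"
      by (subst ennreal_plus) (auto simp: ennreal_mult)
    finally show "ennreal (v y powr a) * indicator (ball x R) y \<le>
      ennreal (l powr (a - b)) * (ennreal (v y powr b) * indicator (ball x R) y) + ennreal (l powr a) * indicator (ball x R) y"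
      by (cases "y \<in> ball x R") auto
  qed
  also have "\<dots> = ennreal (l powr (a - b)) * (\<integral>\<^sup>+y. ennreal (v y powr b) * indicator (ball x R) y \<partial>lborel) + ennreal (l powr a) * emeasure lborel (ball x R)"
  proof -
    have m2: "(\<lambda>y. ennreal (l powr (a - b)) * (ennreal (v y powr b) * indicator (ball x R) y)) \<in> borel_measurable lborel"
      "(\<lambda>y. ennreal (l powr a) * indicator (ball x R) y) \<in> borel_measurable lborel"
      by (intro borel_measurable_times_ennreal borel_measurable_const borel_measurable_indicator bm m1)+
    show ?thesis
      by (simp only: nn_integral_add[OF m2] nn_integral_cmult[OF m1] nn_integral_cmult_indicator[OF bm])
  qed
  also have "\<dots> \<le> ennreal (l powr (a - b)) * ennreal (M powr b * R powr (n - m * b)) + ennreal (l powr a) * ennreal (unit_ball_vol n * R powr n)"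
    using R bound by (intro add_mono mult_left_mono) (auto simp: n_def emeasure_ball powr_realpow)
  also have "\<dots> = ennreal (l powr (a - b) * (M powr b * R powr (n - m * b)) + l powr a * (unit_ball_vol n * R powr n))"
    by (subst ennreal_plus) (auto simp: ennreal_mult n_def)
  also have "l powr (a - b) * (M powr b * R powr (n - m * b)) = (M powr (a - b) * M powr b) * (R powr (- m * (a - b)) * R powr (n - m * b))"
    unfolding lpow by (simp only: mult_ac)
  also have "\<dots> = M powr a * R powr (n - m * a)"
  proof -
    have "- m * (a - b) + (n - m * b) = n - m * a" by (simp add: algebra_simps)
    then show ?thesis by (simp only: powr_add[symmetric] diff_add_cancel)
  qed
  also have "l powr a * (unit_ball_vol n * R powr n) = unit_ball_vol n * (M powr a * (R powr (- m * a) * R powr n))"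
    unfolding lpow by (simp only: mult_ac)
  also have "R powr (- m * a) * R powr n = R powr (n - m * a)"
    by (simp only: powr_add[symmetric]) (simp add: add.commute)
  also have "M powr a * R powr (n - m * a) + unit_ball_vol n * (M powr a * R powr (n - m * a)) =
      (1 + unit_ball_vol n) * M powr a * R powr (n - m * a)"
    by (simp only: distrib_right mult_1_left mult.assoc)
  finally show ?thesis unfolding n_def .
qed

subsection \<open>The refined Hardy--Sobolev inequality\<close>

text \<open>Here \<open>m\<close> is the scaling exponent of \<open>|u| / |y|^r\<close>: the Morrey
  norm of \<open>u\<close> with exponent \<open>p\<close> weighs the integral of
  \<open>(|u| / |y|^r)^p\<close> over a ball by \<open>R powr (p * m - n)\<close>, so all
  \<open>p\<close> share one \<open>m\<close>.\<close>

locale hardy_sobolev_exponents =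
  fixes s \<alpha> n q r m :: real
  assumes s: "0 < s" and \<alpha>: "0 < \<alpha>" "\<alpha> < 2 * s" "2 * s < n"
    and q: "q = 2 * (n - \<alpha>) / (n - 2 * s)"
    and r: "r = \<alpha> / q"
    and m: "m = (n - 2 * s) / 2 + r"
begin

lemma q_gt_2: "q > 2"
  using \<alpha> by (simp add: q field_simps)

lemma r_pos: "r > 0"
  using \<alpha> q_gt_2 by (simp add: r)

lemma m_pos: "m > 0"
  using \<alpha> r_pos unfolding m by (intro add_pos_pos) auto

lemma rq: "r * q = \<alpha>"
  using q_gt_2 by (simp add: r)

lemma q_gap: "(n - 2 * s) * (q - 2) = 2 * (2 * s - \<alpha>)"
  using \<alpha> by (simp add: q field_simps)

text \<open>At the exponent \<open>q\<close> the Morrey weight is trivial, which is why the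
  \<open>L^q\<close> norm of \<open>|u| / |y|^r\<close> controls the Morrey norms.\<close>

lemma mq: "m * q = n"
proof -
  have "(n - 2 * s) * q = 2 * (n - \<alpha>)" using \<alpha> by (simp add: q)
  then show ?thesis using rq by (simp add: m field_simps)
qed

end

text \<open>If \<open>|u x|\<close> is small compared with the Morrey
  bound at scale \<open>|x|\<close>, the Hardy integrand suffices. Otherwise, at the scale \<open>R \<le> |x|\<close> at which the
  Morrey bound makes the mean of \<open>|u|\<close> over \<open>ball x R\<close> a fixed fraction of \<open>|u x|\<close>, the oscillation
  of \<open>u\<close> on this ball is comparable to \<open>|u x|\<close>.\<close>

lemma (in hardy_sobolev_exponents) pointwise_hardy_sobolev:
  fixes u :: "'a::euclidean_space \<Rightarrow> real"
  assumes [measurable]: "u \<in> borel_measurable borel"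
    and n: "n = real DIM('a)" and M: "M > 0"
    and \<omega>: "\<omega> = unit_ball_vol n" and c0: "c0 = 4 * 2 powr r / \<omega>"
    and morrey: "\<And>x R. R > 0 \<Longrightarrow>
      (\<integral>\<^sup>+y. ennreal (\<bar>u y\<bar> / norm y powr r) * indicator (ball x R) y \<partial>lborel) \<le> ennreal (M * R powr (n - m))"
  shows "ennreal (\<bar>u x\<bar> powr q / norm x powr \<alpha>) \<le>
    ennreal ((c0 * M) powr (q - 2)) * (ennreal ((u x)\<^sup>2 / norm x powr (2 * s)) + ennreal (2 / \<omega>) * gagliardo_density s u x)"
\<comment> \<open>At the origin the left-hand side is 0, as a division by 0; an infinite density
  makes the right-hand side infinite, its coefficients being positive.\<close>
proof (cases "x = 0 \<or> u x = 0 \<or> gagliardo_density s u x = \<infinity>")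
  case True
  have \<omega>0: "\<omega> > 0" by (simp add: \<omega> n)
  have "c0 > 0" using \<omega>0 by (simp add: c0)
  then show ?thesis using True M \<omega>0 q_gt_2 by (auto simp: ennreal_mult_top)
next
  case False
  have \<omega>0: "\<omega> > 0" by (simp add: \<omega> n)
  have c00: "c0 > 0" using \<omega>0 by (simp add: c0)
  define \<Lambda> where "\<Lambda> = \<bar>u x\<bar>"
  define \<rho> where "\<rho> = norm x"
  have \<Lambda>: "\<Lambda> > 0" and \<rho>: "\<rho> > 0" using False by (auto simp: \<Lambda>_def \<rho>_def)
  obtain S where S: "S \<ge> 0" "gagliardo_density s u x = ennreal S"
    using False by (cases "gagliardo_density s u x") auto
  have \<Lambda>2: "(u x)\<^sup>2 = \<Lambda>\<^sup>2" by (simp add: \<Lambda>_def)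
  have \<Lambda>q: "\<Lambda> powr q = \<Lambda> powr (q - 2) * \<Lambda>\<^sup>2"
  proof -
    have "\<Lambda> powr q = \<Lambda> powr (q - 2) * \<Lambda> powr 2" by (simp only: powr_add[symmetric]) simp
    then show ?thesis using \<Lambda> by (simp add: powr_numeral)
  qed
  have "\<Lambda> powr q / \<rho> powr \<alpha> \<le> (c0 * M) powr (q - 2) * (\<Lambda>\<^sup>2 / \<rho> powr (2 * s) + 2 / \<omega> * S)"
  \<comment> \<open>Here \<open>r - m = - (n - 2 * s) / 2\<close>. In the small case
    \<open>\<Lambda> powr (q - 2)\<close> supplies exactly the power of \<rho> that turns
    \<open>\<rho> powr (- \<alpha>)\<close> into the Hardy weight.\<close>
  proof (cases "\<Lambda> \<le> c0 * M * \<rho> powr (r - m)")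
    case True
    have "\<Lambda> powr (q - 2) \<le> (c0 * M * \<rho> powr (r - m)) powr (q - 2)"
      using True \<Lambda> q_gt_2 by (intro powr_mono2) auto
    also have "\<dots> = (c0 * M) powr (q - 2) * \<rho> powr (- (2 * s - \<alpha>))"
    proof -
      have "(r - m) * (q - 2) = - (2 * s - \<alpha>)" using q_gap by (simp add: m field_simps)
      then show ?thesis using c00 M by (simp add: powr_mult powr_powr)
    qed
    finally have "\<Lambda> powr q / \<rho> powr \<alpha> \<le> (c0 * M) powr (q - 2) * \<rho> powr (- (2 * s - \<alpha>)) * \<Lambda>\<^sup>2 / \<rho> powr \<alpha>"
      unfolding \<Lambda>q by (intro divide_right_mono mult_right_mono) auto
    also have "\<dots> = (c0 * M) powr (q - 2) * (\<Lambda>\<^sup>2 / \<rho> powr (2 * s))"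
    proof -
      have "\<rho> powr (- (2 * s - \<alpha>)) = \<rho> powr \<alpha> / \<rho> powr (2 * s)" by (simp only: powr_diff[symmetric]) simp
      then show ?thesis using \<rho> by simp
    qed
    also have "\<dots> \<le> (c0 * M) powr (q - 2) * (\<Lambda>\<^sup>2 / \<rho> powr (2 * s) + 2 / \<omega> * S)"
      using S \<omega>0 by (intro mult_left_mono) auto
    finally show ?thesis .
  next
    case big: False
    \<comment> \<open>The radius at which the Morrey bound for the mean of \<open>|u|\<close> equals
      \<open>\<Lambda> / 4\<close>. In \<open>c0\<close> the 4 produces this fraction,
      \<open>2 powr r\<close> comes from \<open>|y| \<le> 2 \<rho>\<close> on the ball, and \<omega>
      from its volume.\<close>
    define R where "R = (c0 * M * \<rho> powr r / \<Lambda>) powr (1 / m)"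
    have R: "R > 0" using c00 M \<rho> \<Lambda> by (simp add: R_def)
    have Rm: "R powr m = c0 * M * \<rho> powr r / \<Lambda>"
      using m_pos c00 M \<rho> \<Lambda> by (simp add: R_def powr_powr)
    \<comment> \<open>A restatement of \<Lambda> exceeding the threshold. It keeps the ball away
      from the origin and inside \<open>|y| \<le> 2 \<rho>\<close>, so the weight can be
      removed.\<close>
    have R\<rho>: "R \<le> \<rho>"
    proof -
      have "c0 * M * \<rho> powr r / \<rho> powr m \<le> \<Lambda>" using big by (simp add: powr_diff)
      then have "R powr m \<le> \<rho> powr m" using \<rho> \<Lambda> unfolding Rm by (simp add: field_simps)
      then show ?thesis using m_pos \<rho> powr_less_mono2[of m \<rho> R] by linarith
    qed
    have mean: "(\<integral>\<^sup>+y. ennreal \<bar>u y\<bar> * indicator (ball x R) y \<partial>lborel) \<le> ennreal (\<Lambda> * \<omega> * R powr n / 4)"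
    proof -
      have "(\<integral>\<^sup>+y. ennreal \<bar>u y\<bar> * indicator (ball x R) y \<partial>lborel) \<le>
        (\<integral>\<^sup>+y. ennreal ((2 * \<rho>) powr r) * (ennreal (\<bar>u y\<bar> / norm y powr r) * indicator (ball x R) y) \<partial>lborel)"
      proof (intro nn_integral_mono)
        fix y
        show "ennreal \<bar>u y\<bar> * indicator (ball x R) y \<le> ennreal ((2 * \<rho>) powr r) * (ennreal (\<bar>u y\<bar> / norm y powr r) * indicator (ball x R) y)"
        proof (cases "y \<in> ball x R")
          case True
          then have d: "norm (x - y) < R" by (simp add: dist_norm)
          have "norm y > 0"
          proof (cases "y = 0")
            case True
            then show ?thesis using d R\<rho> by (simp add: \<rho>_def)
          qed simp
          moreover have "norm y \<le> 2 * \<rho>"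
            using norm_triangle_sub[of y x] d R\<rho> by (simp add: \<rho>_def norm_minus_commute)
          ultimately have "1 \<le> (2 * \<rho>) powr r / norm y powr r"
            using r_pos by (simp add: powr_mono2)
          then have "\<bar>u y\<bar> * 1 \<le> \<bar>u y\<bar> * ((2 * \<rho>) powr r / norm y powr r)" by (intro mult_left_mono) auto
          then have "ennreal \<bar>u y\<bar> \<le> ennreal ((2 * \<rho>) powr r * (\<bar>u y\<bar> / norm y powr r))"
            by (intro ennreal_leI) (simp add: mult_ac)
          then show ?thesis using True by (simp flip: ennreal_mult)
        qed simp
      qed
      also have "\<dots> = ennreal ((2 * \<rho>) powr r) * (\<integral>\<^sup>+y. ennreal (\<bar>u y\<bar> / norm y powr r) * indicator (ball x R) y \<partial>lborel)"
        by (intro nn_integral_cmult borel_measurable_times_ennreal borel_measurable_indicator) auto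
      also have "\<dots> \<le> ennreal ((2 * \<rho>) powr r) * ennreal (M * R powr (n - m))"
        by (intro mult_left_mono morrey R) auto
      also have "\<dots> = ennreal ((2 * \<rho>) powr r * (M * R powr (n - m)))"
        using M by (simp add: ennreal_mult)
      also have "(2 * \<rho>) powr r * (M * R powr (n - m)) = \<Lambda> * \<omega> * R powr n / 4"
      proof -
        have "R powr (n - m) = R powr n / (c0 * M * \<rho> powr r / \<Lambda>)" by (simp add: powr_diff Rm)
        then show ?thesis using M \<rho> \<Lambda> \<omega>0 by (simp add: c0 powr_mult field_simps)
      qed
      finally show ?thesis .
    qed
    have osc: "(\<integral>\<^sup>+y. ennreal ((u y - u x)\<^sup>2) * indicator (ball x R) y \<partial>lborel) \<le> ennreal (R powr (n + 2 * s) * S)"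
    proof -
      let ?k = "\<lambda>h. ennreal ((u (x + h) - u x)\<^sup>2 / norm h powr (n + 2 * s))"
      have "(\<integral>\<^sup>+y. ennreal ((u y - u x)\<^sup>2) * indicator (ball x R) y \<partial>lborel) \<le>
        (\<integral>\<^sup>+y. ennreal (R powr (n + 2 * s)) * ?k (- x + y) \<partial>lborel)"
      proof (intro nn_integral_mono)
        fix y
        show "ennreal ((u y - u x)\<^sup>2) * indicator (ball x R) y \<le> ennreal (R powr (n + 2 * s)) * ?k (- x + y)"
        proof (cases "y \<in> ball x R \<and> y \<noteq> x")
          case True
          then have "norm (y - x) powr (n + 2 * s) \<le> R powr (n + 2 * s)" "norm (y - x) > 0"
            using s by (auto simp: n dist_norm norm_minus_commute intro!: powr_mono2)
          then have "1 \<le> R powr (n + 2 * s) / norm (y - x) powr (n + 2 * s)" by simp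
          then have "(u y - u x)\<^sup>2 * 1 \<le> (u y - u x)\<^sup>2 * (R powr (n + 2 * s) / norm (y - x) powr (n + 2 * s))"
            by (intro mult_left_mono) auto
          then have "ennreal ((u y - u x)\<^sup>2) \<le> ennreal (R powr (n + 2 * s) * ((u y - u x)\<^sup>2 / norm (y - x) powr (n + 2 * s)))"
            by (intro ennreal_leI) (simp add: mult_ac)
          then show ?thesis using True by (simp flip: ennreal_mult)
        qed (auto simp: indicator_def)
      qed
      also have "\<dots> = ennreal (R powr (n + 2 * s)) * (\<integral>\<^sup>+y. ?k (- x + y) \<partial>lborel)"
        by (rule nn_integral_cmult) measurable
      also have "(\<integral>\<^sup>+y. ?k (- x + y) \<partial>lborel) = ennreal S"
        unfolding S(2)[symmetric] gagliardo_density_def n by (rule nn_integral_lborel_translation) measurable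
      finally show ?thesis using S by (simp add: ennreal_mult)
    qed
    have "ennreal (3 / 4 * \<Lambda> * (\<omega> * R powr n)) \<le> ennreal (\<Lambda> * \<omega> * R powr n / 4 + R powr (n + 2 * s) * S / \<Lambda>)"
    proof -
      have bm: "ball x R \<in> sets lborel" by simp
      have m1: "(\<lambda>y. ennreal \<bar>u y\<bar> * indicator (ball x R) y) \<in> borel_measurable lborel"
        "(\<lambda>y. ennreal ((u y - u x)\<^sup>2) * indicator (ball x R) y) \<in> borel_measurable lborel"
        by (intro borel_measurable_times_ennreal borel_measurable_indicator bm; simp)+
      have m2: "(\<lambda>y. ennreal (1 / \<Lambda>) * (ennreal ((u y - u x)\<^sup>2) * indicator (ball x R) y)) \<in> borel_measurable lborel"
        by (intro borel_measurable_times_ennreal borel_measurable_const m1)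
      have "ennreal (3 / 4 * \<Lambda> * (\<omega> * R powr n)) = (\<integral>\<^sup>+y. ennreal (3 / 4 * \<Lambda>) * indicator (ball x R) y \<partial>lborel)"
        using R \<Lambda> \<omega>0 unfolding nn_integral_cmult_indicator[OF bm]
        by (subst ennreal_mult) (auto simp: emeasure_ball \<omega> n powr_realpow)
      also have "\<dots> \<le> (\<integral>\<^sup>+y. ennreal \<bar>u y\<bar> * indicator (ball x R) y + ennreal (1 / \<Lambda>) * (ennreal ((u y - u x)\<^sup>2) * indicator (ball x R) y) \<partial>lborel)"
      proof (intro nn_integral_mono)
        fix y
        \<comment> \<open>By \<open>\<Lambda> \<le> |u y| + d\<close> and
          \<open>d \<le> \<Lambda> / 4 + d^2 / \<Lambda>\<close>. As \<open>|u|\<close> has mean at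
          most \<open>\<Lambda> / 4\<close>, at least half of \<Lambda> is left for the oscillation
          term.\<close>
        have "3 / 4 * \<Lambda> \<le> \<bar>u y\<bar> + 1 / \<Lambda> * (u y - u x)\<^sup>2"
        proof -
          define d where "d = \<bar>u y - u x\<bar>"
          have 1: "\<Lambda> \<le> \<bar>u y\<bar> + d" by (simp add: \<Lambda>_def d_def)
          have "0 \<le> (\<Lambda> / 2 - d)\<^sup>2" by simp
          then have "d * \<Lambda> \<le> \<Lambda>\<^sup>2 / 4 + d\<^sup>2" by (simp add: power2_eq_square algebra_simps)
          then have "d \<le> \<Lambda> / 4 + 1 / \<Lambda> * d\<^sup>2" using \<Lambda> by (simp add: field_simps power2_eq_square)
          then have "3 / 4 * \<Lambda> \<le> \<bar>u y\<bar> + 1 / \<Lambda> * d\<^sup>2" using 1 by linarith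
          then show ?thesis by (simp only: d_def power2_abs)
        qed
        then have "ennreal (3 / 4 * \<Lambda>) \<le> ennreal (\<bar>u y\<bar> + 1 / \<Lambda> * (u y - u x)\<^sup>2)" by (rule ennreal_leI)
        also have "\<dots> = ennreal \<bar>u y\<bar> + ennreal (1 / \<Lambda>) * ennreal ((u y - u x)\<^sup>2)"
        proof -
          have "ennreal (1 / \<Lambda> * (u y - u x)\<^sup>2) = ennreal (1 / \<Lambda>) * ennreal ((u y - u x)\<^sup>2)"
            using \<Lambda> by (intro ennreal_mult) auto
          moreover have "ennreal (\<bar>u y\<bar> + 1 / \<Lambda> * (u y - u x)\<^sup>2) = ennreal \<bar>u y\<bar> + ennreal (1 / \<Lambda> * (u y - u x)\<^sup>2)"
            using \<Lambda> by (intro ennreal_plus) auto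
          ultimately show ?thesis by simp
        qed
        finally show "ennreal (3 / 4 * \<Lambda>) * indicator (ball x R) y \<le>
          ennreal \<bar>u y\<bar> * indicator (ball x R) y + ennreal (1 / \<Lambda>) * (ennreal ((u y - u x)\<^sup>2) * indicator (ball x R) y)"
          by (cases "y \<in> ball x R") auto
      qed
      also have "\<dots> = (\<integral>\<^sup>+y. ennreal \<bar>u y\<bar> * indicator (ball x R) y \<partial>lborel) + ennreal (1 / \<Lambda>) * (\<integral>\<^sup>+y. ennreal ((u y - u x)\<^sup>2) * indicator (ball x R) y \<partial>lborel)"
        by (simp only: nn_integral_add[OF m1(1) m2] nn_integral_cmult[OF m1(2)])
      also have "\<dots> \<le> ennreal (\<Lambda> * \<omega> * R powr n / 4) + ennreal (1 / \<Lambda>) * ennreal (R powr (n + 2 * s) * S)"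
        by (intro add_mono mult_left_mono mean osc) auto
      also have "\<dots> = ennreal (\<Lambda> * \<omega> * R powr n / 4 + R powr (n + 2 * s) * S / \<Lambda>)"
        using \<Lambda> \<omega>0 S by (simp add: ennreal_mult[symmetric])
      finally show ?thesis .
    qed
    then have "3 / 4 * \<Lambda> * (\<omega> * R powr n) \<le> \<Lambda> * \<omega> * R powr n / 4 + R powr (n + 2 * s) * S / \<Lambda>"
      using \<Lambda> \<omega>0 S by (subst (asm) ennreal_le_iff) auto
    then have "\<Lambda> * \<omega> * R powr n / 2 \<le> R powr (n + 2 * s) * S / \<Lambda>"
      by argo
    then have "\<Lambda> * \<omega> * R powr n / 2 \<le> R powr n * R powr (2 * s) * S / \<Lambda>"
      by (simp only: powr_add)
    then have "\<Lambda>\<^sup>2 / R powr (2 * s) \<le> 2 / \<omega> * S"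
      using R \<Lambda> \<omega>0 by (simp add: field_simps power2_eq_square)
    \<comment> \<open>Expressing \<Lambda> through \<open>R\<close> makes this an identity up to the
      factor \<open>(R / \<rho>) powr (2 * r)\<close>, which is at most 1.\<close>
    moreover have "\<Lambda> powr q / \<rho> powr \<alpha> \<le> (c0 * M) powr (q - 2) * (\<Lambda>\<^sup>2 / R powr (2 * s))"
    proof -
      have "\<Lambda> = c0 * M * \<rho> powr r * R powr (- m)"
        using Rm R \<Lambda> by (simp add: powr_minus field_simps)
      then have "\<Lambda> powr (q - 2) = (c0 * M * \<rho> powr r * R powr (- m)) powr (q - 2)" by simp
      also have "\<dots> = (c0 * M) powr (q - 2) * \<rho> powr (r * (q - 2)) * R powr (- m * (q - 2))"
        using c00 M by (simp add: powr_mult powr_powr)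
      also have "r * (q - 2) = \<alpha> - 2 * r" using rq by (simp add: algebra_simps)
      also have "- m * (q - 2) = 2 * r - 2 * s"
      proof -
        have "- m * (q - 2) = 2 * m - m * q" by (simp add: algebra_simps)
        moreover have "2 * m = n - 2 * s + 2 * r" by (simp add: m field_simps)
        ultimately show ?thesis using mq by linarith
      qed
      finally have "\<Lambda> powr q / \<rho> powr \<alpha> = (c0 * M) powr (q - 2) * (\<Lambda>\<^sup>2 / R powr (2 * s)) * (R powr (2 * r) / \<rho> powr (2 * r))"
        unfolding \<Lambda>q using \<rho> R by (simp add: powr_diff mult_ac)
      also have "\<dots> \<le> (c0 * M) powr (q - 2) * (\<Lambda>\<^sup>2 / R powr (2 * s)) * 1"
        using R\<rho> R \<rho> r_pos by (intro mult_left_mono) (auto simp: powr_mono2)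
      finally show ?thesis by simp
    qed
    ultimately have "\<Lambda> powr q / \<rho> powr \<alpha> \<le> (c0 * M) powr (q - 2) * (2 / \<omega> * S)"
      by (meson mult_left_mono order_trans powr_ge_zero)
    also have "\<dots> \<le> (c0 * M) powr (q - 2) * (\<Lambda>\<^sup>2 / \<rho> powr (2 * s) + 2 / \<omega> * S)"
      by (intro mult_left_mono) auto
    finally show ?thesis .
  qed
  then have "ennreal (\<Lambda> powr q / \<rho> powr \<alpha>) \<le> ennreal ((c0 * M) powr (q - 2) * (\<Lambda>\<^sup>2 / \<rho> powr (2 * s) + 2 / \<omega> * S))"
    by (rule ennreal_leI)
  also have "\<dots> = ennreal ((c0 * M) powr (q - 2)) * (ennreal (\<Lambda>\<^sup>2 / \<rho> powr (2 * s)) + ennreal (2 / \<omega>) * ennreal S)"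
  proof -
    have "ennreal (2 / \<omega> * S) = ennreal (2 / \<omega>) * ennreal S"
      using \<omega>0 S by (intro ennreal_mult) auto
    moreover have "ennreal (\<Lambda>\<^sup>2 / \<rho> powr (2 * s) + 2 / \<omega> * S) = ennreal (\<Lambda>\<^sup>2 / \<rho> powr (2 * s)) + ennreal (2 / \<omega> * S)"
      using \<omega>0 S by (intro ennreal_plus) auto
    ultimately show ?thesis using \<omega>0 S by (simp add: ennreal_mult)
  qed
  finally show ?thesis unfolding S(2) \<Lambda>2 \<rho>_def[symmetric] \<Lambda>_def[symmetric] by simp
qed

text \<open>The main hypothesis is the case \<theta> = 2/q. The surplus
  \<open>M powr (\<theta> - 2 / q)\<close> is converted into a power of \<open>H\<close> through
  \<open>M \<le> W * v\<close> and \<open>v \<le> E * H\<close>.\<close>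

lemma interpolation_real:
  fixes v M H D W q \<theta> :: real
  assumes q: "q > 2" and D: "D \<ge> 0" and W: "W \<ge> 1" and pos: "v > 0" "M > 0" "H \<ge> 0"
    and main: "v powr q \<le> D * M powr (q - 2) * H\<^sup>2" and MW: "M \<le> W * v"
    and \<theta>: "2 / q < \<theta>" "\<theta> < 1"
  shows "v \<le> D powr (1 / q) * max 1 (W * sqrt (D * W powr (q - 2))) * H powr \<theta> * M powr (1 - \<theta>)"
proof -
  define E where "E = sqrt (D * W powr (q - 2))"
  have "0 < D * M powr (q - 2) * H\<^sup>2" using pos by (intro less_le_trans[OF _ main]) simp
  then have D0: "D > 0" and H0: "H > 0" using D pos by (auto simp: zero_less_mult_iff)
  have E0: "E > 0" using D0 W by (simp add: E_def)
  \<comment> \<open>The unrefined Hardy-Sobolev inequality: insert \<open>M \<le> W * v\<close> into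
    the main bound and cancel \<open>v powr (q - 2)\<close>.\<close>
  have vE: "v \<le> E * H"
  proof -
    have "v powr (q - 2) * v\<^sup>2 = v powr q"
    proof -
      have "v powr q = v powr (q - 2) * v powr 2" by (simp only: powr_add[symmetric]) simp
      then show ?thesis using pos by (simp add: powr_numeral)
    qed
    also have "\<dots> \<le> D * (W * v) powr (q - 2) * H\<^sup>2"
      using pos MW q D by (intro order_trans[OF main] mult_right_mono mult_left_mono powr_mono2) auto
    also have "\<dots> = v powr (q - 2) * (D * W powr (q - 2) * H\<^sup>2)"
      using pos W by (simp add: powr_mult)
    finally have "v\<^sup>2 \<le> D * W powr (q - 2) * H\<^sup>2" using pos by simp
    also have "\<dots> = (E * H)\<^sup>2" using D by (simp add: E_def power_mult_distrib)
    finally show ?thesis by (rule power2_le_imp_le) (use E0 H0 in simp)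
  qed
  define e where "e = \<theta> - 2 / q"
  have e: "0 < e" "e \<le> 1" using \<theta> divide_pos_pos[of 2 q] q unfolding e_def by linarith+
  have "v = (v powr q) powr (1 / q)" using pos q by (simp add: powr_powr)
  also have "\<dots> \<le> (D * M powr (q - 2) * H\<^sup>2) powr (1 / q)"
    using main q by (intro powr_mono2) auto
  also have "\<dots> = D powr (1 / q) * M powr ((q - 2) * (1 / q)) * H powr (2 / q)"
  proof -
    have "(H\<^sup>2) powr (1 / q) = H powr (2 / q)"
      using H0 powr_powr[of H 2 "1 / q"] by (simp add: powr_numeral)
    then show ?thesis using D0 H0 by (simp add: powr_mult powr_powr)
  qed
  also have "M powr ((q - 2) * (1 / q)) = M powr (1 - \<theta>) * M powr e"
  proof -
    have "(q - 2) * (1 / q) = 1 - \<theta> + e" using q by (simp add: e_def field_simps)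
    then show ?thesis by (simp only: powr_add)
  qed
  also have "D powr (1 / q) * (M powr (1 - \<theta>) * M powr e) * H powr (2 / q) \<le>
     D powr (1 / q) * (M powr (1 - \<theta>) * (max 1 (W * E) * H powr e)) * H powr (2 / q)"
  proof (intro mult_right_mono mult_left_mono)
    have "M powr e \<le> (W * E * H) powr e"
    proof (intro powr_mono2)
      have "W * v \<le> W * (E * H)" using W vE by (intro mult_left_mono) auto
      then show "M \<le> W * E * H" using MW by simp
    qed (use e pos in auto)
    also have "\<dots> = (W * E) powr e * H powr e" using W E0 H0 by (simp add: powr_mult)
    also have "\<dots> \<le> max 1 (W * E) * H powr e"
    proof (intro mult_right_mono)
      \<comment> \<open>Since \<open>0 < e \<le> 1\<close>, the maximum with 1 absorbs the exponent
        and no dependence on \<theta> remains.\<close>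
      have "(W * E) powr e \<le> max 1 (W * E) powr e" using W E0 e by (intro powr_mono2) auto
      also have "\<dots> \<le> max 1 (W * E) powr 1" using e by (intro powr_mono) auto
      finally show "(W * E) powr e \<le> max 1 (W * E)" by simp
    qed simp
    finally show "M powr e \<le> max 1 (W * E) * H powr e" .
  qed auto
  also have "\<dots> = D powr (1 / q) * max 1 (W * E) * (H powr e * H powr (2 / q)) * M powr (1 - \<theta>)"
    by (simp only: mult_ac)
  also have "H powr e * H powr (2 / q) = H powr \<theta>"
    by (simp only: powr_add[symmetric]) (simp add: e_def)
  finally show ?thesis by (simp add: E_def)
qed

text \<open>The left-hand side is the geometric mean of the two terms with weights
  \<open>\<alpha> / (2 * s)\<close> and \<open>1 - \<alpha> / (2 * s)\<close>. The bound is not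
  homogeneous in \<open>a\<close>; it serves to show that the weighted integral is finite.\<close>

lemma (in hardy_sobolev_exponents) hardy_sobolev_integrand_le:
  fixes a b :: real
  assumes b: "b \<ge> 0"
  shows "\<bar>a\<bar> powr q / b powr \<alpha> \<le> a\<^sup>2 / b powr (2 * s) + \<bar>a\<bar> powr (2 * n / (n - 2 * s))"
proof (cases "a = 0 \<or> b = 0")
  case False
  define p where "p = 2 * n / (n - 2 * s)"
  define t where "t = \<alpha> / (2 * s)"
  define A where "A = a\<^sup>2 / b powr (2 * s)"
  define B where "B = \<bar>a\<bar> powr p"
  have t: "0 < t" "t < 1" using \<alpha> s by (auto simp: t_def)
  have A: "A > 0" and B: "B > 0" using False b by (auto simp: A_def B_def)
  have "A = \<bar>a\<bar> powr 2 * b powr (- 2 * s)" using False by (simp add: A_def powr_minus divide_inverse powr_numeral)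
  then have "A powr t * B powr (1 - t) = \<bar>a\<bar> powr (2 * t) * b powr (- 2 * s * t) * \<bar>a\<bar> powr (p * (1 - t))"
    unfolding B_def by (simp add: powr_mult powr_powr del: powr_numeral)
  also have "\<dots> = (\<bar>a\<bar> powr (2 * t) * \<bar>a\<bar> powr (p * (1 - t))) * b powr (- 2 * s * t)" by (simp only: mult_ac)
  also have "\<bar>a\<bar> powr (2 * t) * \<bar>a\<bar> powr (p * (1 - t)) = \<bar>a\<bar> powr q"
  proof -
    have "2 * t + p * (1 - t) = q"
    proof -
      have "(n - 2 * s) * (2 * t + p * (1 - t)) = (n - 2 * s) * q"
      proof -
        have "2 * s * t = \<alpha>" using s by (simp add: t_def)
        moreover have "(n - 2 * s) * p = 2 * n" "(n - 2 * s) * q = 2 * (n - \<alpha>)"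
          using \<alpha> by (simp_all add: p_def q)
        moreover have "(n - 2 * s) * (2 * t + p * (1 - t)) = (n - 2 * s) * p * (1 - t) + 2 * n * t - 2 * (2 * s * t)"
          by (simp add: algebra_simps)
        ultimately show ?thesis by (simp add: algebra_simps)
      qed
      then show ?thesis using \<alpha> by simp
    qed
    then show ?thesis by (simp only: powr_add[symmetric])
  qed
  also have "b powr (- 2 * s * t) = 1 / b powr \<alpha>"
  proof -
    have "- 2 * s * t = - \<alpha>" using s by (simp add: t_def)
    then show ?thesis by (simp only: powr_minus_divide)
  qed
  finally have "\<bar>a\<bar> powr q / b powr \<alpha> = A powr t * B powr (1 - t)" by simp
  also have "\<dots> \<le> max A B powr t * max A B powr (1 - t)"
    using A B t by (intro mult_mono powr_mono2) auto
  also have "\<dots> = max A B" using A by (simp flip: powr_add)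
  also have "\<dots> \<le> A + B" using A B by simp
  finally show ?thesis by (simp add: A_def B_def p_def)
qed auto

lemma (in hardy_sobolev_exponents) refined_hardy_sobolev:
  assumes s1: "s < 1" and n: "n = real DIM('a::euclidean_space)"
  shows "\<exists>C::real. C > 0 \<and>
      (\<forall>\<theta> p. 2 / q < \<theta> \<and> \<theta> < 1 \<and> 1 \<le> p \<and> p < q \<longrightarrow>
        (\<forall>u \<in> (Hdot s :: ('a \<Rightarrow> real) set).
          epowr (\<integral>\<^sup>+ y. ennreal (\<bar>u y\<bar> powr q / norm y powr \<alpha>) \<partial>lebesgue) (1 / q)
          \<le> ennreal (C * Hdot_norm s u powr \<theta>)
             * epowr (morrey_norm p (p * m) (p * r) u) (1 - \<theta>)))"
proof -
  obtain Cg where Cg: "Cg \<ge> 0" "\<And>u g. fourier_pair (u :: 'a \<Rightarrow> real) g \<Longrightarrow>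
       (\<integral>\<^sup>+x. gagliardo_density s u x \<partial>lborel) \<le> ennreal Cg * (\<integral>\<^sup>+\<xi>. ennreal (norm \<xi> powr (2 * s) * (norm (g \<xi>))\<^sup>2) \<partial>lborel)"
    by (rule gagliardo_energy_le_fourier[OF s s1, where 'a='a]) blast
  define pp where "pp = 2 * n / (n - 2 * s)"
  obtain Ch where Ch: "Ch \<ge> 0" "\<And>u :: 'a \<Rightarrow> real. u \<in> borel_measurable borel \<Longrightarrow> (\<integral>\<^sup>+x. ennreal (\<bar>u x\<bar> powr pp) \<partial>lborel) < \<infinity> \<Longrightarrow>
      (\<integral>\<^sup>+x. ennreal ((u x)\<^sup>2 / norm x powr (2 * s)) \<partial>lborel) \<le> ennreal Ch * (\<integral>\<^sup>+x. gagliardo_density s u x \<partial>lborel)"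
    by (rule hardy_inequality[where 'a='a and s=s and p=pp]) (use s \<alpha> n in \<open>auto simp: pp_def\<close>)
  define \<omega> where "\<omega> = unit_ball_vol n"
  have \<omega>: "\<omega> > 0" by (simp add: \<omega>_def n)
  define W where "W = 1 + \<omega>"
  have W: "W \<ge> 1" using \<omega> by (simp add: W_def)
  define c0 where "c0 = 4 * 2 powr r / \<omega>"
  have c0: "c0 > 0" using \<omega> by (simp add: c0_def)
  define C1 where "C1 = (Ch + 2 / \<omega>) * Cg"
  have C1: "C1 \<ge> 0" using Ch Cg \<omega> by (simp add: C1_def)
  \<comment> \<open>The factor \<open>W\<close> accounts for passing from exponent \<open>p\<close>
    to exponent 1 before the pointwise estimate is applied.\<close>
  define D where "D = (c0 * W) powr (q - 2) * C1"
  have D: "D \<ge> 0" using C1 by (simp add: D_def)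
  define C where "C = D powr (1 / q) * max 1 (W * sqrt (D * W powr (q - 2)))"
  have C: "C \<ge> 0" by (simp add: C_def)
  have main: "epowr (\<integral>\<^sup>+ y. ennreal (\<bar>u y\<bar> powr q / norm y powr \<alpha>) \<partial>lebesgue) (1 / q)
          \<le> ennreal ((C + 1) * Hdot_norm s u powr \<theta>)
             * epowr (morrey_norm p (p * m) (p * r) u) (1 - \<theta>)"
    if \<theta>: "2 / q < \<theta>" "\<theta> < 1" and p: "1 \<le> p" "p < q" and uH: "u \<in> Hdot s" for \<theta> p and u :: "'a \<Rightarrow> real"
  proof -
    define H where "H = Hdot_norm s u"
    have H: "H \<ge> 0" unfolding H_def Hdot_norm_def by (intro real_sqrt_ge_zero integral_nonneg_AE) auto
    obtain u0 g where fp: "fourier_pair u0 g" and ae: "AE x in lebesgue. u x = u0 x"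
      and HI: "(\<integral>\<^sup>+\<xi>. ennreal (norm \<xi> powr (2 * s) * (norm (g \<xi>))\<^sup>2) \<partial>lborel) = ennreal (H\<^sup>2)"
      and up: "(\<integral>\<^sup>+x. ennreal (\<bar>u0 x\<bar> powr pp) \<partial>lborel) < \<infinity>"
      using Hdot_borel_representative[OF uH] unfolding H_def pp_def n by blast
    interpret fourier_pair u0 g by (rule fp)
    define J where "J = (\<integral>\<^sup>+x. gagliardo_density s u0 x \<partial>lborel)"
    define I where "I = (\<integral>\<^sup>+x. ennreal ((u0 x)\<^sup>2 / norm x powr (2 * s)) \<partial>lborel)"
    have J: "J \<le> ennreal (Cg * H\<^sup>2)" using Cg(2)[OF fp] Cg(1) unfolding J_def HI by (simp add: ennreal_mult)
    have I: "I \<le> ennreal (Ch * (Cg * H\<^sup>2))"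
    proof -
      have "I \<le> ennreal Ch * J" unfolding I_def J_def by (rule Ch(2)[OF u_meas up])
      also have "\<dots> \<le> ennreal Ch * ennreal (Cg * H\<^sup>2)" by (intro mult_left_mono J) auto
      finally show ?thesis using Ch Cg by (simp add: ennreal_mult)
    qed
    define v where "v x = \<bar>u0 x\<bar> / norm x powr r" for x
    have v0: "v x \<ge> 0" for x by (simp add: v_def)
    have vm [measurable]: "v \<in> borel_measurable borel" unfolding v_def by measurable
    have vpow: "v x powr e = \<bar>u0 x\<bar> powr e / norm x powr (e * r)" for x e
      by (simp add: v_def powr_divide powr_powr mult.commute)
    have vq: "v x powr q = \<bar>u0 x\<bar> powr q / norm x powr \<alpha>" for x
      using vpow[of x q] rq by (simp add: mult.commute)
    define V where "V = (\<integral>\<^sup>+x. ennreal (v x powr q) \<partial>lborel)"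
    have V_lhs: "(\<integral>\<^sup>+ y. ennreal (\<bar>u y\<bar> powr q / norm y powr \<alpha>) \<partial>lebesgue) = V"
    proof -
      have "(\<integral>\<^sup>+ y. ennreal (\<bar>u y\<bar> powr q / norm y powr \<alpha>) \<partial>lebesgue) = (\<integral>\<^sup>+ y. ennreal (v y powr q) \<partial>lebesgue)"
        unfolding vq by (intro nn_integral_cong_AE, use ae in eventually_elim) simp
      then show ?thesis by (simp add: V_def nn_integral_completion)
    qed
    have "V \<le> (\<integral>\<^sup>+x. ennreal ((u0 x)\<^sup>2 / norm x powr (2 * s)) + ennreal (\<bar>u0 x\<bar> powr pp) \<partial>lborel)"
      unfolding V_def vq
    proof (intro nn_integral_mono)
      fix x
      show "ennreal (\<bar>u0 x\<bar> powr q / norm x powr \<alpha>) \<le> ennreal ((u0 x)\<^sup>2 / norm x powr (2 * s)) + ennreal (\<bar>u0 x\<bar> powr pp)"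
        using hardy_sobolev_integrand_le[of "norm x" "u0 x"] unfolding pp_def
        by (subst ennreal_plus[symmetric]) (auto intro!: ennreal_leI simp del: ennreal_plus)
    qed
    also have "\<dots> = I + (\<integral>\<^sup>+x. ennreal (\<bar>u0 x\<bar> powr pp) \<partial>lborel)"
      unfolding I_def by (rule nn_integral_add) measurable
    also have "\<dots> < \<infinity>" using up I by (auto simp: less_top[symmetric] top_unique)
    finally have Vfin: "V < \<infinity>" .
    then obtain V' where V': "V' \<ge> 0" "V = ennreal V'" by (cases V) auto
    define w where "w = V' powr (1 / q)"
    have w0: "w \<ge> 0" by (simp add: w_def)
    have wq: "w powr q = V'" using V' q_gt_2 by (cases "V' = 0") (auto simp: w_def powr_powr)
    have LHS: "epowr V (1 / q) = ennreal w" using V' by (simp add: epowr_ennreal w_def)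
    define Mp where "Mp = morrey_norm p (p * m) (p * r) u"
    have Mp_u0: "Mp = morrey_norm p (p * m) (p * r) u0" unfolding Mp_def by (rule morrey_norm_cong_AE[OF ae])
    define X where "X x R = (\<integral>\<^sup>+y. ennreal (v y powr p) * indicator (ball x R) y \<partial>lborel)" for x R
    have Mp: "Mp = (SUP (R, x) \<in> {0<..} \<times> UNIV. epowr (ennreal (R powr (p * m - n)) * X x R) (1 / p))"
      unfolding Mp_u0 morrey_norm_def morrey_integral_lborel X_def vpow n ..
    show ?thesis
    proof (cases "w = 0")
      case True
      then show ?thesis unfolding V_lhs LHS by simp
    next
      case False
      then have w: "w > 0" using w0 by simp
      \<comment> \<open>The change of exponent from \<open>q\<close> to \<open>p\<close>, with
        \<open>m * q = n\<close>: the \<open>L^q\<close> bound holds on every ball without a power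
        of the radius. In particular the Morrey norm is finite.\<close>
      have Mp_le: "Mp \<le> ennreal (W * w)"
      proof -
        have "epowr (ennreal (R powr (p * m - n)) * X x R) (1 / p) \<le> ennreal (W * w)" if R: "R > 0" for R x
        proof -
        have "X x R \<le> ennreal ((1 + unit_ball_vol DIM('a)) * w powr p * R powr (real DIM('a) - m * p))"
          unfolding X_def
        proof (rule morrey_exponent_change[where b=q])
          have "(\<integral>\<^sup>+y. ennreal (v y powr q) * indicator (ball x R) y \<partial>lborel) \<le> V"
            unfolding V_def by (intro nn_integral_mono) (auto simp: indicator_def)
          also have "V = ennreal (w powr q * R powr (real DIM('a) - m * q))"
            using mq n R by (simp add: V' wq)
          finally show "(\<integral>\<^sup>+y. ennreal (v y powr q) * indicator (ball x R) y \<partial>lborel) \<le> ennreal (w powr q * R powr (real DIM('a) - m * q))" .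
        qed (use v0 p R w in auto)
        then have X: "X x R \<le> ennreal (W * w powr p * R powr (n - m * p))" by (simp add: W_def \<omega>_def n)
        have "ennreal (R powr (p * m - n)) * X x R \<le> ennreal (R powr (p * m - n)) * ennreal (W * w powr p * R powr (n - m * p))"
          by (intro mult_left_mono X) auto
        also have "\<dots> = ennreal (W * w powr p)"
        proof -
          have "R powr (p * m - n) * R powr (n - m * p) = 1"
            using R by (simp flip: powr_add)
          then have "R powr (p * m - n) * (W * w powr p * R powr (n - m * p)) = W * w powr p"
            by (simp add: mult_ac)
          then show ?thesis using W by (simp flip: ennreal_mult)
        qed
        finally have "epowr (ennreal (R powr (p * m - n)) * X x R) (1 / p) \<le> epowr (ennreal (W * w powr p)) (1 / p)"
          using p by (intro epowr_mono) auto
        also have "\<dots> = ennreal (W powr (1 / p) * w)"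
          using W w p by (simp add: epowr_ennreal powr_mult powr_powr)
        \<comment> \<open>As \<open>W \<ge> 1\<close> and \<open>p \<ge> 1\<close>, the root of
          \<open>W\<close> is at most \<open>W\<close>, which frees the constant from
          \<open>p\<close>.\<close>
        also have "\<dots> \<le> ennreal (W * w)"
          using W w p powr_mono[of "1 / p" 1 W] by (intro ennreal_leI mult_right_mono) auto
        finally show ?thesis .
        qed
        then show ?thesis unfolding Mp by (intro SUP_least) auto
      qed
      then obtain M where M: "M \<ge> 0" "Mp = ennreal M"
        by (cases Mp) (auto simp: top_unique)
      have MW: "M \<le> W * w" using Mp_le M W w by (simp add: ennreal_le_iff)
      \<comment> \<open>Stated for every positive \<open>t \<ge> M\<close>, because the pointwise
        estimate needs a positive Morrey bound and \<open>M = 0\<close> is not excluded yet.\<close>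
      have step: "w powr q \<le> D * t powr (q - 2) * H\<^sup>2" if t: "t > 0" "M \<le> t" for t
      proof -
        have X: "X x R \<le> ennreal (t powr p * R powr (n - m * p))" if R: "R > 0" for x R
        proof -
          have "epowr (ennreal (R powr (p * m - n)) * X x R) (1 / p) \<le> Mp"
            unfolding Mp using R by (intro SUP_upper2[of "(R, x)"]) auto
          then have le: "epowr (ennreal (R powr (p * m - n)) * X x R) (1 / p) \<le> ennreal t"
            using M t by (auto intro: order_trans ennreal_leI)
          then have "ennreal (R powr (p * m - n)) * X x R \<noteq> \<infinity>"
            by (auto simp: epowr_def top_unique split: if_splits)
          then have "X x R \<noteq> \<infinity>" using R by (auto simp: ennreal_mult_eq_top_iff)
          then obtain \<xi> where \<xi>: "\<xi> \<ge> 0" "X x R = ennreal \<xi>" by (cases "X x R") auto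
          have "ennreal ((R powr (p * m - n) * \<xi>) powr (1 / p)) \<le> ennreal t"
            using le \<xi> epowr_ennreal[of "R powr (p * m - n) * \<xi>"] by (simp add: ennreal_mult)
          then have "(R powr (p * m - n) * \<xi>) powr (1 / p) \<le> t" using t by (simp add: ennreal_le_iff)
          then have "((R powr (p * m - n) * \<xi>) powr (1 / p)) powr p \<le> t powr p"
            using p by (intro powr_mono2) auto
          then have le2: "R powr (p * m - n) * \<xi> \<le> t powr p"
            using p \<xi> R by (cases "\<xi> = 0") (auto simp: powr_powr)
          have "R powr (n - m * p) * R powr (p * m - n) = 1" using R by (simp flip: powr_add)
          then have "\<xi> = R powr (n - m * p) * (R powr (p * m - n) * \<xi>)" by (simp flip: mult.assoc)
          also have "\<dots> \<le> R powr (n - m * p) * t powr p" by (intro mult_left_mono le2) auto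
          finally show ?thesis using \<xi> by (auto simp: mult.commute intro!: ennreal_leI)
        qed
        \<comment> \<open>The change of exponent from \<open>p\<close> to 1, the form used by the
          pointwise estimate.\<close>
        have morrey: "(\<integral>\<^sup>+y. ennreal (\<bar>u0 y\<bar> / norm y powr r) * indicator (ball x R) y \<partial>lborel) \<le> ennreal (W * t * R powr (n - m))"
          if R: "R > 0" for x R
        proof -
          have "(\<integral>\<^sup>+y. ennreal (v y powr 1) * indicator (ball x R) y \<partial>lborel) \<le>
            ennreal ((1 + unit_ball_vol DIM('a)) * t powr 1 * R powr (real DIM('a) - m * 1))"
            by (rule morrey_exponent_change[where b=p]) (use v0 p R t X[OF R, of x] in \<open>auto simp: X_def n\<close>)
          then show ?thesis using v0 t by (simp add: W_def \<omega>_def n v_def)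
        qed
        have Wt: "W * t > 0" using W t by simp
        have "V \<le> (\<integral>\<^sup>+x. ennreal ((c0 * (W * t)) powr (q - 2)) * (ennreal ((u0 x)\<^sup>2 / norm x powr (2 * s)) + ennreal (2 / \<omega>) * gagliardo_density s u0 x) \<partial>lborel)"
          unfolding V_def vq
          by (intro nn_integral_mono pointwise_hardy_sobolev[OF u_meas n Wt \<omega>_def c0_def morrey])
        also have "\<dots> = ennreal ((c0 * (W * t)) powr (q - 2)) * (I + ennreal (2 / \<omega>) * J)"
          unfolding I_def J_def by (simp add: nn_integral_cmult nn_integral_add)
        also have "\<dots> \<le> ennreal ((c0 * (W * t)) powr (q - 2)) * (ennreal (Ch * (Cg * H\<^sup>2)) + ennreal (2 / \<omega>) * ennreal (Cg * H\<^sup>2))"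
          by (intro mult_left_mono add_mono I J) auto
        also have "ennreal (Ch * (Cg * H\<^sup>2)) + ennreal (2 / \<omega>) * ennreal (Cg * H\<^sup>2) = ennreal (C1 * H\<^sup>2)"
        proof -
          have "ennreal (2 / \<omega>) * ennreal (Cg * H\<^sup>2) = ennreal (2 / \<omega> * (Cg * H\<^sup>2))"
            using \<omega> Cg by (intro ennreal_mult[symmetric]) auto
          moreover have "ennreal (Ch * (Cg * H\<^sup>2)) + ennreal (2 / \<omega> * (Cg * H\<^sup>2)) = ennreal (Ch * (Cg * H\<^sup>2) + 2 / \<omega> * (Cg * H\<^sup>2))"
            using \<omega> Cg Ch by (intro ennreal_plus[symmetric]) auto
          moreover have "Ch * (Cg * H\<^sup>2) + 2 / \<omega> * (Cg * H\<^sup>2) = C1 * H\<^sup>2" by (simp add: C1_def algebra_simps)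
          ultimately show ?thesis by simp
        qed
        also have "ennreal ((c0 * (W * t)) powr (q - 2)) * ennreal (C1 * H\<^sup>2) = ennreal ((c0 * (W * t)) powr (q - 2) * (C1 * H\<^sup>2))"
          using C1 by (intro ennreal_mult[symmetric]) auto
        also have "(c0 * (W * t)) powr (q - 2) * (C1 * H\<^sup>2) = D * t powr (q - 2) * H\<^sup>2"
          using c0 W t by (simp add: D_def powr_mult)
        finally show ?thesis using V' D wq by (simp add: ennreal_le_iff)
      qed
      have Mpos: "M > 0"
      proof (rule ccontr)
        assume "\<not> M > 0"
        then have M0: "M = 0" using M by simp
        define Y where "Y = D * H\<^sup>2"
        have Y: "Y \<ge> 0" using D by (simp add: Y_def)
        \<comment> \<open>Small enough that \<open>step\<close> would bound \<open>w powr q\<close>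
          by less than half of itself; the added 1 avoids dividing by 0 when
          \<open>Y = 0\<close>.\<close>
        define t where "t = (w powr q / (2 * (Y + 1))) powr (1 / (q - 2))"
        have t: "t > 0" using w Y by (simp add: t_def)
        have "t powr (q - 2) = w powr q / (2 * (Y + 1))"
          using q_gt_2 w Y by (simp add: t_def powr_powr)
        then have "w powr q \<le> Y * (w powr q / (2 * (Y + 1)))"
          using step[OF t] M0 t by (simp add: Y_def mult_ac)
        then have "w powr q * (2 * (Y + 1)) \<le> w powr q * Y"
          using Y by (simp add: field_simps)
        then have "2 * (Y + 1) \<le> Y" using w by simp
        then show False using Y by simp
      qed
      have "w \<le> C * H powr \<theta> * M powr (1 - \<theta>)"
        unfolding C_def by (rule interpolation_real[OF q_gt_2 D W w Mpos H step[OF Mpos order_refl] MW \<theta>])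
      \<comment> \<open>\<open>C\<close> is 0 when \<open>D\<close> is, whereas a positive constant
        has to be produced.\<close>
      also have "\<dots> \<le> (C + 1) * H powr \<theta> * M powr (1 - \<theta>)"
        by (intro mult_right_mono) auto
      finally have "ennreal w \<le> ennreal ((C + 1) * H powr \<theta> * M powr (1 - \<theta>))" by (rule ennreal_leI)
      also have "\<dots> = ennreal ((C + 1) * H powr \<theta>) * ennreal (M powr (1 - \<theta>))"
        using C by (intro ennreal_mult) auto
      finally show ?thesis
        unfolding V_lhs LHS H_def[symmetric] Mp_def[symmetric] M(2) epowr_ennreal[OF M(1)] .
    qed
  qed
  show ?thesis
    by (rule exI[of _ "C + 1"]) (use C main in auto)
qed

theorem proposition1p3:
  fixes s \<alpha> n two_star two_star_\<alpha> r \<theta>_bar :: real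
  assumes n: "n = real CARD('n::finite)"
    and s: "0 < s" "s < 1"
    and \<alpha>: "0 < \<alpha>" "\<alpha> < 2 * s" "2 * s < n"
    and two_star: "two_star = 2 * n / (n - 2 * s)"
    and two_star_\<alpha>: "two_star_\<alpha> = 2 * (n - \<alpha>) / (n - 2 * s)"
    and r: "r = \<alpha> / two_star_\<alpha>"
    and \<theta>_bar: "\<theta>_bar = max (2 / two_star_\<alpha>) ((two_star - 1) / two_star_\<alpha>)"
  shows "\<theta>_bar > 0 \<and>
    (\<exists>C::real. C > 0 \<and>
      (\<forall>\<theta> p. \<theta>_bar < \<theta> \<and> \<theta> < 1 \<and> 1 \<le> p \<and> p < two_star_\<alpha> \<longrightarrow>
        (\<forall>u \<in> (Hdot s :: (real ^ 'n \<Rightarrow> real) set).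
          epowr (\<integral>\<^sup>+ y. ennreal (\<bar>u y\<bar> powr two_star_\<alpha> / norm y powr \<alpha>) \<partial>lebesgue) (1 / two_star_\<alpha>)
          \<le> ennreal (C * Hdot_norm s u powr \<theta>)
             * epowr (morrey_norm p ((n - 2 * s) / 2 * p + p * r) (p * r) u) (1 - \<theta>))))"
proof -
  \<comment> \<open>With this \<open>m\<close> the product \<open>p * m\<close> is the exponent
    \<gamma> + \<lambda> of the Morrey space.\<close>
  interpret hardy_sobolev_exponents s \<alpha> n two_star_\<alpha> r "(n - 2 * s) / 2 + r"
    by unfold_locales (use s \<alpha> two_star_\<alpha> r in auto)
  have "n = real DIM(real ^ 'n)" by (simp add: n)
  from refined_hardy_sobolev[OF \<open>s < 1\<close> this]
  obtain C where C: "C > 0" "\<And>\<theta> p (u :: real ^ 'n \<Rightarrow> real). 2 / two_star_\<alpha> < \<theta> \<Longrightarrow> \<theta> < 1 \<Longrightarrow> 1 \<le> p \<Longrightarrow> p < two_star_\<alpha> \<Longrightarrow> u \<in> Hdot s \<Longrightarrow>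
      epowr (\<integral>\<^sup>+ y. ennreal (\<bar>u y\<bar> powr two_star_\<alpha> / norm y powr \<alpha>) \<partial>lebesgue) (1 / two_star_\<alpha>)
          \<le> ennreal (C * Hdot_norm s u powr \<theta>)
             * epowr (morrey_norm p (p * ((n - 2 * s) / 2 + r)) (p * r) u) (1 - \<theta>)"
    by blast
  have eq: "p * ((n - 2 * s) / 2 + r) = (n - 2 * s) / 2 * p + p * r" for p
    by (simp add: algebra_simps)
  have "2 / two_star_\<alpha> > 0" using q_gt_2 by simp
  then have "\<theta>_bar > 0" unfolding \<theta>_bar by (rule less_le_trans) simp
  moreover have "2 / two_star_\<alpha> < \<theta>" if "\<theta>_bar < \<theta>" for \<theta>
    using that unfolding \<theta>_bar by simp
  ultimately show ?thesis
    using C unfolding eq by blast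
qed

end
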